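(* Let $\alpha,\beta_+,\beta_->0$, let $X=(X_t)_{t\ge0}$ be a $\mathrm{Bil}\Gamma(\alpha,\beta_+,\alpha,\beta_-)$ bilateral gamma process and $T$ an $\mathrm{LGNBC}(\mathbb R_+)$ subordinator independent of $X$ with quadruplet $(c,1/\alpha,0,\pi)$, satisfying $\int_0^1\pi(dq)=\vartheta>0$ and $c\,\alpha\ge\vartheta$. Then $Y=X_T$ is a Thorin process on $\mathbb R$ with Thorin triplet $(c',0,\tau)$ given by $$c'=\int_{\{|x|\ge1\}}\frac{\tau(dx)}{x},$$ $$\tau_+=(f_\sharp\pi)^{\beta_0}+(c\,\alpha-\vartheta)\delta_{\beta_+},\qquad\tau_-=(f_\sharp\pi)^{-\beta_0}+(c\,\alpha-\vartheta)\delta_{\beta_-},$$ with $\beta_0=(\beta_--\beta_+)/2$ and $f:[0,1]\to[|\beta_0|,(\beta_++\beta_-)/2]$ defined as $$f(x)=\frac12\sqrt{(\beta_++\beta_-)^2-4\beta_+\beta_-x}.$$ Furthermore, $\operatorname{supp}\tau\subseteq[-\beta_-,\beta_+]$ and $Y\in\mathrm{BG}_0(2c\,\alpha,\mathbb R)$.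
   Context: $\mathrm{Bil}\Gamma(\alpha,\beta_+,\alpha,\beta_-)$ process: Lévy process with $E[e^{izX_1}]=(1-iz/\beta_+)^{-\alpha}(1+iz/\beta_-)^{-\alpha}$ (zero drift; Lévy density $\alpha x^{-1}e^{-\beta_+x}$ for $x>0$ and $\alpha|x|^{-1}e^{-\beta_-|x|}$ for $x<0$). Generalized negative binomial convolutions: $\mathrm{GNBC}(\mathbb R_+)$ is the class of weak limits of finite convolutions of negative binomial laws on $\mathbb N$ (probability generating function (p.g.f.) $(\frac{1-p}{1-pz})^{\beta'}$, $p\in(0,1)$, $\beta'>0$). Its members have p.g.f. $\varphi_0(z)=\exp\bigl(a(z-1)+\int_0^1\log\frac{1-q}{1-qz}\,\pi(dq)\bigr)$, with $a\ge0$ and $\pi$ a measure on $[0,1]$ with $\int_0^{1/2}q\,\pi(dq)<\infty$, $\int_{1/2}^1|\log(1-q)|\pi(dq)<\infty$ (in particular $\pi(\{1\})=0$). $\mathrm{LGNBC}(\mathbb R_+)$ with quadruplet $(c,\alpha_0,a,\pi)$, $c,\alpha_0>0$, is the law with p.g.f. $E[z^{T_1}]=z^c\varphi_0(z^{\alpha_0})$; it is infinitely divisible, and an LGNBC subordinator is a Lévy process $T$ with $\mathcal L(T_1)$ of this form. (So $T_t\stackrel d= ct+\alpha_0 N_t$ with $N$ a Lévy process whose unit-time law is the GNBC law.) A Thorin process on $\mathbb R$ is a Lévy process $Y$ such that $\mathcal L(Y_1)$ is a weak limit of finite convolutions of laws of $Vx$ ($V$ gamma, $x\in\mathbb R\setminus\{0\}$).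 It has Thorin triplet $(b,0,\tau)$ if $\log E[e^{izY_1}]=izb-\int_{\mathbb R}\bigl(\log(1-\frac{iz}{x})+\frac{iz}{x}\mathbf 1_{\{|x|\ge1\}}\bigr)\tau(dx)$, where $\tau(B)=\tau_+(B\cap(0,\infty))+\tau_-((-B)\cap(0,\infty))$ with $\tau_\pm$ measures on $(0,\infty)$ and $\int_{\{|x|\le1\}}(1+|\log|x||)\tau(dx)+\int_{\{|x|>1\}}x^{-2}\tau(dx)<\infty$; its Lévy density is $k(x)/|x|$ with $k(x)=\int_0^\infty e^{-s|x|}\tau_\pm(ds)$ for $\pm x>0$. $f_\sharp\pi(B)=\pi(f^{-1}(B))$; $\eta^c(B)=\eta(B+c)$ is the left translation of a measure $\eta$ by $c$ (pushforward under $x\mapsto x-c$). $Y\in\mathrm{BG}_0(\zeta,\mathbb R)$ means that $Y$ is self-decomposable with Blumenthal--Getoor index $\inf\{p>0:\int_{\{|x|\le1\}}|x|^p\nu(dx)<\infty\}=0$ and $0<\zeta=k(0+)+k(0-)<\infty$; for Thorin processes $k(0+)+k(0-)=\tau_+((0,\infty))+\tau_-((0,\infty))$. *)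

theory Defs
  imports "HOL-Probability.Probability"
begin

section \<open>Real-valued Levy processes\<close>

text \<open>A process is a family \<open>X t\<close> of random variables; only indices \<open>t \<ge> 0\<close> matter.\<close>

definition cadlag :: "(real \<Rightarrow> real) \<Rightarrow> bool" where
  "cadlag x \<longleftrightarrow>
     (\<forall>t\<ge>0. (x \<longlongrightarrow> x t) (at_right t)) \<and> (\<forall>t>0. \<exists>l. (x \<longlongrightarrow> l) (at_left t))"

text \<open>Stochastic continuity is not listed: it follows from the stationarity of the increments
  together with the right-continuity of almost all paths.\<close>

definition levy_process :: "'a measure \<Rightarrow> (real \<Rightarrow> 'a \<Rightarrow> real) \<Rightarrow> bool" where
  "levy_process M X \<longleftrightarrow>
     prob_space M \<and>
     (\<forall>t\<ge>0. X t \<in> borel_measurable M) \<and>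
     (AE \<omega> in M. X 0 \<omega> = 0) \<and>
     (\<forall>(n::nat) (t::nat \<Rightarrow> real). 0 \<le> t 0 \<and> (\<forall>i<n. t i \<le> t (Suc i)) \<longrightarrow>
        prob_space.indep_vars M (\<lambda>_. borel) (\<lambda>i \<omega>. X (t (Suc i)) \<omega> - X (t i) \<omega>) {..<n}) \<and>
     (\<forall>s\<ge>0. \<forall>t\<ge>0. distr M borel (\<lambda>\<omega>. X (s + t) \<omega> - X s \<omega>) = distr M borel (X t)) \<and>
     (AE \<omega> in M. cadlag (\<lambda>t. X t \<omega>))"

text \<open>Independence of the sigma-algebras generated by the two families indexed by \<open>[0, \<infinity>)\<close>.\<close>

definition indep_processes ::
    "'a measure \<Rightarrow> (real \<Rightarrow> 'a \<Rightarrow> real) \<Rightarrow> (real \<Rightarrow> 'a \<Rightarrow> real) \<Rightarrow> bool" where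
  "indep_processes M X T \<longleftrightarrow>
     prob_space.indep_var M
       (\<Pi>\<^sub>M t\<in>{0..}. borel) (\<lambda>\<omega>. \<lambda>t\<in>{0..}. X t \<omega>)
       (\<Pi>\<^sub>M t\<in>{0..}. borel) (\<lambda>\<omega>. \<lambda>t\<in>{0..}. T t \<omega>)"

text \<open>The Levy measure, through the Levy--Khintchine formula (drift \<open>b\<close>, Gaussian variance
  \<open>s\<close>, truncation function \<open>1\<^bsub>|x| \<le> 1\<^esub>\<close>).\<close>

definition has_levy_measure ::
    "'a measure \<Rightarrow> (real \<Rightarrow> 'a \<Rightarrow> real) \<Rightarrow> real measure \<Rightarrow> bool" where
  "has_levy_measure M Y \<nu> \<longleftrightarrow>
     sets \<nu> = sets borel \<and> emeasure \<nu> {0} = 0 \<and>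
     (\<integral>\<^sup>+x. ennreal (min 1 (x\<^sup>2)) \<partial>\<nu>) < \<infinity> \<and>
     (\<exists>b s. 0 \<le> s \<and> (\<forall>z. char (distr M borel (Y 1)) z =
        exp (\<i> * of_real (z * b) - of_real (s * z\<^sup>2 / 2) +
             (CLINT x|\<nu>. iexp (z * x) - 1 - \<i> * of_real (z * x * indicator {-1..1} x)))))"

definition blumenthal_getoor_index :: "real measure \<Rightarrow> real" where
  "blumenthal_getoor_index \<nu> =
     Inf {p. 0 < p \<and> (\<integral>\<^sup>+x\<in>{-1..1}. ennreal (\<bar>x\<bar> powr p) \<partial>\<nu>) < \<infinity>}"

definition self_decomposable :: "real measure \<Rightarrow> bool" where
  "self_decomposable \<mu> \<longleftrightarrow> real_distribution \<mu> \<and>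
     (\<forall>b>1. \<exists>\<rho>. real_distribution \<rho> \<and> (\<forall>z. char \<mu> z = char \<mu> (z / b) * char \<rho> z))"

text \<open>The class \<open>BG\<^sub>0(\<zeta>, \<real>)\<close>. The monotonicity imposed on the canonical function
  \<open>k\<close>, which holds for some version of it whenever the law is self-decomposable, makes the
  limits \<open>k(0+)\<close> and \<open>k(0-)\<close> independent of the version.\<close>

definition BG0 :: "'a measure \<Rightarrow> (real \<Rightarrow> 'a \<Rightarrow> real) \<Rightarrow> real \<Rightarrow> bool" where
  "BG0 M Y \<zeta> \<longleftrightarrow>
     levy_process M Y \<and> self_decomposable (distr M borel (Y 1)) \<and>
     (\<exists>\<nu> k kp km.
        has_levy_measure M Y \<nu> \<and>
        blumenthal_getoor_index \<nu> = 0 \<and>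
        k \<in> borel_measurable borel \<and> (\<forall>x. 0 \<le> k x) \<and>
        antimono_on {0<..} k \<and> mono_on {..<0} k \<and>
        \<nu> = density lborel (\<lambda>x. ennreal (k x / \<bar>x\<bar>)) \<and>
        (k \<longlongrightarrow> kp) (at_right 0) \<and> (k \<longlongrightarrow> km) (at_left 0) \<and>
        \<zeta> = kp + km \<and> 0 < \<zeta>)"


section \<open>Bilateral gamma processes\<close>

definition bilateral_gamma_process ::
    "'a measure \<Rightarrow> (real \<Rightarrow> 'a \<Rightarrow> real) \<Rightarrow> real \<Rightarrow> real \<Rightarrow> real \<Rightarrow> real \<Rightarrow> bool" where
  "bilateral_gamma_process M X \<alpha>p \<beta>p \<alpha>m \<beta>m \<longleftrightarrow>
     0 < \<alpha>p \<and> 0 < \<beta>p \<and> 0 < \<alpha>m \<and> 0 < \<beta>m \<and> levy_process M X \<and>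
     (\<forall>z. char (distr M borel (X 1)) z =
        (1 - \<i> * of_real (z / \<beta>p)) powr (- of_real \<alpha>p) *
        (1 + \<i> * of_real (z / \<beta>m)) powr (- of_real \<alpha>m))"


section \<open>LGNBC subordinators\<close>

text \<open>\<open>\<pi>\<close> is a Borel measure on the real line concentrated on \<open>[0, 1]\<close>. The condition
  \<open>\<pi>({1}) = 0\<close> has to be explicit because here \<open>ln 0 = 0\<close>.\<close>

definition gnbc_measure :: "real measure \<Rightarrow> bool" where
  "gnbc_measure \<pi> \<longleftrightarrow>
     sets \<pi> = sets borel \<and> emeasure \<pi> (- {0..1}) = 0 \<and> emeasure \<pi> {1} = 0 \<and>
     (\<integral>\<^sup>+q\<in>{0..1/2}. ennreal q \<partial>\<pi>) < \<infinity> \<and>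
     (\<integral>\<^sup>+q\<in>{1/2..1}. ennreal \<bar>ln (1 - q)\<bar> \<partial>\<pi>) < \<infinity>"

definition gnbc_pgf :: "real \<Rightarrow> real measure \<Rightarrow> real \<Rightarrow> real" where
  "gnbc_pgf a \<pi> z = exp (a * (z - 1) + (LINT q|\<pi>. ln ((1 - q) / (1 - q * z))))"

definition lgnbc_law :: "real \<Rightarrow> real \<Rightarrow> real \<Rightarrow> real measure \<Rightarrow> real measure \<Rightarrow> bool" where
  "lgnbc_law c \<alpha>0 a \<pi> \<mu> \<longleftrightarrow>
     0 < c \<and> 0 < \<alpha>0 \<and> 0 \<le> a \<and> gnbc_measure \<pi> \<and>
     real_distribution \<mu> \<and> (AE x in \<mu>. 0 \<le> x) \<and>
     (\<forall>z\<in>{0<..1}. (LINT x|\<mu>. z powr x) = z powr c * gnbc_pgf a \<pi> (z powr \<alpha>0))"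

text \<open>As \<open>T 1 \<ge> 0\<close> almost surely, almost all paths of \<open>T\<close> are nondecreasing.\<close>

definition lgnbc_subordinator ::
    "'a measure \<Rightarrow> (real \<Rightarrow> 'a \<Rightarrow> real) \<Rightarrow> real \<Rightarrow> real \<Rightarrow> real \<Rightarrow> real measure \<Rightarrow> bool" where
  "lgnbc_subordinator M T c \<alpha>0 a \<pi> \<longleftrightarrow>
     levy_process M T \<and> lgnbc_law c \<alpha>0 a \<pi> (distr M borel (T 1))"


section \<open>Thorin processes\<close>

definition gamma_law :: "real \<Rightarrow> real \<Rightarrow> real measure" where
  "gamma_law a b = density lborel (\<lambda>x. ennreal
     (if 0 < x then b powr a / Gamma a * x powr (a - 1) * exp (- b * x) else 0))"

inductive gamma_convolution :: "real measure \<Rightarrow> bool" where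
  single: "0 < a \<Longrightarrow> 0 < b \<Longrightarrow> x \<noteq> 0 \<Longrightarrow>
     gamma_convolution (distr (gamma_law a b) borel (\<lambda>v. v * x))"
| conv: "gamma_convolution \<mu> \<Longrightarrow> gamma_convolution \<rho> \<Longrightarrow> gamma_convolution (\<mu> \<star> \<rho>)"

definition thorin_process :: "'a measure \<Rightarrow> (real \<Rightarrow> 'a \<Rightarrow> real) \<Rightarrow> bool" where
  "thorin_process M Y \<longleftrightarrow>
     levy_process M Y \<and>
     (\<exists>\<mu>. (\<forall>n. gamma_convolution (\<mu> n)) \<and> weak_conv_m \<mu> (distr M borel (Y 1)))"

text \<open>The measure \<open>\<tau>(B) = \<tau>\<^sub>+(B \<inter> (0,\<infinity>)) + \<tau>\<^sub>-((-B) \<inter> (0,\<infinity>))\<close>.\<close>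

definition two_sided :: "real measure \<Rightarrow> real measure \<Rightarrow> real measure" where
  "two_sided \<tau>p \<tau>m = measure_of UNIV (sets borel)
     (\<lambda>B. emeasure \<tau>p (B \<inter> {0<..}) + emeasure \<tau>m (uminus ` B \<inter> {0<..}))"

text \<open>The triplet is \<open>(b, 0, \<tau>)\<close> with \<open>\<tau> = two_sided \<tau>p \<tau>m\<close>. The one-sided parts are the
  arguments, so that they are required to be measures on \<open>(0, \<infinity>)\<close>, which \<open>two_sided\<close> alone
  would not enforce. As \<open>1 - iz/x\<close> has real part 1, the principal logarithm is the
  continuous one.\<close>

definition has_thorin_triplet_0 ::
    "'a measure \<Rightarrow> (real \<Rightarrow> 'a \<Rightarrow> real) \<Rightarrow> real \<Rightarrow> real measure \<Rightarrow> real measure \<Rightarrow> bool" where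
  "has_thorin_triplet_0 M Y b \<tau>p \<tau>m \<longleftrightarrow>
     sets \<tau>p = sets borel \<and> sets \<tau>m = sets borel \<and>
     emeasure \<tau>p {..0} = 0 \<and> emeasure \<tau>m {..0} = 0 \<and>
     (let \<tau> = two_sided \<tau>p \<tau>m in
        (\<integral>\<^sup>+x\<in>{x. \<bar>x\<bar> \<le> 1}. ennreal (1 + \<bar>ln \<bar>x\<bar>\<bar>) \<partial>\<tau>) +
        (\<integral>\<^sup>+x\<in>{x. 1 < \<bar>x\<bar>}. ennreal (1 / x\<^sup>2) \<partial>\<tau>) < \<infinity> \<and>
        (\<forall>z. char (distr M borel (Y 1)) z =
           exp (\<i> * of_real (z * b) -
             (CLINT x|\<tau>. Ln (1 - \<i> * of_real (z / x)) +
                \<i> * of_real (z / x * indicator {x. 1 \<le> \<bar>x\<bar>} x)))))"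


section \<open>Operations on measures\<close>

definition left_translate :: "real measure \<Rightarrow> real \<Rightarrow> real measure" where
  "left_translate \<eta> c = distr \<eta> borel (\<lambda>x. x - c)"

definition add_measure :: "real measure \<Rightarrow> real measure \<Rightarrow> real measure" where
  "add_measure \<mu> \<rho> = measure_of UNIV (sets borel) (\<lambda>B. emeasure \<mu> B + emeasure \<rho> B)"

definition measure_support :: "real measure \<Rightarrow> real set" where
  "measure_support \<mu> = {x. \<forall>U. open U \<and> x \<in> U \<longrightarrow> 0 < emeasure \<mu> U}"

lemma sets_two_sided [simp, measurable_cong]: "sets (two_sided \<tau>p \<tau>m) = sets borel"
  and sets_add_measure [simp, measurable_cong]: "sets (add_measure \<mu> \<rho>) = sets borel"
  using sets.sigma_sets_eq[of "borel :: real measure"]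
  by (simp_all add: two_sided_def add_measure_def sets_measure_of)

lemma emeasure_left_translate:
  assumes "sets \<eta> = sets borel" and "B \<in> sets borel"
  shows "emeasure (left_translate \<eta> c) B = emeasure \<eta> ((\<lambda>x. x + c) ` B)"
proof -
  have "(\<lambda>x. x - c) -` B = (\<lambda>x. x + c) ` B"
    by (auto simp: image_iff) (metis diff_add_cancel)
  moreover have "space \<eta> = UNIV"
    using assms(1) sets_eq_imp_space_eq by fastforce
  moreover have "(\<lambda>x. x - c) \<in> borel_measurable \<eta>"
    by (subst measurable_cong_sets[OF assms(1) refl]) simp
  ultimately show ?thesis
    using assms by (simp add: left_translate_def emeasure_distr)
qed

lemma emeasure_add_measure:
  assumes "sets \<mu> = sets borel" and "sets \<rho> = sets borel" and "B \<in> sets borel"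
  shows "emeasure (add_measure \<mu> \<rho>) B = emeasure \<mu> B + emeasure \<rho> B"
proof (rule emeasure_measure_of[OF add_measure_def])
  show "countably_additive (sets (add_measure \<mu> \<rho>)) (\<lambda>B. emeasure \<mu> B + emeasure \<rho> B)"
    using assms
    by (auto simp: countably_additive_def suminf_add[symmetric] suminf_emeasure[symmetric])
qed (use assms in \<open>auto simp: positive_def\<close>)

lemma emeasure_two_sided:
  assumes "sets \<tau>p = sets borel" and "sets \<tau>m = sets borel" and "B \<in> sets borel"
  shows "emeasure (two_sided \<tau>p \<tau>m) B =
    emeasure \<tau>p (B \<inter> {0<..}) + emeasure \<tau>m (uminus ` B \<inter> {0<..})"
proof (rule emeasure_measure_of[OF two_sided_def])
  have neg: "uminus ` A \<in> sets borel" if "A \<in> sets borel" for A :: "real set"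
  proof -
    have "uminus ` A = uminus -` A \<inter> space borel"
      by (auto simp: image_iff) (metis minus_minus)
    then show ?thesis
      using measurable_sets[OF borel_measurable_uminus[OF measurable_ident] that] by simp
  qed
  show "countably_additive (sets (two_sided \<tau>p \<tau>m))
    (\<lambda>B. emeasure \<tau>p (B \<inter> {0<..}) + emeasure \<tau>m (uminus ` B \<inter> {0<..}))"
  proof (rule countably_additiveI)
    fix A :: "nat \<Rightarrow> real set"
    assume A: "range A \<subseteq> sets (two_sided \<tau>p \<tau>m)" "disjoint_family A"
    have p: "(\<Sum>i. emeasure \<tau>p (A i \<inter> {0<..})) = emeasure \<tau>p (\<Union>i. A i \<inter> {0<..})"
      using A assms by (intro suminf_emeasure) (auto simp: disjoint_family_on_def)
    have m: "(\<Sum>i. emeasure \<tau>m (uminus ` A i \<inter> {0<..})) =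
        emeasure \<tau>m (\<Union>i. uminus ` A i \<inter> {0<..})"
    proof (rule suminf_emeasure)
      show "disjoint_family (\<lambda>i. uminus ` A i \<inter> {0<..})"
        unfolding disjoint_family_on_def
      proof (intro ballI impI)
        fix i j :: nat
        assume "i \<noteq> j"
        then have "A i \<inter> A j = {}"
          using A(2) by (simp add: disjoint_family_on_def)
        then have "uminus ` A i \<inter> uminus ` A j = {}"
          by force
        then show "uminus ` A i \<inter> {0<..} \<inter> (uminus ` A j \<inter> {0<..}) = {}"
          by blast
      qed
    qed (use A assms neg in auto)
    have u: "(\<Union>i. A i) \<inter> {0<..} = (\<Union>i. A i \<inter> {0<..})"
      "uminus ` (\<Union>i. A i) \<inter> {0<..} = (\<Union>i. uminus ` A i \<inter> {0<..})"
      by auto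
    show "(\<Sum>i. emeasure \<tau>p (A i \<inter> {0<..}) + emeasure \<tau>m (uminus ` A i \<inter> {0<..})) =
        emeasure \<tau>p ((\<Union>i. A i) \<inter> {0<..}) + emeasure \<tau>m (uminus ` (\<Union>i. A i) \<inter> {0<..})"
      unfolding u p[symmetric] m[symmetric] by (rule suminf_add[symmetric]) simp_all
  qed
qed (use assms in \<open>auto simp: positive_def\<close>)

end

theory Submission
  imports Defs "HOL-Complex_Analysis.Complex_Analysis"
begin

text \<open>Conditioning on the path of \<open>T\<close> shows that \<open>Y\<close> is a Levy process and that the
  characteristic function of \<open>Y 1\<close> at \<open>z\<close> is the Laplace transform of \<open>T 1\<close> at \<open>\<alpha> L(z)\<close>, where
  \<open>exp (L(z)) = (1 - iz/\<beta>p) (1 + iz/\<beta>m)\<close>. The generating function determines that transform on the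
  positive reals, hence on the right half-plane. With \<open>r\<^sub>\<plusminus> = f q \<mp> \<beta>0\<close> one has
  \<open>exp (L(z)) - q = (1 - q) (1 - iz/r\<^sub>+) (1 + iz/r\<^sub>-)\<close>, so the logarithm of the characteristic function is
  \<open>- \<integral> Ln (1 - iz/x) \<tau>(dx)\<close>. As \<open>\<tau>\<close> is finite, rounding \<open>\<tau>\<close> to a finite grid gives approximating
  gamma convolutions; Frullani's integral turns the exponent into Levy--Khintchine form with density
  \<open>k(y)/|y|\<close>, \<open>k\<close> a Laplace transform of \<open>\<tau>\<close>; and the quotient of the characteristic functions at \<open>z\<close>
  and \<open>z/b\<close> is compound Poisson with intensity \<open>(k(y) - k(by))/|y|\<close>, of total mass \<open>ln b \<tau>(\<real>)\<close>.\<close>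

section \<open>Laplace transforms and analytic continuation\<close>

text \<open>The obstacle is the branch of the complex logarithm: exponents are compared, not only
  exponentials. \<open>L z\<close> is a sum of two principal logarithms, not the logarithm of a
  product. Each factor has real part 1 and, for \<open>z \<noteq> 0\<close>, modulus above 1, so
  \<open>Re (L z) > 0\<close>; this places \<open>\<alpha> * L z\<close> in the open half-plane
  where the Laplace transform is known. Integrating the factorization over \<open>\<pi>\<close> uses
  up \<open>\<theta> * L z\<close> out of \<open>c * \<alpha> * L z\<close>. The surplus
  \<open>(c * \<alpha> - \<theta>) * L z\<close> produces the atoms at \<open>\<beta>p\<close> and
  \<open>- \<beta>m\<close>, and \<open>\<theta> \<le> c * \<alpha>\<close> makes their weight
  nonnegative. A root may approach 0 as \<open>q\<close> approaches 1, but no faster than a multiple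
  of \<open>1 - q\<close>. Hence integrability of \<open>ln (1 - q)\<close> under
  \<open>\<pi>\<close> becomes integrability of \<open>ln (1 + 1 / \<bar>x\<bar>)\<close> under
  \<open>\<tau>\<close>.\<close>

lemma holomorphic_on_lebesgue_integral:
  fixes F :: "complex \<Rightarrow> 'a \<Rightarrow> complex"
  assumes S: "open S"
    and meas: "\<And>s. s \<in> S \<Longrightarrow> F s \<in> borel_measurable M"
    and g: "integrable M g"
    and F: "AE q in M. (\<lambda>s. F s q) holomorphic_on S \<and> (\<forall>s\<in>S. norm (F s q) \<le> g q)"
  shows "(\<lambda>s. LINT q|M. F s q) holomorphic_on S"
proof -
  have int: "integrable M (F s)" if "s \<in> S" for s
    by (rule Bochner_Integration.integrable_bound[OF g meas[OF that]])
      (use F in \<open>eventually_elim, use that in force\<close>)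
  have "\<exists>D. ((\<lambda>s. LINT q|M. F s q) has_field_derivative D) (at s0)" if s0: "s0 \<in> S" for s0
  proof -
    obtain r' where r': "r' > 0" "cball s0 r' \<subseteq> S"
      using S s0 open_contains_cball by blast
    \<comment> \<open>Half the radius: a circle of radius \<open>r\<close> about any point of the
      ball \<open>U\<close> still lies in \<open>S\<close>.\<close>
    define r where "r = r' / 2"
    have r: "r > 0" "cball s0 (2 * r) \<subseteq> S"
      using r' by (auto simp: r_def)
    define U where "U = ball s0 r"
    have US: "U \<subseteq> S"
      using r by (auto simp: U_def)
    \<comment> \<open>Cauchy's inequality on such a circle bounds the derivative by
      \<open>g q / r\<close> on all of \<open>U\<close>. The difference quotients therefore share
      one integrable bound.\<close>
    have bound: "norm (F s q - F s0 q) \<le> g q / r * norm (s - s0)"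
      if hol: "(\<lambda>s. F s q) holomorphic_on S" and bd: "\<forall>s\<in>S. norm (F s q) \<le> g q" and s: "s \<in> U" for s q
    proof (rule field_differentiable_bound[where S = U and f' = "deriv (\<lambda>s. F s q)"])
      fix z assume z: "z \<in> U"
      have sub: "cball z r \<subseteq> S"
      proof
        fix x assume "x \<in> cball z r"
        then have "dist s0 x \<le> 2 * r"
          using z dist_triangle[of s0 x z] by (auto simp: U_def)
        then show "x \<in> S" using r by auto
      qed
      show "((\<lambda>s. F s q) has_field_derivative deriv (\<lambda>s. F s q) z) (at z within U)"
        using hol S z US holomorphic_derivI by blast
      have "norm ((deriv ^^ 1) (\<lambda>s. F s q) z) \<le> fact 1 * g q / r ^ 1"
      proof (rule Cauchy_inequality)
        show "(\<lambda>s. F s q) holomorphic_on ball z r"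
          using hol sub by (meson ball_subset_cball holomorphic_on_subset order_trans)
        show "continuous_on (cball z r) (\<lambda>s. F s q)"
          using hol sub holomorphic_on_imp_continuous_on holomorphic_on_subset by blast
        show "norm (F x q) \<le> g q" if "norm (z - x) = r" for x
          using bd sub that by (auto simp: dist_norm)
      qed (use r in auto)
      then show "norm (deriv (\<lambda>s. F s q) z) \<le> g q / r" by simp
    qed (use s r in \<open>auto simp: U_def\<close>)
    define e where "e = (\<lambda>n::nat. complex_of_real (r / (real n + 2)))"
    have e: "s0 + e n \<in> U - {s0}" for n
    proof -
      have "norm (e n) = r / (real n + 2)"
        unfolding e_def norm_of_real using r by simp
      moreover have "r / (real n + 2) < r"
        using r by (simp add: divide_less_eq field_simps add_pos_nonneg)
      moreover have "0 < r / (real n + 2)"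
        using r by (intro divide_pos_pos) auto
      ultimately show ?thesis
        by (auto simp: U_def dist_norm)
    qed
    have elim: "(\<lambda>n. s0 + e n) \<longlonglongrightarrow> s0"
    proof -
      have "(\<lambda>n. r / (real n + 2)) \<longlonglongrightarrow> 0" by real_asymp
      from tendsto_of_real[OF this, where 'a = complex] have "e \<longlonglongrightarrow> 0" by (simp add: e_def)
      from tendsto_add[OF tendsto_const this, of s0] show ?thesis by simp
    qed
    \<comment> \<open>The pointwise derivative is taken as a limit along the fixed sequence
      \<open>e\<close>, so that its measurability in \<open>q\<close> is immediate;
      \<open>Dq\<close> identifies it with the actual derivative wherever \<open>F\<close> is
      holomorphic.\<close>
    define D where "D q = lim (\<lambda>n. (F (s0 + e n) q - F s0 q) / (s0 + e n - s0))" for q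
    have eS: "s0 + e n \<in> S" for n
      using e US by blast
    have Dm: "D \<in> borel_measurable M"
      unfolding D_def
      by (intro borel_measurable_lim_metric borel_measurable_divide borel_measurable_diff meas eS s0 borel_measurable_const)
    have Dq: "((\<lambda>s. (F s q - F s0 q) / (s - s0)) \<longlongrightarrow> D q) (at s0 within U)"
      if hol: "(\<lambda>s. F s q) holomorphic_on S" for q
    proof -
      have *: "((\<lambda>s. (F s q - F s0 q) / (s - s0)) \<longlongrightarrow> deriv (\<lambda>s. F s q) s0) (at s0 within U)"
        using holomorphic_derivI[OF hol S s0, of U] by (simp add: has_field_derivative_iff)
      from this[unfolded tendsto_at_iff_sequentially, rule_format, OF e elim]
      have "(\<lambda>n. (F (s0 + e n) q - F s0 q) / (s0 + e n - s0)) \<longlonglongrightarrow> deriv (\<lambda>s. F s q) s0"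
        by (simp only: o_def)
      then have "D q = deriv (\<lambda>s. F s q) s0"
        by (simp add: D_def limI)
      with * show ?thesis by simp
    qed
    have "((\<lambda>s. ((LINT q|M. F s q) - (LINT q|M. F s0 q)) / (s - s0)) \<longlongrightarrow> (LINT q|M. D q)) (at s0 within U)"
      unfolding tendsto_at_iff_sequentially
    proof (intro allI impI)
      fix X :: "nat \<Rightarrow> complex"
      assume X: "\<forall>i. X i \<in> U - {s0}" "X \<longlonglongrightarrow> s0"
      have XS: "X i \<in> S" for i using X US by blast
      have "(\<lambda>i. LINT q|M. (F (X i) q - F s0 q) / (X i - s0)) \<longlonglongrightarrow> (LINT q|M. D q)"
      proof (rule integral_dominated_convergence[where w = "\<lambda>q. g q / r"])
        show "(\<lambda>q. (F (X i) q - F s0 q) / (X i - s0)) \<in> borel_measurable M" for i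
          by (intro borel_measurable_divide borel_measurable_diff meas XS s0 borel_measurable_const)
        show "AE q in M. (\<lambda>i. (F (X i) q - F s0 q) / (X i - s0)) \<longlonglongrightarrow> D q"
          using F
        proof eventually_elim
          case (elim q)
          then show ?case
            using Dq[unfolded tendsto_at_iff_sequentially, of q] X by (auto simp: o_def)
        qed
        show "AE q in M. norm ((F (X i) q - F s0 q) / (X i - s0)) \<le> g q / r" for i
          using F
        proof eventually_elim
          case (elim q)
          then have "norm (F (X i) q - F s0 q) \<le> g q / r * norm (X i - s0)"
            using bound X by blast
          moreover have "norm (X i - s0) > 0" using X by auto
          ultimately show ?case by (simp add: norm_divide pos_divide_le_eq)
        qed
      qed (use g Dm in auto)
      moreover have "(LINT q|M. (F (X i) q - F s0 q) / (X i - s0)) =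
          ((LINT q|M. F (X i) q) - (LINT q|M. F s0 q)) / (X i - s0)" for i
        by (subst integral_divide_zero, subst Bochner_Integration.integral_diff[OF int[OF XS] int[OF s0]]) (rule refl)
      ultimately show "((\<lambda>s. ((LINT q|M. F s q) - (LINT q|M. F s0 q)) / (s - s0)) \<circ> X) \<longlonglongrightarrow> (LINT q|M. D q)"
        by (simp only: o_def)
    qed
    moreover have "at s0 within U = at s0"
      unfolding U_def using r(1) by (intro at_within_open) auto
    ultimately show ?thesis
      unfolding has_field_derivative_iff by metis
  qed
  then show ?thesis
    unfolding holomorphic_on_open[OF S] by blast
qed

text \<open>Identity theorem on the right half-plane, using that the positive axis accumulates at 1.
  Nonnegativity of \<open>Z\<close> bounds the integrand by 1 there and makes the transform
  holomorphic.\<close>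

lemma laplace_transform_continuation:
  fixes G :: "complex \<Rightarrow> complex"
  assumes "finite_measure M" and Z[measurable]: "Z \<in> borel_measurable M" and Z0: "AE \<omega> in M. 0 \<le> Z \<omega>"
    and G: "G holomorphic_on {s. 0 < Re s}"
    and eq: "\<And>x. 0 < x \<Longrightarrow> of_real (LINT \<omega>|M. exp (- x * Z \<omega>)) = G (of_real x)"
    and s: "0 < Re s"
  shows "(LINT \<omega>|M. exp (- s * of_real (Z \<omega>))) = G s"
proof -
  interpret finite_measure M by fact
  have op: "open {s. 0 < Re s}" by (rule open_halfspace_Re_gt)
  have "(\<lambda>s. LINT \<omega>|M. exp (- s * of_real (Z \<omega>))) holomorphic_on {s. 0 < Re s}"
  proof (rule holomorphic_on_lebesgue_integral[OF op, where g = "\<lambda>_. 1"])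
    show "AE q in M. (\<lambda>s. exp (- s * complex_of_real (Z q))) holomorphic_on {s. 0 < Re s} \<and>
        (\<forall>s\<in>{s. 0 < Re s}. norm (exp (- s * complex_of_real (Z q))) \<le> 1)"
      using Z0 by eventually_elim (auto intro!: holomorphic_intros)
  qed auto
  then have hol: "(\<lambda>s. (LINT \<omega>|M. exp (- s * of_real (Z \<omega>))) - G s) holomorphic_on {s. 0 < Re s}"
    by (intro holomorphic_intros G)
  have "(LINT \<omega>|M. exp (- s * of_real (Z \<omega>))) - G s = 0"
  proof (rule analytic_continuation[OF hol op, where U = "of_real ` {0<..}" and \<xi> = 1])
    show "connected {s. 0 < Re s}"
      by (intro convex_connected convex_halfspace_Re_gt)
    show "1 islimpt complex_of_real ` {0<..}"
      unfolding islimpt_sequential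
    proof (intro exI[of _ "\<lambda>n. complex_of_real (1 + 1 / (real n + 1))"] conjI allI)
      show "complex_of_real (1 + 1 / (real n + 1)) \<in> complex_of_real ` {0<..} - {1}" for n
      proof -
        have "0 < 1 / (real n + 1)" by simp
        then have "1 + 1 / (real n + 1) \<in> {0<..} - {1}"
          unfolding Diff_iff greaterThan_iff singleton_iff by linarith
        then show ?thesis unfolding Diff_iff image_iff by (auto simp del: of_real_add of_real_divide)
      qed
      have "(\<lambda>n. 1 + 1 / (real n + 1)) \<longlonglongrightarrow> 1" by real_asymp
      from tendsto_of_real[OF this, where 'a = complex]
      show "(\<lambda>n. complex_of_real (1 + 1 / (real n + 1))) \<longlonglongrightarrow> 1" by simp
    qed
    show "(LINT \<omega>|M. exp (- z * of_real (Z \<omega>))) - G z = 0" if z: "z \<in> of_real ` {0<..}" for z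
    proof -
      obtain x where x: "z = of_real x" "0 < x" using z by auto
      have "(LINT \<omega>|M. exp (- z * of_real (Z \<omega>))) = (LINT \<omega>|M. complex_of_real (exp (- x * Z \<omega>)))"
        by (simp add: x exp_of_real[symmetric])
      also have "\<dots> = G z" using eq[OF x(2)] by (simp add: x)
      finally show ?thesis by simp
    qed
  qed (use s in auto)
  then show ?thesis by simp
qed

section \<open>Laplace transform and characteristic function of a gamma law\<close>

lemma nn_integral_gamma_law_exp:
  assumes a: "0 < a" and x: "0 \<le> x"
  shows "(\<integral>\<^sup>+v. ennreal (exp (- x * v)) \<partial>gamma_law a 1) = ennreal ((1 + x) powr (- a))"
proof -
  have G: "Gamma a > 0" using a by (rule Gamma_real_pos)
  have "ennreal (Gamma a) = (\<integral>\<^sup>+t. ennreal (indicator {0..} t * t powr (a - 1) / exp t) \<partial>lborel)"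
    by (rule Gamma_conv_nn_integral_real[OF a])
  \<comment> \<open>Rescaling Euler's integral by \<open>1 + x\<close> collects the power
    \<open>(1 + x) powr a\<close> in front of the transform.\<close>
  also have "\<dots> = ennreal (1 + x) * (\<integral>\<^sup>+t. ennreal (indicator {0..} ((1 + x) * t) * ((1 + x) * t) powr (a - 1) / exp ((1 + x) * t)) \<partial>lborel)"
    using nn_integral_real_affine[of "\<lambda>t. ennreal (indicator {0..} t * t powr (a - 1) / exp t)" "1 + x" 0] x
    by simp
  also have "(\<integral>\<^sup>+t. ennreal (indicator {0..} ((1 + x) * t) * ((1 + x) * t) powr (a - 1) / exp ((1 + x) * t)) \<partial>lborel) =
      (\<integral>\<^sup>+t. ennreal ((1 + x) powr (a - 1) * Gamma a) *
        (ennreal (if 0 < t then 1 powr a / Gamma a * t powr (a - 1) * exp (- 1 * t) else 0) * ennreal (exp (- x * t))) \<partial>lborel)"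
  proof (rule nn_integral_cong_AE)
    have "AE t in lborel. t \<noteq> (0::real)" by (rule AE_lborel_singleton)
    then show "AE t in lborel. ennreal (indicator {0..} ((1 + x) * t) * ((1 + x) * t) powr (a - 1) / exp ((1 + x) * t)) =
      ennreal ((1 + x) powr (a - 1) * Gamma a) *
        (ennreal (if 0 < t then 1 powr a / Gamma a * t powr (a - 1) * exp (- 1 * t) else 0) * ennreal (exp (- x * t)))"
    proof eventually_elim
      case (elim t)
      show ?case
      proof (cases "0 < t")
        case True
        have "((1 + x) * t) powr (a - 1) = (1 + x) powr (a - 1) * t powr (a - 1)"
          using x True by (simp add: powr_mult)
        moreover have "exp ((1 + x) * t) = exp t * exp (x * t)"
          by (simp add: exp_add[symmetric] distrib_right)
        moreover have "0 < (1 + x) * t" using x True by simp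
        ultimately have eq: "indicator {0..} ((1 + x) * t) * ((1 + x) * t) powr (a - 1) / exp ((1 + x) * t) =
            ((1 + x) powr (a - 1) * Gamma a) * ((t powr (a - 1) / Gamma a * exp (- t)) * exp (- x * t))"
          using G by (simp add: exp_minus divide_simps del: mult_pos_pos)
        have "ennreal (A * (B * C)) = ennreal A * (ennreal B * ennreal C)"
          if "0 \<le> A" "0 \<le> B" "0 \<le> C" for A B C :: real
          using that by (simp add: ennreal_mult)
        from this[of "(1 + x) powr (a - 1) * Gamma a" "t powr (a - 1) / Gamma a * exp (- t)" "exp (- x * t)"]
        show ?thesis unfolding eq using G True by simp
      next
        case False
        then have "(1 + x) * t < 0" using elim x by (simp add: mult_pos_neg)
        then show ?thesis using False by (simp add: indicator_def)
      qed
    qed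
  qed
  also have "\<dots> = ennreal ((1 + x) powr (a - 1) * Gamma a) * (\<integral>\<^sup>+v. ennreal (exp (- x * v)) \<partial>gamma_law a 1)"
    unfolding gamma_law_def
    by (subst nn_integral_density) (auto simp: nn_integral_cmult)
  also have "ennreal (1 + x) * (ennreal ((1 + x) powr (a - 1) * Gamma a) * (\<integral>\<^sup>+v. ennreal (exp (- x * v)) \<partial>gamma_law a 1)) =
      ennreal ((1 + x) powr a * Gamma a) * (\<integral>\<^sup>+v. ennreal (exp (- x * v)) \<partial>gamma_law a 1)"
  proof -
    have "(1 + x) powr a * Gamma a = (1 + x) * ((1 + x) powr (a - 1) * Gamma a)"
      using x by (simp add: powr_diff)
    then have "ennreal ((1 + x) powr a * Gamma a) = ennreal (1 + x) * ennreal ((1 + x) powr (a - 1) * Gamma a)"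
      using x by (simp only: ennreal_mult' add_nonneg_nonneg zero_le_one)
    then show ?thesis by (simp only: mult.assoc)
  qed
  finally have "ennreal ((1 + x) powr (- a) / Gamma a) * ennreal (Gamma a) =
      ennreal ((1 + x) powr (- a) / Gamma a) * (ennreal ((1 + x) powr a * Gamma a) * (\<integral>\<^sup>+v. ennreal (exp (- x * v)) \<partial>gamma_law a 1))"
    by (rule arg_cong)
  moreover have "ennreal ((1 + x) powr (- a) / Gamma a) * ennreal (Gamma a) = ennreal ((1 + x) powr (- a))"
    using G by (simp add: ennreal_mult[symmetric])
  moreover have "ennreal ((1 + x) powr (- a) / Gamma a) * (ennreal ((1 + x) powr a * Gamma a) * I) = I" for I
  proof -
    have "ennreal ((1 + x) powr (- a) / Gamma a) * ennreal ((1 + x) powr a * Gamma a) = 1"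
      using G x by (simp add: ennreal_mult[symmetric] powr_minus)
    then show ?thesis by (simp add: mult.assoc[symmetric])
  qed
  ultimately show ?thesis by metis
qed

lemma sets_gamma_law [simp, measurable_cong]: "sets (gamma_law a b) = sets borel"
  by (simp add: gamma_law_def)

lemma prob_space_gamma_law:
  assumes "0 < a"
  shows "prob_space (gamma_law a 1)"
proof
  show "emeasure (gamma_law a 1) (space (gamma_law a 1)) = 1"
    using nn_integral_gamma_law_exp[OF assms, of 0] by simp
qed

text \<open>The characteristic function is the boundary value of the Laplace transform at
  \<open>- \<i> * t\<close>. The function \<open>Ln (1 + s)\<close> is continuous there, because
  \<open>1 + s\<close> keeps a positive real part.\<close>

lemma char_gamma_law:
  assumes a: "0 < a"
  shows "char (gamma_law a 1) t = exp (- of_real a * Ln (1 - \<i> * of_real t))"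
proof -
  interpret prob_space "gamma_law a 1" by (rule prob_space_gamma_law[OF a])
  have pos: "AE v in gamma_law a 1. 0 \<le> v"
    unfolding gamma_law_def by (subst AE_density) (auto intro!: AE_I2)
  have real: "(LINT v|gamma_law a 1. exp (- x * v)) = (1 + x) powr (- a)" if "0 < x" for x
    using nn_integral_gamma_law_exp[OF a, of x] that
    by (intro integral_eq_nn_integral[THEN trans]) (auto simp del: mult_minus_left)
  have half: "(LINT v|gamma_law a 1. exp (- s * of_real v)) = exp (- of_real a * Ln (1 + s))" if "0 < Re s" for s
  proof (rule laplace_transform_continuation[where Z = "\<lambda>v. v" and G = "\<lambda>s. exp (- of_real a * Ln (1 + s))", OF _ _ pos _ _ that])
    show "(\<lambda>s. exp (- complex_of_real a * Ln (1 + s))) holomorphic_on {s. 0 < Re s}"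
      by (intro holomorphic_intros) (auto simp: complex_nonpos_Reals_iff)
    show "complex_of_real (LINT v|gamma_law a 1. exp (- x * v)) = exp (- complex_of_real a * Ln (1 + complex_of_real x))"
      if "0 < x" for x
    proof -
      have "Ln (1 + complex_of_real x) = of_real (ln (1 + x))"
        using that by (metis Ln_of_real add_pos_pos of_real_1 of_real_add zero_less_one)
      then show ?thesis
        unfolding real[OF that] using that by (simp add: powr_def exp_of_real[symmetric])
    qed
  qed (auto intro: finite_measure_axioms)
  \<comment> \<open>Analytic continuation stops at the open half-plane; this sequence reaches the
    imaginary axis from inside, where dominated convergence applies.\<close>
  define s where "s n = complex_of_real (1 / (real n + 1)) - \<i> * of_real t" for n
  have slim: "s \<longlonglongrightarrow> - \<i> * of_real t"
  proof -
    have "(\<lambda>n. 1 / (real n + 1)) \<longlonglongrightarrow> 0" by real_asymp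
    from tendsto_diff[OF tendsto_of_real[OF this, where 'a = complex] tendsto_const, of "\<i> * of_real t"]
    show ?thesis unfolding s_def[abs_def] by simp
  qed
  have Res: "Re (s n) = 1 / (real n + 1)" for n
    by (simp add: s_def Re_divide_of_real del: of_real_divide)
  have l1: "(\<lambda>n. LINT v|gamma_law a 1. exp (- s n * of_real v)) \<longlonglongrightarrow> (LINT v|gamma_law a 1. exp (- (- \<i> * of_real t) * of_real v))"
  proof (rule integral_dominated_convergence[where w = "\<lambda>_. 1"])
    show "AE v in gamma_law a 1. (\<lambda>n. exp (- s n * of_real v)) \<longlonglongrightarrow> exp (- (- \<i> * of_real t) * of_real v)"
      by (intro AE_I2 tendsto_intros slim)
    show "AE v in gamma_law a 1. norm (exp (- s n * complex_of_real v)) \<le> 1" for n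
      using pos by eventually_elim (auto simp: Res)
  qed auto
  have l2: "(\<lambda>n. exp (- of_real a * Ln (1 + s n))) \<longlonglongrightarrow> exp (- of_real a * Ln (1 + (- \<i> * of_real t)))"
    by (intro tendsto_intros slim) (auto simp: complex_nonpos_Reals_iff)
  have eq: "(LINT v|gamma_law a 1. exp (- s n * of_real v)) = exp (- of_real a * Ln (1 + s n))" for n
    by (rule half) (simp add: Res)
  have "(LINT v|gamma_law a 1. exp (- (- \<i> * of_real t) * of_real v)) =
      exp (- of_real a * Ln (1 + (- \<i> * of_real t)))"
    by (rule LIMSEQ_unique[OF l1[unfolded eq] l2])
  then show ?thesis
    by (simp add: char_def mult.assoc)
qed

section \<open>Levy processes\<close>

lemma levy_processD:
  assumes "levy_process M X"
  shows "prob_space M" and "\<And>t. 0 \<le> t \<Longrightarrow> X t \<in> borel_measurable M"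
    and "AE \<omega> in M. X 0 \<omega> = 0"
    and "\<And>n (t :: nat \<Rightarrow> real). 0 \<le> t 0 \<Longrightarrow> (\<And>i. i < n \<Longrightarrow> t i \<le> t (Suc i)) \<Longrightarrow>
      prob_space.indep_vars M (\<lambda>_. borel) (\<lambda>i \<omega>. X (t (Suc i)) \<omega> - X (t i) \<omega>) {..<n}"
    and "\<And>s t. 0 \<le> s \<Longrightarrow> 0 \<le> t \<Longrightarrow> distr M borel (\<lambda>\<omega>. X (s + t) \<omega> - X s \<omega>) = distr M borel (X t)"
    and "AE \<omega> in M. cadlag (\<lambda>t. X t \<omega>)"
  using assms unfolding levy_process_def by auto

text \<open>For \<open>s \<ge> 0\<close>, the least multiple of \<open>1 / (n + 1)\<close> strictly
  above \<open>s\<close>. Strictness makes it converge from the right, where cadlag paths are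
  continuous; for each \<open>n\<close> it takes countably many values, which gives measurability.
  It also serves to discretize a Thorin measure.\<close>

definition grid :: "nat \<Rightarrow> real \<Rightarrow> real" where
  "grid n s = (real (nat \<lfloor>real (Suc n) * s\<rfloor>) + 1) / real (Suc n)"

lemma grid_bounds:
  assumes "0 \<le> s"
  shows "s < grid n s" and "grid n s \<le> s + 1 / real (Suc n)"
proof -
  define N where "N = real (Suc n)"
  have N: "0 < N" by (simp add: N_def)
  have "0 \<le> N * s" using N assms by simp
  then have "real (nat \<lfloor>N * s\<rfloor>) = of_int \<lfloor>N * s\<rfloor>" by simp
  then have b: "real (nat \<lfloor>N * s\<rfloor>) \<le> N * s" "N * s < real (nat \<lfloor>N * s\<rfloor>) + 1"
    by linarith+
  have g: "grid n s = (real (nat \<lfloor>N * s\<rfloor>) + 1) / N"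
    by (simp add: grid_def N_def)
  show "s < grid n s"
    using b N by (simp add: g pos_less_divide_eq mult.commute)
  have "grid n s \<le> (N * s + 1) / N"
    using b N by (simp add: g divide_right_mono)
  then show "grid n s \<le> s + 1 / real (Suc n)"
    using N by (simp add: add_divide_distrib N_def)
qed

lemma filterlim_grid:
  assumes "0 \<le> s"
  shows "filterlim (\<lambda>n. grid n s) (at_right s) sequentially"
  unfolding filterlim_at
proof
  show "\<forall>\<^sub>F n in sequentially. grid n s \<in> {s<..} \<and> grid n s \<noteq> s"
    using grid_bounds(1)[OF assms] by (auto intro!: always_eventually simp: less_imp_neq[symmetric])
  show "(\<lambda>n. grid n s) \<longlonglongrightarrow> s"
  proof (rule tendsto_sandwich[where f = "\<lambda>_. s" and h = "\<lambda>n. s + 1 / real (Suc n)"])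
    show "(\<lambda>n. s + 1 / real (Suc n)) \<longlonglongrightarrow> s"
      using tendsto_add[OF tendsto_const LIMSEQ_Suc[OF lim_1_over_n], of s] by simp
  qed (use grid_bounds[OF assms] in \<open>auto intro!: always_eventually simp: less_imp_le\<close>)
qed

lemma cadlag_grid:
  assumes "cadlag x" and "0 \<le> s"
  shows "(\<lambda>n. x (grid n s)) \<longlonglongrightarrow> x s"
  using filterlim_compose[OF _ filterlim_grid[OF assms(2)]] assms by (auto simp: cadlag_def)

text \<open>Monotonicity of \<open>T\<close> carries one-sided approach in time to one-sided
  approach in the argument of \<open>x\<close>. On the left there are two cases: either
  \<open>T\<close> reaches its left limit \<open>l\<close> before \<open>t\<close> and is constant
  from then on, or it stays strictly below \<open>l\<close> and the left limit of \<open>x\<close>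
  at \<open>l\<close> takes over.\<close>

lemma cadlag_compose:
  assumes x: "cadlag x" and T: "cadlag T" and nn: "0 \<le> T 0"
    and mono: "\<And>s t. 0 \<le> s \<Longrightarrow> s \<le> t \<Longrightarrow> T s \<le> T t"
  shows "cadlag (\<lambda>t. x (T t))"
  unfolding cadlag_def
proof (intro conjI allI impI)
  have T0: "0 \<le> T t" if "0 \<le> t" for t
    using mono[of 0 t] nn that by simp
  show "((\<lambda>t. x (T t)) \<longlongrightarrow> x (T t)) (at_right t)" if t: "0 \<le> t" for t
  proof (rule topological_tendstoI)
    fix U assume U: "open U" "x (T t) \<in> U"
    have "(x \<longlongrightarrow> x (T t)) (at_right (T t))"
      using x T0[OF t] by (simp add: cadlag_def)
    from topological_tendstoD[OF this U]
    obtain b where b: "T t < b" "\<And>y. T t < y \<Longrightarrow> y < b \<Longrightarrow> x y \<in> U"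
      unfolding eventually_at_right_field by blast
    have "(T \<longlongrightarrow> T t) (at_right t)"
      using T t by (simp add: cadlag_def)
    then have "\<forall>\<^sub>F s in at_right t. T s < b"
      using b(1) by (rule order_tendstoD)
    moreover have "\<forall>\<^sub>F s in at_right t. t < s"
      by (rule eventually_at_right_less)
    ultimately show "\<forall>\<^sub>F s in at_right t. x (T s) \<in> U"
    proof eventually_elim
      case (elim s)
      then have "T t \<le> T s" using mono t by simp
      \<comment> \<open>A right limit says nothing about the point itself, so the case
        \<open>T t = T s\<close> is separate.\<close>
      then show ?case using b(2)[of "T s"] elim U(2) by (cases "T t = T s") auto
    qed
  qed
  show "\<exists>l. ((\<lambda>t. x (T t)) \<longlongrightarrow> l) (at_left t)" if t: "0 < t" for t
  proof -
    obtain l where l: "(T \<longlongrightarrow> l) (at_left t)"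
      using T t by (auto simp: cadlag_def)
    have le: "T s \<le> l" if s: "0 \<le> s" "s < t" for s
    proof (rule tendsto_lowerbound[OF l])
      show "\<forall>\<^sub>F u in at_left t. T s \<le> T u"
        unfolding eventually_at_left_field
        using mono[OF s(1)] s(2) by (intro exI[of _ s]) auto
    qed simp
    show ?thesis
    proof (cases "\<exists>s. 0 \<le> s \<and> s < t \<and> T s = l")
      case True
      then obtain s where s: "0 \<le> s" "s < t" "T s = l" by blast
      have "\<forall>\<^sub>F u in at_left t. x l = x (T u)"
        unfolding eventually_at_left_field
      proof (intro exI[of _ s] conjI allI impI)
        fix u assume u: "s < u" "u < t"
        have "l \<le> T u" using mono[OF s(1), of u] u s(3) by simp
        moreover have "T u \<le> l" using le[of u] u s(1) by simp
        ultimately show "x l = x (T u)" by simp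
      qed (use s in auto)
      then show ?thesis
        using tendsto_eventually[of "\<lambda>u. x (T u)" "x l"] by (auto simp: eq_commute)
    next
      case False
      then have lt: "T s < l" if "0 \<le> s" "s < t" for s
        using le[OF that] that by force
      have "filterlim T (at_left l) (at_left t)"
        unfolding filterlim_at
      proof
        show "\<forall>\<^sub>F s in at_left t. T s \<in> {..<l} \<and> T s \<noteq> l"
          unfolding eventually_at_left_field using lt t by (intro exI[of _ 0]) (auto simp: less_imp_neq)
      qed (fact l)
      moreover have "0 < l" using lt[of 0] t nn by simp
      then obtain m where "(x \<longlongrightarrow> m) (at_left l)"
        using x by (auto simp: cadlag_def)
      ultimately show ?thesis
        using filterlim_compose by blast
    qed
  qed
qed

section \<open>Characteristic functions and increments of a Levy process\<close>

lemma levy_process_char_nat_mult: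
  assumes X: "levy_process M X" and u: "0 \<le> u"
  shows "char (distr M borel (X (real n * u))) z = char (distr M borel (X u)) z ^ n"
proof -
  note L = levy_processD[OF X]
  interpret prob_space M by (rule L(1))
  have [measurable]: "X (real i * u) \<in> borel_measurable M" for i
    using L(2) u by simp
  have eq: "AE \<omega> in M. (\<Sum>i<n. X (real (Suc i) * u) \<omega> - X (real i * u) \<omega>) = X (real n * u) \<omega>"
    using L(3)
  proof eventually_elim
    case (elim \<omega>)
    have "(\<Sum>i<n. X (real (Suc i) * u) \<omega> - X (real i * u) \<omega>) = X (real n * u) \<omega> - X (real 0 * u) \<omega>"
      by (rule sum_lessThan_telescope)
    with elim show ?case by simp
  qed
  have "distr M borel (X (real n * u)) = distr M borel (\<lambda>\<omega>. \<Sum>i<n. X (real (Suc i) * u) \<omega> - X (real i * u) \<omega>)"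
    by (rule distr_cong_AE) (use eq in \<open>auto simp: eq_commute simp del: of_nat_Suc\<close>)
  then have "char (distr M borel (X (real n * u))) z =
      (\<Prod>i<n. char (distr M borel (\<lambda>\<omega>. X (real (Suc i) * u) \<omega> - X (real i * u) \<omega>)) z)"
    using char_distr_sum[OF L(4)[of "\<lambda>i. real i * u" n], of z] u
    by (simp add: mult_right_mono)
  moreover have "distr M borel (\<lambda>\<omega>. X (real (Suc i) * u) \<omega> - X (real i * u) \<omega>) = distr M borel (X u)" for i
    using L(5)[of "real i * u" u] u by (simp add: distrib_right add.commute)
  ultimately show ?thesis by simp
qed

lemma levy_process_char_grid:
  assumes X: "levy_process M X" and u: "0 \<le> u"
  shows "(\<lambda>n. char (distr M borel (X (grid n u))) z) \<longlonglongrightarrow> char (distr M borel (X u)) z"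
proof -
  note L = levy_processD[OF X]
  interpret prob_space M by (rule L(1))
  have g: "0 \<le> grid n u" for n
    using grid_bounds(1)[OF u, of n] u by linarith
  have [measurable]: "X (grid n u) \<in> borel_measurable M" "X u \<in> borel_measurable M" for n
    using L(2) g u by auto
  have "(\<lambda>n. CLINT \<omega>|M. iexp (z * X (grid n u) \<omega>)) \<longlonglongrightarrow> (CLINT \<omega>|M. iexp (z * X u \<omega>))"
  proof (rule integral_dominated_convergence[where w = "\<lambda>_. 1"])
    show "AE \<omega> in M. (\<lambda>n. iexp (z * X (grid n u) \<omega>)) \<longlonglongrightarrow> iexp (z * X u \<omega>)"
      using L(6) by eventually_elim (intro tendsto_intros cadlag_grid u)
  qed auto
  then show ?thesis
    by (simp add: char_def integral_distr)
qed

text \<open>Time \<open>1 / n\<close> is settled by taking roots, multiples of it by independent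
  increments, and all other times by right-continuity along the grid. A complex power alone would
  leave the branch open; continuity of \<open>\<psi>\<close> and \<open>\<psi> 0 = 0\<close> fix
  it.\<close>

lemma levy_process_char_exp:
  fixes \<psi> :: "real \<Rightarrow> complex"
  assumes X: "levy_process M X" and \<psi>: "continuous_on UNIV \<psi>" "\<psi> 0 = 0"
    and one: "\<And>z. char (distr M borel (X 1)) z = exp (\<psi> z)"
    and u: "0 \<le> u"
  shows "char (distr M borel (X u)) z = exp (of_real u * \<psi> z)"
proof -
  note L = levy_processD[OF X]
  interpret prob_space M by (rule L(1))
  have root: "char (distr M borel (X (1 / real n))) z = exp (\<psi> z / of_nat n)" if n: "0 < n" for n z
  proof -
    have [measurable]: "X (1 / real n) \<in> borel_measurable M"
      using L(2) by simp
    interpret D: real_distribution "distr M borel (X (1 / real n))"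
      by (intro real_distribution_distr) simp
    define R where "R z = char (distr M borel (X (1 / real n))) z * exp (- \<psi> z / of_nat n)" for z
    have Rn: "R z ^ n = 1" for z
    proof -
      have "R z ^ n = char (distr M borel (X (1 / real n))) z ^ n * exp (- \<psi> z)"
        using n by (simp add: R_def power_mult_distrib exp_of_nat_mult[symmetric])
      also have "char (distr M borel (X (1 / real n))) z ^ n = exp (\<psi> z)"
        using levy_process_char_nat_mult[OF X, of "1 / real n" n z] n one by simp
      finally show ?thesis by (simp add: exp_minus)
    qed
    \<comment> \<open>\<open>R\<close> is a continuous \<open>n\<close>-th root of unity, which selects the right root of the characteristic function.\<close>
    have "R constant_on UNIV"
    proof (rule continuous_finite_range_constant)
      show "continuous_on UNIV R"
        unfolding R_def using D.isCont_char n
        by (intro continuous_intros \<psi>(1) continuous_at_imp_continuous_on) auto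
      have "finite {w :: complex. w ^ n = 1}"
        using n by (simp add: finite_roots_unity)
      then show "finite (range R)"
        by (rule finite_subset[rotated]) (auto simp: Rn)
    qed auto
    then have "R z = R 0" by (auto simp: constant_on_def)
    also have "R 0 = 1" by (simp add: R_def \<psi>(2) D.char_zero)
    finally have "char (distr M borel (X (1 / real n))) z * exp (- \<psi> z / of_nat n) * exp (\<psi> z / of_nat n) = exp (\<psi> z / of_nat n)"
      by (simp add: R_def)
    then show ?thesis
      by (simp add: mult.assoc exp_add[symmetric])
  qed
  have "char (distr M borel (X (grid n u))) z = exp (of_real (grid n u) * \<psi> z)" for n
  proof -
    define m where "m = nat \<lfloor>real (Suc n) * u\<rfloor> + 1"
    have g: "grid n u = real m * (1 / real (Suc n))"
      by (simp add: grid_def m_def)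
    have "char (distr M borel (X (grid n u))) z = exp (\<psi> z / of_nat (Suc n)) ^ m"
      unfolding g by (subst levy_process_char_nat_mult[OF X]) (auto simp: root simp del: of_nat_Suc)
    also have "\<dots> = exp (of_real (grid n u) * \<psi> z)"
      by (simp add: g exp_of_nat_mult[symmetric])
    finally show ?thesis .
  qed
  moreover have "(\<lambda>n. exp (of_real (grid n u) * \<psi> z)) \<longlonglongrightarrow> exp (of_real u * \<psi> z)"
    using filterlim_grid[OF u] by (intro tendsto_intros) (auto simp: filterlim_at)
  ultimately show ?thesis
    using LIMSEQ_unique[OF levy_process_char_grid[OF X u, of z]] by simp
qed

lemma levy_process_increments:
  assumes X: "levy_process M X" and s: "0 \<le> s 0" "\<And>i. i < n \<Longrightarrow> s i \<le> s (Suc i)"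
    and B: "\<And>i. i < n \<Longrightarrow> B i \<in> sets borel"
  shows "emeasure M {\<omega>\<in>space M. \<forall>i<n. X (s (Suc i)) \<omega> - X (s i) \<omega> \<in> B i} =
    (\<Prod>i<n. emeasure (distr M borel (X (s (Suc i) - s i))) (B i))"
proof -
  note L = levy_processD[OF X]
  interpret prob_space M by (rule L(1))
  have s0: "0 \<le> s i" if "i \<le> n" for i
    using that by (induction i) (use s in \<open>auto intro: order_trans\<close>)
  have m: "X (s i) \<in> borel_measurable M" if "i \<le> n" for i
    using L(2) s0 that by simp
  have d: "distr M borel (\<lambda>\<omega>. X (s (Suc i)) \<omega> - X (s i) \<omega>) = distr M borel (X (s (Suc i) - s i))"
    if "i < n" for i
    using L(5)[of "s i" "s (Suc i) - s i"] s0[of i] s(2)[OF that] that by simp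
  \<comment> \<open>For \<open>n = 0\<close> the intersection over the index set would be the whole
    type and not \<open>space M\<close>.\<close>
  show ?thesis
  proof (cases "n = 0")
    case True
    then show ?thesis using emeasure_space_1 by simp
  next
    case False
    have "emeasure M {\<omega>\<in>space M. \<forall>i<n. X (s (Suc i)) \<omega> - X (s i) \<omega> \<in> B i} =
        emeasure M (\<Inter>i\<in>{..<n}. (\<lambda>\<omega>. X (s (Suc i)) \<omega> - X (s i) \<omega>) -` B i \<inter> space M)"
      using False by (intro arg_cong[where f = "emeasure M"]) auto
    also have "\<dots> = ennreal (\<Prod>i<n. prob ((\<lambda>\<omega>. X (s (Suc i)) \<omega> - X (s i) \<omega>) -` B i \<inter> space M))"
      unfolding emeasure_eq_measure
      using indep_varsD_finite[OF L(4)[of s n, OF s], where A = B] False B by auto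
    also have "\<dots> = (\<Prod>i<n. emeasure M ((\<lambda>\<omega>. X (s (Suc i)) \<omega> - X (s i) \<omega>) -` B i \<inter> space M))"
      by (simp add: emeasure_eq_measure prod_ennreal)
    also have "\<dots> = (\<Prod>i<n. emeasure (distr M borel (X (s (Suc i) - s i))) (B i))"
      by (intro prod.cong refl, subst d[symmetric]) (use B m in \<open>auto simp: emeasure_distr\<close>)
    finally show ?thesis .
  qed
qed

text \<open>If an increment over time \<open>1 / n\<close> were negative with probability
  \<open>p > 0\<close>, then all \<open>n\<close> of them would be negative with probability
  \<open>p ^ n > 0\<close>, and so would be \<open>T 1\<close>. Hence almost surely all grid
  increments are nonnegative, and right-continuity extends the order to all times.\<close>

lemma levy_process_mono_paths:
  assumes T: "levy_process M T" and T1: "AE \<omega> in M. 0 \<le> T 1 \<omega>"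
  shows "AE \<omega> in M. \<forall>s t. 0 \<le> s \<longrightarrow> s \<le> t \<longrightarrow> T s \<omega> \<le> T t \<omega>"
proof -
  note L = levy_processD[OF T]
  interpret prob_space M by (rule L(1))
  have m[measurable]: "T (real i / real n) \<in> borel_measurable M" for i n
    using L(2) by simp
  have zero: "emeasure (distr M borel (T (1 / real n))) {..<0} = 0" if n: "0 < n" for n
  proof -
    define s where "s i = real i / real n" for i
    have "(\<Prod>i<n. emeasure (distr M borel (T (s (Suc i) - s i))) {..<0}) =
        emeasure M {\<omega>\<in>space M. \<forall>i<n. T (s (Suc i)) \<omega> - T (s i) \<omega> \<in> {..<0}}"
      by (rule levy_process_increments[OF T, symmetric]) (auto simp: s_def divide_right_mono)
    also have "\<dots> = 0"
    proof (rule emeasure_eq_0_AE)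
      show "AE \<omega> in M. \<not> (\<forall>i<n. T (s (Suc i)) \<omega> - T (s i) \<omega> \<in> {..<0})"
        using T1 L(3)
      proof eventually_elim
        case (elim \<omega>)
        have "(\<Sum>i<n. T (s (Suc i)) \<omega> - T (s i) \<omega>) = T (s n) \<omega> - T (s 0) \<omega>"
          by (rule sum_lessThan_telescope)
        also have "\<dots> \<ge> 0" using elim n by (simp add: s_def)
        finally have "\<not> (\<Sum>i<n. T (s (Suc i)) \<omega> - T (s i) \<omega>) < 0" by simp
        then show ?case
          using n sum_strict_mono[of "{..<n}" "\<lambda>i. T (s (Suc i)) \<omega> - T (s i) \<omega>" "\<lambda>_. 0"] by auto
      qed
    qed
    also have "(\<Prod>i<n. emeasure (distr M borel (T (s (Suc i) - s i))) {..<0}) =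
        emeasure (distr M borel (T (1 / real n))) {..<0} ^ n"
      by (simp add: s_def diff_divide_distrib[symmetric])
    finally show ?thesis by simp
  qed
  have "AE \<omega> in M. \<forall>n i. T (real i / real (Suc n)) \<omega> \<le> T (real (Suc i) / real (Suc n)) \<omega>"
    unfolding AE_all_countable
  proof (intro allI)
    fix n i :: nat
    have "distr M borel (\<lambda>\<omega>. T (real (Suc i) / real (Suc n)) \<omega> - T (real i / real (Suc n)) \<omega>) =
        distr M borel (T (1 / real (Suc n)))"
      using L(5)[of "real i / real (Suc n)" "1 / real (Suc n)"] by (simp add: add_divide_distrib add.commute)
    then have "emeasure (distr M borel (\<lambda>\<omega>. T (real (Suc i) / real (Suc n)) \<omega> - T (real i / real (Suc n)) \<omega>)) {..<0} = 0"
      using zero[of "Suc n"] by simp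
    then have "emeasure M {\<omega>\<in>space M. T (real (Suc i) / real (Suc n)) \<omega> - T (real i / real (Suc n)) \<omega> < 0} = 0"
      by (subst (asm) emeasure_distr) (auto simp: vimage_def Int_def conj_commute simp del: of_nat_Suc)
    then have "AE \<omega> in M. \<not> (T (real (Suc i) / real (Suc n)) \<omega> - T (real i / real (Suc n)) \<omega> < 0)"
      by (subst AE_iff_measurable[OF _ refl]) (auto simp del: of_nat_Suc)
    then show "AE \<omega> in M. T (real i / real (Suc n)) \<omega> \<le> T (real (Suc i) / real (Suc n)) \<omega>"
      by eventually_elim simp
  qed
  with L(6) show ?thesis
  proof eventually_elim
    case (elim \<omega>)
    show ?case
    proof (intro allI impI)
      fix s t :: real assume st: "0 \<le> s" "s \<le> t"
      have step: "T (real i / real (Suc n)) \<omega> \<le> T (real j / real (Suc n)) \<omega>" if "i \<le> j" for i j n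
        using lift_Suc_mono_le[of "\<lambda>i. T (real i / real (Suc n)) \<omega>", OF _ that] elim(2) by blast
      \<comment> \<open>Both times are rounded on the same mesh and \<open>floor\<close> is
        monotone, so countably many comparisons suffice.\<close>
      have "T (grid n s) \<omega> \<le> T (grid n t) \<omega>" for n
      proof -
        have g: "grid n u = real (nat \<lfloor>real (Suc n) * u\<rfloor> + 1) / real (Suc n)" for u
          by (simp add: grid_def)
        show ?thesis
          unfolding g using st by (intro step add_right_mono nat_mono floor_mono mult_left_mono) auto
      qed
      then show "T s \<omega> \<le> T t \<omega>"
        using st elim(1) by (intro LIMSEQ_le[OF cadlag_grid[of "\<lambda>t. T t \<omega>" s] cadlag_grid[of "\<lambda>t. T t \<omega>" t]]) auto
    qed
  qed
qed

section \<open>Subordination\<close>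

abbreviation path_space :: "(real \<Rightarrow> real) measure" where
  "path_space \<equiv> (\<Pi>\<^sub>M t\<in>{0..}. borel)"

text \<open>Evaluation is not jointly measurable in time and path on the product space; the limit
  along the grid is, and it agrees with evaluation on cadlag paths.\<close>

definition path_eval :: "real \<Rightarrow> (real \<Rightarrow> real) \<Rightarrow> real" where
  "path_eval s x = lim (\<lambda>n. x (grid n s))"

lemma path_eval_restrict:
  assumes "cadlag x" and s: "0 \<le> s"
  shows "path_eval s (restrict x {0..}) = x s"
proof -
  have "restrict x {0..} (grid n s) = x (grid n s)" for n
    using grid_bounds(1)[OF s, of n] s by simp
  then show ?thesis
    using limI[OF cadlag_grid[OF assms]] by (simp add: path_eval_def)
qed

text \<open>For each \<open>n\<close> the grid selects among countably many coordinates, each of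
  which is measurable on the product space; the limit in \<open>n\<close> keeps
  measurability.\<close>

lemma measurable_path_eval [measurable (raw)]:
  assumes f[measurable]: "f \<in> borel_measurable N" and g[measurable]: "g \<in> N \<rightarrow>\<^sub>M path_space"
  shows "(\<lambda>x. path_eval (f x) (g x)) \<in> borel_measurable N"
  unfolding path_eval_def
proof (rule borel_measurable_lim_metric)
  fix n
  have "(\<lambda>x. (\<lambda>k x. g x ((real k + 1) / real (Suc n))) (nat \<lfloor>real (Suc n) * f x\<rfloor>) x) \<in> borel_measurable N"
  proof (rule measurable_compose_countable[where f = "\<lambda>k x. g x ((real k + 1) / real (Suc n))"])
    show "(\<lambda>x. g x ((real k + 1) / real (Suc n))) \<in> borel_measurable N" for k
      by (rule measurable_compose[OF g measurable_component_singleton]) simp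
  qed measurable
  then show "(\<lambda>x. g x (grid n (f x))) \<in> borel_measurable N"
    by (simp add: grid_def)
qed

text \<open>Measurability of \<open>Y t\<close> is a separate hypothesis: \<open>M\<close> need not
  be complete, so agreement with \<open>X (T t)\<close> outside a null set does not supply
  it.\<close>

locale subordination =
  fixes M :: "'a measure" and X T Y :: "real \<Rightarrow> 'a \<Rightarrow> real"
  assumes X: "levy_process M X" and T: "levy_process M T"
    and T1: "AE \<omega> in M. 0 \<le> T 1 \<omega>"
    and indep: "indep_processes M X T"
    and Y_measurable: "\<And>t. 0 \<le> t \<Longrightarrow> Y t \<in> borel_measurable M"
    and Y: "AE \<omega> in M. \<forall>t\<ge>0. Y t \<omega> = X (T t \<omega>) \<omega>"
begin

sublocale prob_space M
  by (rule levy_processD(1)[OF X])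

definition Xpath :: "'a \<Rightarrow> real \<Rightarrow> real" where "Xpath \<omega> = (\<lambda>t\<in>{0..}. X t \<omega>)"
definition Tpath :: "'a \<Rightarrow> real \<Rightarrow> real" where "Tpath \<omega> = (\<lambda>t\<in>{0..}. T t \<omega>)"

lemma paths_measurable [measurable]:
  "Xpath \<in> M \<rightarrow>\<^sub>M path_space" "Tpath \<in> M \<rightarrow>\<^sub>M path_space"
  unfolding Xpath_def[abs_def] Tpath_def[abs_def]
  using levy_processD(2)[OF X] levy_processD(2)[OF T] by (auto intro!: measurable_restrict)

lemma joint_law:
  "distr M (path_space \<Otimes>\<^sub>M path_space) (\<lambda>\<omega>. (Xpath \<omega>, Tpath \<omega>)) =
    distr M path_space Xpath \<Otimes>\<^sub>M distr M path_space Tpath"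
  using indep unfolding indep_processes_def indep_var_distribution_eq Xpath_def[abs_def] Tpath_def[abs_def]
  by simp

sublocale XL: prob_space "distr M path_space Xpath"
  by (rule prob_space_distr) measurable

sublocale TL: prob_space "distr M path_space Tpath"
  by (rule prob_space_distr) measurable

sublocale XTL: pair_prob_space "distr M path_space Xpath" "distr M path_space Tpath" ..

lemma T_mono: "AE \<omega> in M. \<forall>s t. 0 \<le> s \<longrightarrow> s \<le> t \<longrightarrow> T s \<omega> \<le> T t \<omega>"
  by (rule levy_process_mono_paths[OF T T1])

lemma T_nonneg: "AE \<omega> in M. \<forall>t\<ge>0. 0 \<le> T t \<omega>"
  using T_mono levy_processD(3)[OF T] by eventually_elim force

lemma Xpath_eval: "AE \<omega> in M. \<forall>s\<ge>0. path_eval s (Xpath \<omega>) = X s \<omega>"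
  using levy_processD(6)[OF X] by eventually_elim (simp add: Xpath_def path_eval_restrict)

lemma Y_eval: "AE \<omega> in M. \<forall>t\<ge>0. Y t \<omega> = path_eval (Tpath \<omega> t) (Xpath \<omega>)"
  using Y T_nonneg Xpath_eval by eventually_elim (auto simp: Tpath_def)

text \<open>The transition probability \<open>P(X u \<in> B)\<close>, expressed through
  \<open>path_eval\<close> so that it is defined and measurable for every real \<open>u\<close>, not
  only for the times \<open>u \<ge> 0\<close> at which \<open>X\<close> is specified.\<close>

definition kern :: "real set \<Rightarrow> real \<Rightarrow> ennreal" where
  "kern B u = emeasure (distr M path_space Xpath) {x\<in>space (distr M path_space Xpath). path_eval u x \<in> B}"

lemma kern_measurable:
  assumes [measurable]: "B \<in> sets borel"
  shows "kern B \<in> borel_measurable borel"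
proof -
  have "{p \<in> space (borel \<Otimes>\<^sub>M distr M path_space Xpath). path_eval (fst p) (snd p) \<in> B} \<in>
      sets (borel \<Otimes>\<^sub>M distr M path_space Xpath)"
    by measurable
  from XL.measurable_emeasure_Pair[OF this] show ?thesis
    unfolding kern_def[abs_def]
    by (rule measurable_cong[THEN iffD1, rotated])
       (auto intro!: arg_cong[where f = "emeasure (distr M path_space Xpath)"] simp: space_pair_measure)
qed

lemma kern_eq:
  assumes "0 \<le> u" and [measurable]: "B \<in> sets borel"
  shows "kern B u = emeasure (distr M borel (X u)) B"
proof -
  have [measurable]: "X u \<in> borel_measurable M"
    by (rule levy_processD(2)[OF X assms(1)])
  have "kern B u = emeasure M {\<omega>\<in>space M. path_eval u (Xpath \<omega>) \<in> B}"
    unfolding kern_def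
    by (subst emeasure_distr) (auto intro!: arg_cong[where f = "emeasure M"]
        simp: measurable_space[OF paths_measurable(1)])
  also have "\<dots> = emeasure M {\<omega>\<in>space M. X u \<omega> \<in> B}"
  proof (rule emeasure_eq_AE)
    show "AE \<omega> in M. (\<omega> \<in> {\<omega>\<in>space M. path_eval u (Xpath \<omega>) \<in> B}) = (\<omega> \<in> {\<omega>\<in>space M. X u \<omega> \<in> B})"
      using Xpath_eval by eventually_elim (use assms in auto)
  qed measurable
  also have "\<dots> = emeasure (distr M borel (X u)) B"
    by (simp add: emeasure_distr vimage_def Int_def conj_commute)
  finally show ?thesis .
qed

text \<open>With the path of \<open>T\<close> frozen, the increments of \<open>Y\<close> are
  increments of \<open>X\<close> over deterministic consecutive intervals. Their joint law is a
  product depending only on the interval lengths. Averaging over \<open>T\<close> then factorizes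
  because those lengths are themselves independent. This yields independence and stationarity at
  once.\<close>

lemma Y_increments:
  fixes t :: "nat \<Rightarrow> real"
  assumes t: "0 \<le> t 0" "\<And>i. i < n \<Longrightarrow> t i \<le> t (Suc i)"
    and B: "\<And>i. i < n \<Longrightarrow> B i \<in> sets borel"
  shows "emeasure M {\<omega>\<in>space M. \<forall>i<n. Y (t (Suc i)) \<omega> - Y (t i) \<omega> \<in> B i} =
    (\<Prod>i<n. \<integral>\<^sup>+\<omega>. kern (B i) (T (t (Suc i)) \<omega> - T (t i) \<omega>) \<partial>M)"
proof -
  note LX = levy_processD[OF X] and LT = levy_processD[OF T]
  have t0: "0 \<le> t i" if "i \<le> n" for i
    using that by (induction i) (use t in \<open>auto intro: order_trans\<close>)
  have t0': "i < n \<Longrightarrow> 0 \<le> t i" "i < n \<Longrightarrow> 0 \<le> t (Suc i)" for i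
    using t0 by auto
  have Bm: "Measurable.pred N (\<lambda>x. \<forall>i<n. h i x \<in> B i)" if "\<And>i. i < n \<Longrightarrow> h i \<in> borel_measurable N"
    for N :: "'x measure" and h
  proof -
    have "Measurable.pred N (\<lambda>x. \<forall>i\<in>{..<n}. h i x \<in> B i)"
    proof (rule pred_intros_countable_bounded)
      show "Measurable.pred N (\<lambda>x. h i x \<in> B i)" if "i \<in> {..<n}" for i
        using that \<open>\<And>i. i < n \<Longrightarrow> h i \<in> borel_measurable N\<close>[of i] B[of i] by simp
    qed
    then show ?thesis by (simp only: Ball_def lessThan_iff)
  qed
  define A where "A p \<longleftrightarrow> (\<forall>i<n. path_eval (snd p (t (Suc i))) (fst p) - path_eval (snd p (t i)) (fst p) \<in> B i)"
    for p :: "(real \<Rightarrow> real) \<times> (real \<Rightarrow> real)"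
  have comp: "(\<lambda>p. snd p (t i)) \<in> borel_measurable (path_space \<Otimes>\<^sub>M path_space)"
     "(\<lambda>x. x (t i)) \<in> borel_measurable path_space" if "i \<le> n" for i
    using t0[OF that] by (auto intro!: measurable_compose[OF measurable_snd measurable_component_singleton] measurable_component_singleton)
  have Am[measurable]: "Measurable.pred (path_space \<Otimes>\<^sub>M path_space) A"
    unfolding A_def
    by (intro Bm borel_measurable_diff measurable_path_eval comp measurable_fst) auto
  have "emeasure M {\<omega>\<in>space M. \<forall>i<n. Y (t (Suc i)) \<omega> - Y (t i) \<omega> \<in> B i} =
      emeasure M {\<omega>\<in>space M. A (Xpath \<omega>, Tpath \<omega>)}"
  proof (rule emeasure_eq_AE)
    show "AE \<omega> in M. (\<omega> \<in> {\<omega>\<in>space M. \<forall>i<n. Y (t (Suc i)) \<omega> - Y (t i) \<omega> \<in> B i}) =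
        (\<omega> \<in> {\<omega>\<in>space M. A (Xpath \<omega>, Tpath \<omega>)})"
      using Y_eval by eventually_elim (use t0' in \<open>auto simp: A_def\<close>)
    have "Measurable.pred M (\<lambda>\<omega>. \<forall>i<n. Y (t (Suc i)) \<omega> - Y (t i) \<omega> \<in> B i)"
      by (intro Bm borel_measurable_diff Y_measurable t0')
    then show "{\<omega>\<in>space M. \<forall>i<n. Y (t (Suc i)) \<omega> - Y (t i) \<omega> \<in> B i} \<in> sets M"
      by (simp only: pred_def)
  qed measurable
  also have "\<dots> = emeasure (distr M (path_space \<Otimes>\<^sub>M path_space) (\<lambda>\<omega>. (Xpath \<omega>, Tpath \<omega>)))
      {p\<in>space (path_space \<Otimes>\<^sub>M path_space). A p}"
    by (subst emeasure_distr) (auto intro!: arg_cong[where f = "emeasure M"]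
        simp: space_pair_measure measurable_space[OF paths_measurable(1)] measurable_space[OF paths_measurable(2)])
  also have "\<dots> = (\<integral>\<^sup>+\<tau>. emeasure (distr M path_space Xpath) ((\<lambda>x. (x, \<tau>)) -` {p\<in>space (path_space \<Otimes>\<^sub>M path_space). A p})
      \<partial>distr M path_space Tpath)"
    unfolding joint_law by (rule XTL.emeasure_pair_measure_alt2) measurable
  also have "\<dots> = (\<integral>\<^sup>+\<omega>. emeasure (distr M path_space Xpath)
      ((\<lambda>x. (x, Tpath \<omega>)) -` {p\<in>space (path_space \<Otimes>\<^sub>M path_space). A p}) \<partial>M)"
  proof -
    have "{p\<in>space (path_space \<Otimes>\<^sub>M path_space). A p} \<in>
        sets (distr M path_space Xpath \<Otimes>\<^sub>M distr M path_space Tpath)"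
      by measurable
    from XTL.measurable_emeasure_Pair2[OF this] show ?thesis
      by (intro nn_integral_distr[OF paths_measurable(2)]) simp
  qed
  also have "\<dots> = (\<integral>\<^sup>+\<omega>. (\<Prod>i<n. kern (B i) (T (t (Suc i)) \<omega> - T (t i) \<omega>)) \<partial>M)"
  proof (rule nn_integral_cong_AE)
    show "AE \<omega> in M. emeasure (distr M path_space Xpath)
        ((\<lambda>x. (x, Tpath \<omega>)) -` {p\<in>space (path_space \<Otimes>\<^sub>M path_space). A p}) =
        (\<Prod>i<n. kern (B i) (T (t (Suc i)) \<omega> - T (t i) \<omega>))"
      using T_mono T_nonneg AE_space
    proof eventually_elim
      case (elim \<omega>)
      \<comment> \<open>For fixed \<open>\<omega>\<close> these are nonrandom, nonnegative and
        nondecreasing times for \<open>X\<close>.\<close>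
      define s where "s i = T (t i) \<omega>" for i
      have s: "0 \<le> s 0" "\<And>i. i < n \<Longrightarrow> s i \<le> s (Suc i)"
        using elim t t0' by (auto simp: s_def)
      have s0: "0 \<le> s i" if "i \<le> n" for i
        using elim t0[OF that] by (auto simp: s_def)
      have tp: "Tpath \<omega> (t i) = s i" if "i \<le> n" for i
        using t0[OF that] by (simp add: Tpath_def s_def)
      have sp: "Tpath \<omega> \<in> space path_space"
        using elim measurable_space[OF paths_measurable(2)] by blast
      have "((\<lambda>x. (x, Tpath \<omega>)) -` {p\<in>space (path_space \<Otimes>\<^sub>M path_space). A p}) =
          {x\<in>space path_space. \<forall>i<n. path_eval (s (Suc i)) x - path_eval (s i) x \<in> B i}"
        using sp tp by (auto simp: A_def space_pair_measure)
      also have "emeasure (distr M path_space Xpath) \<dots> =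
          emeasure M {\<omega>'\<in>space M. \<forall>i<n. path_eval (s (Suc i)) (Xpath \<omega>') - path_eval (s i) (Xpath \<omega>') \<in> B i}"
      proof (subst emeasure_distr)
        have "Measurable.pred path_space (\<lambda>x. \<forall>i<n. path_eval (s (Suc i)) x - path_eval (s i) x \<in> B i)"
          by (intro Bm) measurable
        then show "{x\<in>space path_space. \<forall>i<n. path_eval (s (Suc i)) x - path_eval (s i) x \<in> B i} \<in> sets path_space"
          by (simp only: pred_def)
      qed (auto intro!: arg_cong[where f = "emeasure M"] simp: measurable_space[OF paths_measurable(1)])
      also have "\<dots> = emeasure M {\<omega>'\<in>space M. \<forall>i<n. X (s (Suc i)) \<omega>' - X (s i) \<omega>' \<in> B i}"
      proof (rule emeasure_eq_AE)
        show "AE \<omega>' in M. (\<omega>' \<in> {\<omega>'\<in>space M. \<forall>i<n. path_eval (s (Suc i)) (Xpath \<omega>') - path_eval (s i) (Xpath \<omega>') \<in> B i}) =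
          (\<omega>' \<in> {\<omega>'\<in>space M. \<forall>i<n. X (s (Suc i)) \<omega>' - X (s i) \<omega>' \<in> B i})"
          using Xpath_eval by eventually_elim (use s0 in auto)
        have "Measurable.pred M (\<lambda>\<omega>'. \<forall>i<n. path_eval (s (Suc i)) (Xpath \<omega>') - path_eval (s i) (Xpath \<omega>') \<in> B i)"
          by (intro Bm) measurable
        then show "{\<omega>'\<in>space M. \<forall>i<n. path_eval (s (Suc i)) (Xpath \<omega>') - path_eval (s i) (Xpath \<omega>') \<in> B i} \<in> sets M"
          by (simp only: pred_def)
        have "Measurable.pred M (\<lambda>\<omega>'. \<forall>i<n. X (s (Suc i)) \<omega>' - X (s i) \<omega>' \<in> B i)"
          by (intro Bm borel_measurable_diff LX(2) s0) auto
        then show "{\<omega>'\<in>space M. \<forall>i<n. X (s (Suc i)) \<omega>' - X (s i) \<omega>' \<in> B i} \<in> sets M"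
          by (simp only: pred_def)
      qed
      also have "\<dots> = (\<Prod>i<n. emeasure (distr M borel (X (s (Suc i) - s i))) (B i))"
        by (rule levy_process_increments[OF X s B])
      also have "\<dots> = (\<Prod>i<n. kern (B i) (s (Suc i) - s i))"
        using s(2) B by (intro prod.cong refl kern_eq[symmetric]) auto
      finally show ?case by (simp add: s_def)
    qed
  qed
  \<comment> \<open>Independence of the increments of \<open>T\<close> moves the expectation inside
    the product.\<close>
  also have "\<dots> = (\<Prod>i<n. \<integral>\<^sup>+\<omega>. kern (B i) (T (t (Suc i)) \<omega> - T (t i) \<omega>) \<partial>M)"
    by (rule indep_vars_nn_integral[OF _ indep_vars_compose2[OF LT(4)[OF t]]])
       (auto intro!: kern_measurable B)
  finally show ?thesis .
qed

text \<open>The case of a single increment. The right-hand side depends on \<open>a\<close> and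
  \<open>b\<close> only through \<open>b - a\<close>, which is stationarity.\<close>

lemma Y_increment:
  assumes ab: "0 \<le> a" "a \<le> b" and B[measurable]: "B \<in> sets borel"
  shows "emeasure (distr M borel (\<lambda>\<omega>. Y b \<omega> - Y a \<omega>)) B = (\<integral>\<^sup>+u. kern B u \<partial>distr M borel (T (b - a)))"
proof -
  have [measurable]: "Y a \<in> borel_measurable M" "Y b \<in> borel_measurable M"
      "T a \<in> borel_measurable M" "T b \<in> borel_measurable M"
    using Y_measurable levy_processD(2)[OF T] ab by auto
  have "emeasure (distr M borel (\<lambda>\<omega>. Y b \<omega> - Y a \<omega>)) B = emeasure M {\<omega>\<in>space M. Y b \<omega> - Y a \<omega> \<in> B}"
    by (simp add: emeasure_distr vimage_def Int_def conj_commute)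
  also have "\<dots> = (\<integral>\<^sup>+\<omega>. kern B (T b \<omega> - T a \<omega>) \<partial>M)"
    using Y_increments[of "\<lambda>i. if i = 0 then a else b" 1 "\<lambda>_. B"] ab by simp
  also have "\<dots> = (\<integral>\<^sup>+u. kern B u \<partial>distr M borel (\<lambda>\<omega>. T b \<omega> - T a \<omega>))"
    by (subst nn_integral_distr) (auto intro: kern_measurable)
  also have "distr M borel (\<lambda>\<omega>. T b \<omega> - T a \<omega>) = distr M borel (T (b - a))"
    using levy_processD(5)[OF T, of a "b - a"] ab by simp
  finally show ?thesis .
qed

lemma Y_0: "AE \<omega> in M. Y 0 \<omega> = 0"
  using Y levy_processD(3)[OF X] levy_processD(3)[OF T] by eventually_elim simp

lemma levy_process_Y: "levy_process M Y"
  unfolding levy_process_def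
proof (intro conjI allI impI)
  show "prob_space M" by unfold_locales
  show "Y t \<in> borel_measurable M" if "0 \<le> t" for t
    by (rule Y_measurable[OF that])
  show "AE \<omega> in M. Y 0 \<omega> = 0" by (rule Y_0)
  show "AE \<omega> in M. cadlag (\<lambda>t. Y t \<omega>)"
    using levy_processD(6)[OF X] levy_processD(6)[OF T] T_mono T_nonneg Y
  proof eventually_elim
    case (elim \<omega>)
    have c: "cadlag (\<lambda>t. X (T t \<omega>) \<omega>)"
      using elim by (intro cadlag_compose[of "\<lambda>t. X t \<omega>" "\<lambda>t. T t \<omega>"]) simp_all
    \<comment> \<open>\<open>Y\<close> is known to agree with \<open>X \<circ> T\<close> on
      nonnegative times only, so the one-sided limits are transferred through eventual
      equality.\<close>
    show ?case
      unfolding cadlag_def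
    proof (intro conjI allI impI)
      show "((\<lambda>t. Y t \<omega>) \<longlongrightarrow> Y t \<omega>) (at_right t)" if t: "0 \<le> t" for t
      proof -
        have "\<forall>\<^sub>F s in at_right t. X (T s \<omega>) \<omega> = Y s \<omega>"
          using eventually_at_right_less[of t] by eventually_elim (use elim(5) t in simp)
        moreover have "((\<lambda>t. X (T t \<omega>) \<omega>) \<longlongrightarrow> X (T t \<omega>) \<omega>) (at_right t)"
          using c t by (simp add: cadlag_def)
        ultimately have "((\<lambda>t. Y t \<omega>) \<longlongrightarrow> X (T t \<omega>) \<omega>) (at_right t)"
          by (rule Lim_transform_eventually[rotated])
        then show ?thesis using elim(5) t by simp
      qed
      show "\<exists>l. ((\<lambda>t. Y t \<omega>) \<longlongrightarrow> l) (at_left t)" if t: "0 < t" for t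
      proof -
        have "\<forall>\<^sub>F s in at_left t. 0 \<le> s"
          unfolding eventually_at_left_field using t by (intro exI[of _ 0]) auto
        then have "\<forall>\<^sub>F s in at_left t. X (T s \<omega>) \<omega> = Y s \<omega>"
          by eventually_elim (use elim(5) in simp)
        moreover obtain l where "((\<lambda>t. X (T t \<omega>) \<omega>) \<longlongrightarrow> l) (at_left t)"
          using c t by (auto simp: cadlag_def)
        ultimately have "((\<lambda>t. Y t \<omega>) \<longlongrightarrow> l) (at_left t)"
          by (rule Lim_transform_eventually[rotated])
        then show ?thesis ..
      qed
    qed
  qed
  show "distr M borel (\<lambda>\<omega>. Y (s + t) \<omega> - Y s \<omega>) = distr M borel (Y t)" if st: "0 \<le> s" "0 \<le> t" for s t
  proof -
    have [measurable]: "Y 0 \<in> borel_measurable M" "Y t \<in> borel_measurable M"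
      using Y_measurable st by auto
    have "distr M borel (Y t) = distr M borel (\<lambda>\<omega>. Y t \<omega> - Y 0 \<omega>)"
      by (rule distr_cong_AE) (use Y_0 in auto)
    moreover have "distr M borel (\<lambda>\<omega>. Y (s + t) \<omega> - Y s \<omega>) = distr M borel (\<lambda>\<omega>. Y t \<omega> - Y 0 \<omega>)"
      by (rule measure_eqI) (use st in \<open>auto simp: Y_increment\<close>)
    ultimately show ?thesis by simp
  qed
  show "indep_vars (\<lambda>_. borel) (\<lambda>i \<omega>. Y (t (Suc i)) \<omega> - Y (t i) \<omega>) {..<n}"
    if "0 \<le> t 0 \<and> (\<forall>i<n. t i \<le> t (Suc i))" for n and t :: "nat \<Rightarrow> real"
  proof (cases "n = 0")
    case True
    then show ?thesis by (simp add: indep_vars_def2 indep_sets_def)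
  next
    case False
    from that have t: "0 \<le> t 0" "\<And>i. i < n \<Longrightarrow> t i \<le> t (Suc i)" by auto
    have t0: "0 \<le> t i" if "i \<le> n" for i
      using that by (induction i) (use t in \<open>auto intro: order_trans\<close>)
    show ?thesis
    proof (subst indep_vars_finite[where E = "\<lambda>_. sets borel"])
      show "\<forall>A\<in>{..<n} \<rightarrow> sets borel. prob (\<Inter>j\<in>{..<n}. (\<lambda>\<omega>. Y (t (Suc j)) \<omega> - Y (t j) \<omega>) -` A j \<inter> space M) =
          (\<Prod>j\<in>{..<n}. prob ((\<lambda>\<omega>. Y (t (Suc j)) \<omega> - Y (t j) \<omega>) -` A j \<inter> space M))"
      proof
        fix A assume A: "A \<in> {..<n} \<rightarrow> sets (borel :: real measure)"
        \<comment> \<open>The factors in \<open>Y_increments\<close> are recognized as marginal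
          probabilities by applying that lemma to one increment, with the times shifted by
          \<open>i\<close>.\<close>
        have single: "(\<integral>\<^sup>+\<omega>. kern (A i) (T (t (Suc i)) \<omega> - T (t i) \<omega>) \<partial>M) =
            emeasure M ((\<lambda>\<omega>. Y (t (Suc i)) \<omega> - Y (t i) \<omega>) -` A i \<inter> space M)" if "i < n" for i
        proof -
          have "emeasure M {\<omega>\<in>space M. Y (t (Suc i)) \<omega> - Y (t i) \<omega> \<in> A i} =
              (\<integral>\<^sup>+\<omega>. kern (A i) (T (t (Suc i)) \<omega> - T (t i) \<omega>) \<partial>M)"
            using Y_increments[of "\<lambda>j. t (i + j)" 1 "\<lambda>_. A i"] t0[of i] t(2)[of i] that A by auto
          then show ?thesis by (simp add: vimage_def Int_def conj_commute)
        qed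
        have "(\<Inter>j\<in>{..<n}. (\<lambda>\<omega>. Y (t (Suc j)) \<omega> - Y (t j) \<omega>) -` A j \<inter> space M) =
            {\<omega>\<in>space M. \<forall>i<n. Y (t (Suc i)) \<omega> - Y (t i) \<omega> \<in> A i}"
          using False by auto
        then have "emeasure M (\<Inter>j\<in>{..<n}. (\<lambda>\<omega>. Y (t (Suc j)) \<omega> - Y (t j) \<omega>) -` A j \<inter> space M) =
            (\<Prod>i<n. \<integral>\<^sup>+\<omega>. kern (A i) (T (t (Suc i)) \<omega> - T (t i) \<omega>) \<partial>M)"
          using Y_increments[of t n A, OF t] A by auto
        also have "\<dots> = (\<Prod>i<n. emeasure M ((\<lambda>\<omega>. Y (t (Suc i)) \<omega> - Y (t i) \<omega>) -` A i \<inter> space M))"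
          using single by (intro prod.cong) auto
        finally show "prob (\<Inter>j\<in>{..<n}. (\<lambda>\<omega>. Y (t (Suc j)) \<omega> - Y (t j) \<omega>) -` A j \<inter> space M) =
            (\<Prod>j\<in>{..<n}. prob ((\<lambda>\<omega>. Y (t (Suc j)) \<omega> - Y (t j) \<omega>) -` A j \<inter> space M))"
          by (simp add: emeasure_eq_measure prod_ennreal prod_nonneg)
      qed
    qed (use False Y_measurable t0 sets.Int_stable sets.sigma_sets_eq[of "borel :: real measure"] in auto)
  qed
qed

lemma char_Y:
  assumes g[measurable]: "g \<in> borel_measurable borel"
    and X_char: "\<And>u. 0 \<le> u \<Longrightarrow> char (distr M borel (X u)) z = g u"
  shows "char (distr M borel (Y 1)) z = (CLINT \<omega>|M. g (T 1 \<omega>))"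
proof -
  let ?f = "\<lambda>x \<tau>. iexp (z * path_eval (\<tau> 1) x)"
  have comp[measurable]: "(\<lambda>x. x 1) \<in> borel_measurable path_space"
    by (rule measurable_component_singleton) simp
  have [measurable]: "Y 1 \<in> borel_measurable M"
    by (rule Y_measurable) simp
  have Xm: "X u \<in> borel_measurable M" if "0 \<le> u" for u
    by (rule levy_processD(2)[OF X that])
  have m: "(\<lambda>p. ?f (fst p) (snd p)) \<in> borel_measurable (path_space \<Otimes>\<^sub>M path_space)"
    by measurable
  have fub: "(CLINT \<omega>|M. ?f (Xpath \<omega>) (Tpath \<omega>)) = (CLINT \<tau>|distr M path_space Tpath. CLINT x|distr M path_space Xpath. ?f x \<tau>)"
  proof -
    have "(CLINT \<tau>|distr M path_space Tpath. CLINT x|distr M path_space Xpath. ?f x \<tau>) =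
        (CLINT p|distr M path_space Xpath \<Otimes>\<^sub>M distr M path_space Tpath. (case p of (x, \<tau>) \<Rightarrow> ?f x \<tau>))"
    proof (rule XTL.integral_snd)
      show "integrable (distr M path_space Xpath \<Otimes>\<^sub>M distr M path_space Tpath) (case_prod ?f)"
        by (rule XTL.P.integrable_const_bound[where B = 1]) (use m in \<open>auto simp: split_beta'\<close>)
    qed
    also have "\<dots> = (CLINT \<omega>|M. ?f (Xpath \<omega>) (Tpath \<omega>))"
      unfolding joint_law[symmetric]
      by (subst integral_distr) (use m in \<open>auto simp: split_beta'\<close>)
    finally show ?thesis by simp
  qed
  have "char (distr M borel (Y 1)) z = (CLINT \<omega>|M. iexp (z * Y 1 \<omega>))"
    by (simp add: char_def integral_distr)
  also have "\<dots> = (CLINT \<omega>|M. ?f (Xpath \<omega>) (Tpath \<omega>))"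
  proof (rule integral_cong_AE)
    show "AE \<omega> in M. iexp (z * Y 1 \<omega>) = ?f (Xpath \<omega>) (Tpath \<omega>)"
      using Y_eval by eventually_elim simp
  qed measurable
  also have "\<dots> = (CLINT \<omega>|M. CLINT x|distr M path_space Xpath. ?f x (Tpath \<omega>))"
    unfolding fub by (subst integral_distr) (auto intro!: XL.borel_measurable_lebesgue_integral simp: split_beta')
  also have "\<dots> = (CLINT \<omega>|M. g (T 1 \<omega>))"
  proof (rule integral_cong_AE)
    have [measurable]: "T 1 \<in> borel_measurable M"
      by (rule levy_processD(2)[OF T]) simp
    show "(\<lambda>\<omega>. g (T 1 \<omega>)) \<in> borel_measurable M" by measurable
    show "(\<lambda>\<omega>. CLINT x|distr M path_space Xpath. ?f x (Tpath \<omega>)) \<in> borel_measurable M"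
      by (intro XL.borel_measurable_lebesgue_integral) (auto simp: split_beta')
    show "AE \<omega> in M. (CLINT x|distr M path_space Xpath. ?f x (Tpath \<omega>)) = g (T 1 \<omega>)"
      using T_nonneg
    proof eventually_elim
      case (elim \<omega>)
      then have T0: "0 \<le> T 1 \<omega>" by simp
      have [measurable]: "X (T 1 \<omega>) \<in> borel_measurable M" by (rule Xm[OF T0])
      have "(CLINT x|distr M path_space Xpath. ?f x (Tpath \<omega>)) = (CLINT \<omega>'|M. iexp (z * path_eval (T 1 \<omega>) (Xpath \<omega>')))"
        by (subst integral_distr) (auto simp: Tpath_def)
      also have "\<dots> = (CLINT \<omega>'|M. iexp (z * X (T 1 \<omega>) \<omega>'))"
      proof (rule integral_cong_AE)
        show "AE \<omega>' in M. iexp (z * path_eval (T 1 \<omega>) (Xpath \<omega>')) = iexp (z * X (T 1 \<omega>) \<omega>')"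
          using Xpath_eval by eventually_elim (simp add: T0)
      qed measurable
      also have "\<dots> = char (distr M borel (X (T 1 \<omega>))) z"
        by (simp add: char_def integral_distr)
      finally show ?case by (simp add: X_char[OF T0])
    qed
  qed
  finally show ?thesis .
qed

end

section \<open>Frullani integrals\<close>

text \<open>Pasting: \<open>Ln\<close> is continuous off the closed negative half-axis, and on it
  \<open>Ln\<close> equals the real logarithm plus a constant, except for the default value at
  0.\<close>

lemma borel_measurable_Ln [measurable]: "Ln \<in> borel_measurable borel"
proof -
  have "Ln = (\<lambda>z. if z \<in> \<real>\<^sub>\<le>\<^sub>0 then (if z = 0 then Ln 0 else of_real (ln (- Re z)) + \<i> * of_real pi)
      else indicator (- \<real>\<^sub>\<le>\<^sub>0) z *\<^sub>R Ln z)"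
  proof
    fix z :: complex
    show "Ln z = (if z \<in> \<real>\<^sub>\<le>\<^sub>0 then (if z = 0 then Ln 0 else of_real (ln (- Re z)) + \<i> * of_real pi)
        else indicator (- \<real>\<^sub>\<le>\<^sub>0) z *\<^sub>R Ln z)"
    proof (cases "z \<in> \<real>\<^sub>\<le>\<^sub>0 \<and> z \<noteq> 0")
      case True
      define x where "x = - Re z"
      have z: "z = - of_real x" "0 < x"
        using True by (auto simp: x_def complex_nonpos_Reals_iff complex_eq_iff)
      have "Ln z = of_real (ln x) + \<i> * of_real pi"
        unfolding z(1) using z(2) by (subst Ln_minus) (auto simp: Ln_of_real)
      then show ?thesis using True z by simp
    qed auto
  qed
  moreover have "(\<lambda>z. indicator (- \<real>\<^sub>\<le>\<^sub>0) z *\<^sub>R Ln z) \<in> borel_measurable borel"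
    by (rule borel_measurable_continuous_on_indicator) (auto intro!: continuous_intros)
  moreover have [measurable]: "(\<real>\<^sub>\<le>\<^sub>0 :: complex set) \<in> sets borel"
    by (intro borel_closed closed_nonpos_Reals_complex)
  ultimately show ?thesis by (subst \<open>Ln = _\<close>) measurable
qed

lemma norm_exp_minus_one_le:
  fixes v :: complex
  assumes "Re v \<le> c" and "0 \<le> c"
  shows "norm (exp v - 1) \<le> exp c * norm v"
proof -
  have "norm (exp v - exp 0) \<le> exp c * norm (v - 0)"
  proof (rule field_differentiable_bound[where S = "{u. Re u \<le> c}" and f' = exp])
    show "convex {u. Re u \<le> c}" by (rule convex_halfspace_Re_le)
  qed (use assms in \<open>auto intro!: derivative_eq_intros\<close>)
  then show ?thesis by simp
qed

text \<open>The estimate \<open>1 + \<bar>z\<bar> / \<bar>s\<bar> \<le> (1 + \<bar>z\<bar>) * (1 + 1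
  / \<bar>s\<bar>)\<close> separates the variables, so that \<open>z\<close> contributes only an
  additive constant to a bound integrable in \<open>s\<close>.\<close>

lemma norm_Ln_one_minus_i_le:
  fixes s z :: real
  shows "norm (Ln (1 - \<i> * of_real (z / s))) \<le> ln (1 + \<bar>z\<bar>) + ln (1 + 1 / \<bar>s\<bar>) + pi"
proof -
  let ?w = "1 - \<i> * complex_of_real (z / s)"
  have re: "1 \<le> norm ?w" using complex_Re_le_cmod[of ?w] by simp
  have w0: "?w \<noteq> 0" by (simp add: complex_eq_iff)
  have "norm ?w \<le> 1 + \<bar>z\<bar> / \<bar>s\<bar>"
    using norm_triangle_ineq4[of 1 "\<i> * complex_of_real (z / s)"] by (simp add: norm_mult norm_divide)
  also have "\<dots> \<le> (1 + \<bar>z\<bar>) * (1 + 1 / \<bar>s\<bar>)"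
  proof -
    have "0 \<le> 1 / \<bar>s\<bar>" "0 \<le> \<bar>z\<bar>" by auto
    moreover have "(1 + \<bar>z\<bar>) * (1 + 1 / \<bar>s\<bar>) = 1 + \<bar>z\<bar> / \<bar>s\<bar> + (\<bar>z\<bar> + 1 / \<bar>s\<bar>)"
      by (simp add: algebra_simps add_divide_distrib)
    ultimately show ?thesis by linarith
  qed
  finally have "ln (norm ?w) \<le> ln ((1 + \<bar>z\<bar>) * (1 + 1 / \<bar>s\<bar>))"
    using re by (intro ln_mono) auto
  also have "\<dots> = ln (1 + \<bar>z\<bar>) + ln (1 + 1 / \<bar>s\<bar>)"
    by (intro ln_mult_pos) (auto intro!: add_pos_nonneg)
  finally have "\<bar>Re (Ln ?w)\<bar> \<le> ln (1 + \<bar>z\<bar>) + ln (1 + 1 / \<bar>s\<bar>)"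
    using re w0 by (simp del: of_real_divide)
  moreover have "\<bar>Im (Ln ?w)\<bar> \<le> pi"
    using mpi_less_Im_Ln[OF w0] Im_Ln_le_pi[OF w0] by simp
  ultimately show ?thesis
    using cmod_le[of "Ln ?w"] by linarith
qed

text \<open>This replaces the usual weight \<open>min 1 y\<close> by \<open>1 - exp (- y)\<close>,
  whose integral against \<open>exp (- s * y) / y\<close> is explicit. The constant 2 comes from
  \<open>y / (1 + y) \<ge> min 1 y / 2\<close>.\<close>

lemma one_minus_exp_lower:
  fixes y :: real
  assumes "0 \<le> y"
  shows "min 1 y \<le> 2 * (1 - exp (- y))"
proof -
  have "1 + y \<le> exp y" by (rule exp_ge_add_one_self)
  then have "exp (- y) \<le> 1 / (1 + y)"
    using assms by (simp add: exp_minus field_simps)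
  then have "2 * (1 - 1 / (1 + y)) \<le> 2 * (1 - exp (- y))" by simp
  moreover have "min 1 y \<le> 2 * (1 - 1 / (1 + y))"
    using assms mult_left_mono[of y 1 y] by (simp add: field_simps min_def)
  ultimately show ?thesis by linarith
qed

lemma norm_iexp_minus_one_le:
  "norm (iexp (z * y) - 1) \<le> (4 + 2 * \<bar>z\<bar>) * (1 - exp (- \<bar>y\<bar>))"
proof -
  have a: "norm (iexp (z * y) - 1) \<le> \<bar>z * y\<bar>"
    using norm_exp_minus_one_le[of "\<i> * of_real (z * y)" 0] by (simp add: norm_mult)
  have b: "norm (iexp (z * y) - 1) \<le> 2"
    using norm_triangle_ineq4[of "iexp (z * y)" 1] by simp
  have "norm (iexp (z * y) - 1) \<le> (2 + \<bar>z\<bar>) * min 1 \<bar>y\<bar>"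
  proof (cases "1 \<le> \<bar>y\<bar>")
    case True
    then show ?thesis using b by (simp add: min_def)
  next
    case False
    then have "\<bar>z * y\<bar> \<le> (2 + \<bar>z\<bar>) * \<bar>y\<bar>" by (simp add: abs_mult mult_right_mono)
    then show ?thesis using a False by (simp add: min_def)
  qed
  also have "\<dots> \<le> (2 + \<bar>z\<bar>) * (2 * (1 - exp (- \<bar>y\<bar>)))"
    by (intro mult_left_mono one_minus_exp_lower) auto
  finally show ?thesis by (simp add: algebra_simps)
qed

lemma nn_integral_exp_tail:
  fixes a :: real
  assumes a: "0 < a"
  shows "(\<integral>\<^sup>+y. ennreal (if 0 < y then exp (- (a * y)) else 0) \<partial>lborel) = ennreal (1 / a)"
proof -
  have "(\<integral>\<^sup>+y. ennreal (if 0 < y then exp (- (a * y)) else 0) \<partial>lborel) =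
      (\<integral>\<^sup>+y. ennreal (exp (- (a * y))) * indicator {0..} y \<partial>lborel)"
    by (rule nn_integral_cong_AE)
      (use AE_lborel_singleton[of "0::real"] in \<open>eventually_elim, auto simp: indicator_def\<close>)
  also have "\<dots> = ennreal (0 - (- exp (- (a * 0)) / a))"
  proof (rule nn_integral_FTC_atLeast)
    show "DERIV (\<lambda>y. - exp (- (a * y)) / a) x :> exp (- (a * x))" if "0 \<le> x" for x
      using a by (auto intro!: derivative_eq_intros)
    show "((\<lambda>y. - exp (- (a * y)) / a) \<longlongrightarrow> 0) at_top"
      using a by real_asymp
  qed auto
  finally show ?thesis by simp
qed

text \<open>The integrand is the integral of \<open>exp (- (s + u) * y)\<close> over
  \<open>u\<close> in \<open>{0..w}\<close>. Tonelli then leaves the integral of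
  \<open>1 / (s + u)\<close>.\<close>

lemma nn_integral_frullani:
  fixes s w :: real
  assumes s: "0 < s" and w: "0 \<le> w"
  shows "(\<integral>\<^sup>+y. ennreal (if 0 < y then (1 - exp (- (w * y))) * exp (- (s * y)) / y else 0) \<partial>lborel) = ennreal (ln (1 + w / s))"
proof -
  have inner: "ennreal (if 0 < y then (1 - exp (- (w * y))) * exp (- (s * y)) / y else 0) =
      (\<integral>\<^sup>+u. ennreal (if 0 < y then exp (- ((s + u) * y)) else 0) * indicator {0..w} u \<partial>lborel)" for y :: real
  proof (cases "0 < y")
    case True
    have "(\<integral>\<^sup>+u. ennreal (exp (- ((s + u) * y))) * indicator {0..w} u \<partial>lborel) =
        ennreal ((- exp (- ((s + w) * y)) / y) - (- exp (- ((s + 0) * y)) / y))"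
    proof (rule nn_integral_FTC_Icc)
      show "DERIV (\<lambda>u. - exp (- ((s + u) * y)) / y) x :> exp (- ((s + x) * y))" for x
        using True by (auto intro!: derivative_eq_intros)
    qed (use w in auto)
    also have "(- exp (- ((s + w) * y)) / y) - (- exp (- ((s + 0) * y)) / y) =
        (1 - exp (- (w * y))) * exp (- (s * y)) / y"
      using True by (simp add: field_simps exp_add[symmetric])
    finally show ?thesis using True by simp
  qed auto
  have "(\<integral>\<^sup>+y. ennreal (if 0 < y then (1 - exp (- (w * y))) * exp (- (s * y)) / y else 0) \<partial>lborel) =
      (\<integral>\<^sup>+u. \<integral>\<^sup>+y. ennreal (if 0 < y then exp (- ((s + u) * y)) else 0) * indicator {0..w} u \<partial>lborel \<partial>lborel)"
    unfolding inner by (rule lborel_pair.Fubini') measurable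
  also have "\<dots> = (\<integral>\<^sup>+u. ennreal (1 / (s + u)) * indicator {0..w} u \<partial>lborel)"
  proof (rule nn_integral_cong)
    fix u :: real
    show "(\<integral>\<^sup>+y. ennreal (if 0 < y then exp (- ((s + u) * y)) else 0) * indicator {0..w} u \<partial>lborel) =
        ennreal (1 / (s + u)) * indicator {0..w} u"
      using nn_integral_exp_tail[of "s + u"] s by (cases "u \<in> {0..w}") auto
  qed
  also have "\<dots> = ennreal (ln (s + w) - ln (s + 0))"
  proof (rule nn_integral_FTC_Icc)
    show "DERIV (\<lambda>u. ln (s + u)) x :> 1 / (s + x)" if "x \<in> {0..w}" for x
      using s that by (auto intro!: derivative_eq_intros simp: divide_simps)
  qed (use s w in auto)
  also have "ln (s + w) - ln (s + 0) = ln (1 + w / s)"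
  proof -
    have "1 + w / s = (s + w) / s" using s by (simp add: add_divide_distrib)
    then show ?thesis using s w by (simp add: ln_div)
  qed
  finally show ?thesis .
qed

text \<open>Points \<open>s\<close> of a two-sided Thorin measure act on the half-line of the same sign only.\<close>

definition exp_kernel :: "real \<Rightarrow> real \<Rightarrow> real" where
  "exp_kernel s y = (if 0 < s * y then exp (- (s * y)) else 0)"

lemma exp_kernel_measurable [measurable]:
  "case_prod exp_kernel \<in> borel_measurable (borel \<Otimes>\<^sub>M borel)"
  unfolding exp_kernel_def[abs_def] by measurable

lemma exp_kernel_nonneg [simp]: "0 \<le> exp_kernel s y"
  and exp_kernel_le_1 [simp]: "exp_kernel s y \<le> 1"
  by (auto simp: exp_kernel_def)

lemma exp_kernel_minus: "exp_kernel (- s) (- y) = exp_kernel s y"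
  by (simp add: exp_kernel_def)

text \<open>Frullani's integral with \<open>w = 1\<close>, after a reflection if
  \<open>s < 0\<close>. It is the reason why \<open>ln (1 + 1 / \<bar>s\<bar>)\<close> is the right
  weight for a Thorin measure.\<close>

lemma nn_integral_exp_kernel:
  assumes s: "s \<noteq> 0"
  shows "(\<integral>\<^sup>+y. ennreal ((1 - exp (- \<bar>y\<bar>)) * (exp_kernel s y / \<bar>y\<bar>)) \<partial>lborel) = ennreal (ln (1 + 1 / \<bar>s\<bar>))"
proof -
  have pos: "(\<integral>\<^sup>+y. ennreal ((1 - exp (- \<bar>y\<bar>)) * (exp_kernel s y / \<bar>y\<bar>)) \<partial>lborel) = ennreal (ln (1 + 1 / s))"
    if s: "0 < s" for s
    unfolding nn_integral_frullani[OF s, of 1, simplified, symmetric]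
    using s by (intro nn_integral_cong) (auto simp: exp_kernel_def zero_less_mult_iff)
  show ?thesis
  proof (cases "0 < s")
    case True
    then show ?thesis using pos by simp
  next
    case False
    have "(\<integral>\<^sup>+y. ennreal ((1 - exp (- \<bar>y\<bar>)) * (exp_kernel s y / \<bar>y\<bar>)) \<partial>lborel) =
        (\<integral>\<^sup>+y. ennreal ((1 - exp (- \<bar>y\<bar>)) * (exp_kernel (- s) y / \<bar>y\<bar>)) \<partial>lborel)"
      using nn_integral_real_affine[of "\<lambda>y. ennreal ((1 - exp (- \<bar>y\<bar>)) * (exp_kernel s y / \<bar>y\<bar>))" "-1" 0]
      by (simp add: exp_kernel_minus[of "- s", simplified])
    then show ?thesis using pos[of "- s"] False s by simp
  qed
qed

text \<open>Analytic continuation in \<open>w\<close> of the real Frullani formula, which holds on a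
  positive segment accumulating at 0.\<close>

lemma frullani_halfplane:
  fixes s :: real and w0 :: complex
  assumes s: "0 < s" and w0: "- (s / 2) < Re w0"
  shows "(CLINT y|lborel. (if 0 < y then (exp (- w0 * of_real y) - 1) * of_real (exp (- (s * y)) / y) else 0)) = - Ln (1 + w0 / of_real s)"
proof -
  \<comment> \<open>Any bound exceeding \<open>norm w0\<close> works: a bounded domain is needed
    since the integrand grows linearly in \<open>norm w\<close>.\<close>
  define K where "K = norm w0 + 1"
  \<comment> \<open>The strip to the left keeps the imaginary axis inside the domain, so no boundary limit is needed.\<close>
  define S where "S = {w. - (s / 2) < Re w} \<inter> ball 0 K"
  define F where "F w y = (if 0 < y then (exp (- w * of_real y) - 1) * of_real (exp (- (s * y)) / y) else 0)"
    for w :: complex and y :: real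
  have op: "open S" unfolding S_def by (intro open_Int open_halfspace_Re_gt open_ball)
  \<comment> \<open>The factor \<open>exp (- w * y)\<close> costs at most half of the decay
    \<open>exp (- s * y)\<close>, and the linear factor \<open>y\<close> cancels the singularity
    \<open>1 / y\<close>.\<close>
  have F_bound: "norm (F w y) \<le> K * (if 0 < y then exp (- (s / 2 * y)) else 0)" if w: "w \<in> S" for w y
  proof (cases "0 < y")
    case True
    have Re: "Re (- w * of_real y) \<le> s / 2 * y"
    proof -
      have "- Re w * y \<le> s / 2 * y"
        using w True by (intro mult_right_mono) (auto simp: S_def)
      then show ?thesis by simp
    qed
    have "norm (exp (- w * of_real y) - 1) \<le> exp (s / 2 * y) * norm (- w * of_real y)"
      by (rule norm_exp_minus_one_le[OF Re]) (use s True in simp)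
    also have "\<dots> \<le> exp (s / 2 * y) * (K * y)"
      using w True by (intro mult_left_mono) (auto simp: S_def norm_mult intro!: mult_right_mono)
    finally have "norm (exp (- w * of_real y) - 1) * (exp (- (s * y)) / y) \<le> exp (s / 2 * y) * (K * y) * (exp (- (s * y)) / y)"
      using True by (intro mult_right_mono) auto
    moreover have "norm (F w y) = norm (exp (- w * of_real y) - 1) * (exp (- (s * y)) / y)"
      using True unfolding F_def norm_mult if_P[OF True] norm_of_real by simp
    ultimately have "norm (F w y) \<le> exp (s / 2 * y) * (K * y) * (exp (- (s * y)) / y)" by simp
    also have "\<dots> = K * (exp (s / 2 * y) * exp (- (s * y)))" using True by simp
    also have "exp (s / 2 * y) * exp (- (s * y)) = exp (- (s / 2 * y))"
      by (simp add: exp_add[symmetric])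
    finally show ?thesis using True by simp
  qed (simp add: F_def)
  have F_int: "(\<lambda>w. CLINT y|lborel. F w y) holomorphic_on S"
  proof (rule holomorphic_on_lebesgue_integral[OF op, where g = "\<lambda>y. K * (if 0 < y then exp (- (s / 2 * y)) else 0)"])
    show "integrable lborel (\<lambda>y. K * (if 0 < y then exp (- (s / 2 * y)) else 0))"
    proof (rule integrable_mult_right)
      show "integrable lborel (\<lambda>y. (if 0 < y then exp (- (s / 2 * y)) else 0) :: real)"
        by (rule integrableI_nn_integral_finite[where x = "1 / (s / 2)"])
          (use nn_integral_exp_tail[of "s / 2"] s in auto)
    qed
    show "F w \<in> borel_measurable lborel" for w
      unfolding F_def[abs_def] by measurable
    show "AE y in lborel. (\<lambda>w. F w y) holomorphic_on S \<and> (\<forall>w\<in>S. norm (F w y) \<le> K * (if 0 < y then exp (- (s / 2 * y)) else 0))"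
    proof (rule AE_I2, intro conjI ballI F_bound)
      show "(\<lambda>w. F w y) holomorphic_on S" for y
        unfolding F_def by (cases "0 < y") (auto intro!: holomorphic_intros)
    qed
  qed
  have pos: "0 < Re (1 + w / of_real s)" if "w \<in> S" for w
    using that s by (auto simp: S_def Re_divide_of_real field_simps)
  have hol: "(\<lambda>w. (CLINT y|lborel. F w y) + Ln (1 + w / of_real s)) holomorphic_on S"
    using pos s by (intro holomorphic_intros F_int) (auto simp: complex_nonpos_Reals_iff not_le[symmetric] leD)
  have K: "0 < K" "1 \<le> K" by (auto simp: K_def add_nonneg_pos)
  have "(CLINT y|lborel. F w0 y) + Ln (1 + w0 / of_real s) = 0"
  proof (rule analytic_continuation[OF hol op, where U = "of_real ` {0<..<K}" and \<xi> = 0])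
    show "connected S"
      unfolding S_def by (intro convex_connected convex_Int convex_halfspace_Re_gt convex_ball)
    show "complex_of_real ` {0<..<K} \<subseteq> S"
      using s by (auto simp: S_def)
    show "0 \<in> S" using s K by (auto simp: S_def)
    show "w0 \<in> S" using w0 by (auto simp: S_def K_def)
    show "0 islimpt complex_of_real ` {0<..<K}"
      unfolding islimpt_sequential
    proof (intro exI[of _ "\<lambda>n. complex_of_real (K / (real n + 2))"] conjI allI)
      show "complex_of_real (K / (real n + 2)) \<in> complex_of_real ` {0<..<K} - {0}" for n
      proof -
        have "K * 1 < K * (real n + 2)" using K(1) by (intro mult_strict_left_mono) auto
        then have "K / (real n + 2) \<in> {0<..<K} - {0}"
          using K by (simp add: divide_less_eq add_nonneg_pos)
        then show ?thesis by (auto simp del: of_real_divide of_real_add)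
      qed
      have "(\<lambda>n. K / (real n + 2)) \<longlonglongrightarrow> 0" by real_asymp
      from tendsto_of_real[OF this, where 'a = complex]
      show "(\<lambda>n. complex_of_real (K / (real n + 2))) \<longlonglongrightarrow> 0" by simp
    qed
    show "(CLINT y|lborel. F z y) + Ln (1 + z / of_real s) = 0" if z: "z \<in> of_real ` {0<..<K}" for z
    proof -
      obtain w where w: "z = of_real w" "0 < w" using z by auto
      have "F z y = of_real (- (if 0 < y then (1 - exp (- (w * y))) * exp (- (s * y)) / y else 0))" for y
        by (simp add: F_def w exp_of_real[symmetric] left_diff_distrib diff_divide_distrib)
      then have "(CLINT y|lborel. F z y) = of_real (LINT y|lborel. - (if 0 < y then (1 - exp (- (w * y))) * exp (- (s * y)) / y else 0))"
        by (simp only: integral_complex_of_real)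
      also have "(LINT y|lborel. - (if 0 < y then (1 - exp (- (w * y))) * exp (- (s * y)) / y else 0)) =
          - (LINT y|lborel. (if 0 < y then (1 - exp (- (w * y))) * exp (- (s * y)) / y else 0))"
        by (rule Bochner_Integration.integral_minus)
      also have "(LINT y|lborel. (if 0 < y then (1 - exp (- (w * y))) * exp (- (s * y)) / y else 0)) = ln (1 + w / s)"
        using s w nn_integral_frullani[OF s, of w]
        by (subst integral_eq_nn_integral) (auto intro!: AE_I2 divide_nonneg_pos mult_nonneg_nonneg)
      finally have "(CLINT y|lborel. F z y) = - of_real (ln (1 + w / s))" by simp
      moreover have "Ln (1 + z / of_real s) = of_real (ln (1 + w / s))"
      proof -
        have "0 < 1 + w / s" using w s by (simp add: add_pos_pos)
        from Ln_of_real[OF this] show ?thesis by (simp add: w)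
      qed
      ultimately show ?thesis by simp
    qed
  qed
  then show ?thesis by (simp add: F_def eq_neg_iff_add_eq_0)
qed

text \<open>The continued formula at \<open>w = - \<i> * z\<close>; negative \<open>s\<close>
  reduces to positive \<open>s\<close> by reflecting \<open>y\<close>.\<close>

lemma frullani_char:
  fixes s z :: real
  assumes s: "s \<noteq> 0"
  shows "(CLINT y|lborel. (iexp (z * y) - 1) * of_real (exp_kernel s y / \<bar>y\<bar>)) = - Ln (1 - \<i> * of_real (z / s))"
proof -
  have pos: "(CLINT y|lborel. (iexp (z * y) - 1) * of_real (exp_kernel s y / \<bar>y\<bar>)) = - Ln (1 - \<i> * of_real (z / s))"
    if s: "0 < s" for s z :: real
  proof -
    have "(iexp (z * y) - 1) * of_real (exp_kernel s y / \<bar>y\<bar>) =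
        (if 0 < y then (exp (- (- \<i> * of_real z) * of_real y) - 1) * of_real (exp (- (s * y)) / y) else 0)" for y
      using s by (auto simp: exp_kernel_def zero_less_mult_iff mult.assoc)
    then show ?thesis
      using frullani_halfplane[OF s, of "- \<i> * of_real z"] s by simp
  qed
  show ?thesis
  proof (cases "0 < s")
    case True
    then show ?thesis by (rule pos)
  next
    case False
    have "(CLINT y|lborel. (iexp (z * y) - 1) * of_real (exp_kernel s y / \<bar>y\<bar>)) =
        (CLINT y|lborel. (iexp (- z * y) - 1) * of_real (exp_kernel (- s) y / \<bar>y\<bar>))"
      using lborel_integral_real_affine[of "-1" "\<lambda>y. (iexp (z * y) - 1) * complex_of_real (exp_kernel s y / \<bar>y\<bar>)" 0]
      by (simp add: exp_kernel_minus[of "- s", simplified])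
    also have "\<dots> = - Ln (1 - \<i> * of_real (z / s))"
      using pos[of "- s" "- z"] False s by simp
    finally show ?thesis .
  qed
qed

section \<open>Compound Poisson laws and gamma convolutions\<close>

lemma expectation_poisson_power:
  fixes w :: complex
  assumes m: "0 < m" and w: "norm w \<le> 1"
  shows "(CLINT k|measure_pmf (poisson_pmf m). w ^ k) = exp (of_real m * (w - 1))"
proof -
  let ?f = "\<lambda>k. (m ^ k / fact k * exp (- m)) *\<^sub>R w ^ k"
  have eq: "?f k = exp (- of_real m) * ((of_real m * w) ^ k /\<^sub>R fact k)" for k
    by (simp add: scaleR_conv_of_real power_mult_distrib exp_of_real[symmetric] field_simps)
  have "(\<lambda>k. (of_real m * w) ^ k /\<^sub>R fact k) sums exp (of_real m * w)"
    by (rule exp_converges)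
  then have s: "?f sums (exp (- of_real m) * exp (of_real m * w))"
    unfolding eq by (rule sums_mult)
  have "summable (\<lambda>k. norm (?f k))"
    unfolding eq norm_mult by (intro summable_mult summable_norm_exp)
  then have int: "integrable (count_space UNIV) ?f"
    by (simp add: integrable_count_space_nat_iff)
  have "(CLINT k|measure_pmf (poisson_pmf m). w ^ k) = integral\<^sup>L (count_space UNIV) ?f"
    unfolding measure_pmf_eq_density using m by (subst integral_density) auto
  also have "\<dots> = exp (- of_real m) * exp (of_real m * w)"
    using integral_count_space_nat[OF int] s by (simp add: sums_iff)
  finally show ?thesis
    by (simp add: exp_add[symmetric] algebra_simps)
qed

text \<open>A Poisson number of independent jumps with law \<open>\<Lambda>\<close> normalized. A
  null \<open>\<Lambda>\<close> cannot be normalized and gives the point mass at 0.\<close>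

lemma compound_poisson_exists:
  fixes \<Lambda> :: "real measure"
  assumes fin: "finite_measure \<Lambda>" and sets[measurable_cong]: "sets \<Lambda> = sets borel"
  shows "\<exists>\<rho>. real_distribution \<rho> \<and> (\<forall>z. char \<rho> z = exp (CLINT x|\<Lambda>. iexp (z * x) - 1))"
proof -
  interpret L: finite_measure \<Lambda> by fact
  define m where "m = measure \<Lambda> (space \<Lambda>)"
  show ?thesis
  proof (cases "m = 0")
    case True
    then have "emeasure \<Lambda> (space \<Lambda>) = 0" by (simp add: m_def L.emeasure_eq_measure)
    then have "AE x in \<Lambda>. False" by (simp add: AE_iff_null null_sets_def)
    then have "(CLINT x|\<Lambda>. iexp (z * x) - 1) = 0" for z
      by (intro integral_eq_zero_AE) auto
    moreover have "real_distribution (return borel (0 :: real))"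
      by (auto simp: real_distribution_def real_distribution_axioms_def intro!: prob_space_return)
    ultimately show ?thesis
      by (intro exI[of _ "return borel 0"]) (auto simp: char_def integral_return)
  next
    case False
    then have m: "0 < m" by (simp add: m_def zero_less_measure_iff)
    define J where "J = density \<Lambda> (\<lambda>_. ennreal (1 / m))"
    have [measurable_cong, simp]: "sets J = sets borel" by (simp add: J_def sets)
    have "prob_space J"
    proof
      have "emeasure J (space J) = ennreal (1 / m) * emeasure \<Lambda> (space \<Lambda>)"
        unfolding J_def by (simp add: emeasure_density nn_integral_cmult)
      also have "\<dots> = 1"
        using m by (simp add: L.emeasure_eq_measure m_def[symmetric] ennreal_mult[symmetric])
      finally show "emeasure J (space J) = 1" .
    qed
    interpret l: prob_space J by fact
    \<comment> \<open>An infinite product supplies jumps for every value of the Poisson count;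
      pairing it with \<open>?N\<close> makes the count independent of them.\<close>
    define P where "P = (\<Pi>\<^sub>M i\<in>(UNIV::nat set). J)"
    have [measurable]: "(\<lambda>x. x i) \<in> borel_measurable P" for i
      unfolding P_def by measurable
    interpret P: prob_space P
      unfolding P_def using \<open>prob_space J\<close> by (intro prob_space_PiM)
    let ?N = "measure_pmf (poisson_pmf m)"
    interpret NP: pair_prob_space ?N P ..
    have comp: "distr P borel (\<lambda>x. x i) = J" for i
    proof -
      have "distr P borel (\<lambda>x. x i) = distr P J (\<lambda>x. x i)"
        by (rule distr_cong) simp_all
      then show ?thesis
        using distr_PiM_component[of UNIV "\<lambda>_. J" i] \<open>prob_space J\<close> by (simp add: P_def)
    qed
    have indep: "P.indep_vars (\<lambda>_. borel) (\<lambda>i x. x i) UNIV"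
    proof (subst P.indep_vars_iff_distr_eq_PiM)
      have "distr P (\<Pi>\<^sub>M i\<in>UNIV. borel) (\<lambda>x. \<lambda>i\<in>UNIV. x i) = distr P P (\<lambda>x. x)"
      proof (rule distr_cong)
        show "sets (\<Pi>\<^sub>M i\<in>UNIV. borel) = sets P"
          unfolding P_def by (rule sets_PiM_cong) simp_all
      qed auto
      then show "distr P (\<Pi>\<^sub>M i\<in>UNIV. borel) (\<lambda>x. \<lambda>i\<in>UNIV. x i) = (\<Pi>\<^sub>M i\<in>UNIV. distr P borel (\<lambda>x. x i))"
        by (simp add: comp distr_id[unfolded id_def]) (simp add: P_def)
    qed auto
    define S where "S p = (\<Sum>i<fst p. snd p i)" for p :: "nat \<times> (nat \<Rightarrow> real)"
    have Sm[measurable]: "S \<in> borel_measurable (?N \<Otimes>\<^sub>M P)"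
    proof -
      have "(\<lambda>p. (\<lambda>k p. \<Sum>i<k. snd p i) (fst p) p) \<in> borel_measurable (?N \<Otimes>\<^sub>M P)"
      proof (rule measurable_compose_countable[where f = "\<lambda>k p. \<Sum>i<k. snd p i"])
        show "fst \<in> ?N \<Otimes>\<^sub>M P \<rightarrow>\<^sub>M count_space UNIV" by measurable
      qed measurable
      then show ?thesis by (simp add: S_def[abs_def])
    qed
    have "char (distr (?N \<Otimes>\<^sub>M P) borel S) z = exp (CLINT x|\<Lambda>. iexp (z * x) - 1)" for z
    proof -
      interpret ld: real_distribution J
        by (auto simp: real_distribution_def real_distribution_axioms_def \<open>prob_space J\<close>)
      have inner: "(CLINT x|P. iexp (z * S (k, x))) = char J z ^ k" for k
      proof -
        have "(CLINT x|P. iexp (z * S (k, x))) = char (distr P borel (\<lambda>x. \<Sum>i<k. x i)) z"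
          by (simp add: char_def integral_distr S_def)
        also have "\<dots> = (\<Prod>i<k. char (distr P borel (\<lambda>x. x i)) z)"
          by (rule P.char_distr_sum) (rule P.indep_vars_subset[OF indep], simp)
        finally show ?thesis by (simp add: comp)
      qed
      have "char (distr (?N \<Otimes>\<^sub>M P) borel S) z = (CLINT p|?N \<Otimes>\<^sub>M P. iexp (z * S p))"
        by (simp add: char_def integral_distr)
      also have "\<dots> = (CLINT k|?N. CLINT x|P. iexp (z * S (k, x)))"
        by (subst NP.integral_fst'[symmetric]) (auto intro!: NP.P.integrable_const_bound[where B = 1])
      also have "\<dots> = exp (of_real m * (char J z - 1))"
        unfolding inner by (rule expectation_poisson_power[OF m ld.cmod_char_le_1])
      also have "of_real m * (char J z - 1) = (CLINT x|\<Lambda>. iexp (z * x) - 1)"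
      proof -
        have iexp_m: "(\<lambda>x. iexp (z * x)) \<in> borel_measurable \<Lambda>"
          by (subst measurable_cong_sets[OF sets refl]) measurable
        have "char J z = (1 / m) *\<^sub>R (CLINT x|\<Lambda>. iexp (z * x))"
          unfolding char_def J_def using m by (subst integral_density[OF iexp_m]) auto
        moreover have "(CLINT x|\<Lambda>. iexp (z * x) - 1) = (CLINT x|\<Lambda>. iexp (z * x)) - of_real m"
          by (subst Bochner_Integration.integral_diff)
            (use iexp_m in \<open>auto intro!: L.integrable_const_bound[where B = 1] simp: m_def scaleR_conv_of_real\<close>)
        ultimately show ?thesis
          using m by (simp add: scaleR_conv_of_real algebra_simps)
      qed
      finally show ?thesis .
    qed
    moreover have "real_distribution (distr (?N \<Otimes>\<^sub>M P) borel S)"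
      by (rule NP.P.real_distribution_distr) measurable
    ultimately show ?thesis by blast
  qed
qed

lemma char_convolution:
  fixes \<mu> \<rho> :: "real measure"
  assumes "real_distribution \<mu>" "real_distribution \<rho>"
  shows "char (\<mu> \<star> \<rho>) z = char \<mu> z * char \<rho> z" and "real_distribution (\<mu> \<star> \<rho>)"
proof -
  interpret m: real_distribution \<mu> by fact
  interpret r: real_distribution \<rho> by fact
  interpret P: pair_prob_space \<mu> \<rho> ..
  have add[measurable]: "(\<lambda>(x, y). x + y :: real) \<in> borel_measurable (\<mu> \<Otimes>\<^sub>M \<rho>)"
    by measurable
  show "real_distribution (\<mu> \<star> \<rho>)"
    unfolding convolution_def by (rule P.P.real_distribution_distr) measurable
  have "char (\<mu> \<star> \<rho>) z = (CLINT p|\<mu> \<Otimes>\<^sub>M \<rho>. iexp (z * (fst p + snd p)))"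
    unfolding convolution_def char_def by (subst integral_distr) (auto simp: split_beta')
  also have "\<dots> = (CLINT x|\<mu>. CLINT y|\<rho>. iexp (z * (x + y)))"
    by (subst P.integral_fst'[symmetric]) (auto intro!: P.P.integrable_const_bound[where B = 1])
  also have "\<dots> = (CLINT x|\<mu>. CLINT y|\<rho>. iexp (z * x) * iexp (z * y))"
    by (simp add: exp_add[symmetric] distrib_left)
  finally show "char (\<mu> \<star> \<rho>) z = char \<mu> z * char \<rho> z"
    by (simp add: char_def)
qed

text \<open>An atom of weight \<open>a y\<close> at \<open>y\<close> is realized by
  \<open>V / y\<close> with \<open>V\<close> gamma of shape \<open>a y\<close> and rate 1.
  \<open>K\<close> must be nonempty because \<open>gamma_convolution\<close> contains no empty
  convolution.\<close>

lemma gamma_convolution_finite_sum: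
  fixes a :: "real \<Rightarrow> real"
  assumes "finite K" "K \<noteq> {}" "\<And>y. y \<in> K \<Longrightarrow> y \<noteq> 0 \<and> 0 < a y"
  shows "\<exists>\<mu>. gamma_convolution \<mu> \<and> real_distribution \<mu> \<and>
    (\<forall>z. char \<mu> z = exp (- (\<Sum>y\<in>K. of_real (a y) * Ln (1 - \<i> * of_real (z / y)))))"
  using assms
proof (induction K rule: finite_ne_induct)
  have single: "\<exists>\<mu>. gamma_convolution \<mu> \<and> real_distribution \<mu> \<and>
      (\<forall>z. char \<mu> z = exp (- (of_real b * Ln (1 - \<i> * of_real (z / y)))))"
    if b: "0 < b" and y: "y \<noteq> 0" for b y :: real
  proof -
    interpret prob_space "gamma_law b 1" by (rule prob_space_gamma_law[OF b])
    have "char (distr (gamma_law b 1) borel (\<lambda>v. v * (1 / y))) z = char (gamma_law b 1) (z / y)" for z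
      by (subst char_def, subst integral_distr) (auto simp: char_def mult.commute)
    then show ?thesis
      using gamma_convolution.single[OF b zero_less_one, of "1 / y"] y
      by (intro exI[of _ "distr (gamma_law b 1) borel (\<lambda>v. v * (1 / y))"])
        (auto intro!: real_distribution_distr simp: char_gamma_law[OF b])
  qed
  {
    case (singleton y)
    then show ?case using single[of "a y" y] by simp
  next
    case (insert y K)
    then obtain \<mu> where \<mu>: "gamma_convolution \<mu>" "real_distribution \<mu>"
      "\<And>z. char \<mu> z = exp (- (\<Sum>y\<in>K. of_real (a y) * Ln (1 - \<i> * of_real (z / y))))"
      by blast
    obtain \<rho> where \<rho>: "gamma_convolution \<rho>" "real_distribution \<rho>"
      "\<And>z. char \<rho> z = exp (- (of_real (a y) * Ln (1 - \<i> * of_real (z / y))))"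
      using single[of "a y" y] insert.prems by auto
    show ?case
      using gamma_convolution.conv[OF \<rho>(1) \<mu>(1)] char_convolution[OF \<rho>(2) \<mu>(2)] insert.hyps
      by (intro exI[of _ "\<rho> \<star> \<mu>"]) (auto simp: \<mu>(3) \<rho>(3) exp_add[symmetric])
  }
qed

section \<open>Laws given by a finite Thorin measure\<close>

text \<open>Finite mass bounds \<open>k\<close>, the logarithmic condition controls small
  \<open>s\<close>, and the bound \<open>R\<close> makes the rounding grid finite.\<close>

locale thorin_measure = finite_measure \<tau> for \<tau> :: "real measure" +
  fixes R :: real
  assumes sets_tau[measurable_cong, simp]: "sets \<tau> = sets borel"
    and nonzero: "AE s in \<tau>. s \<noteq> 0"
    and bounded: "AE s in \<tau>. \<bar>s\<bar> \<le> R"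
    and integrable_ln: "integrable \<tau> (\<lambda>s. ln (1 + 1 / \<bar>s\<bar>))"
begin

lemma space_tau [simp]: "space \<tau> = UNIV"
  using sets_eq_imp_space_eq[OF sets_tau] by simp

text \<open>The negative logarithm of the characteristic function, with neither drift nor
  truncation: it converges as it stands under the conditions of the locale.\<close>

definition exponent :: "real \<Rightarrow> complex" where
  "exponent z = (CLINT s|\<tau>. Ln (1 - \<i> * of_real (z / s)))"

lemma integrable_bound_Ln: "integrable \<tau> (\<lambda>s. ln (1 + \<bar>z\<bar>) + ln (1 + 1 / \<bar>s\<bar>) + pi)"
  by (intro Bochner_Integration.integrable_add integrable_ln) auto

lemma integrable_Ln: "integrable \<tau> (\<lambda>s. Ln (1 - \<i> * of_real (z / s)))"
  by (rule Bochner_Integration.integrable_bound[OF integrable_bound_Ln[of z]])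
    (auto intro!: AE_I2 order_trans[OF norm_Ln_one_minus_i_le] simp del: of_real_divide)

definition k :: "real \<Rightarrow> real" where
  "k y = (LINT s|\<tau>. exp_kernel s y)"

lemma integrable_exp_kernel: "integrable \<tau> (\<lambda>s. exp_kernel s y)"
  by (rule integrable_const_bound[where B = 1]) auto

lemma k_measurable [measurable]: "k \<in> borel_measurable borel"
  unfolding k_def[abs_def] by (rule borel_measurable_lebesgue_integral) measurable

lemma k_nonneg [simp]: "0 \<le> k y"
  unfolding k_def by (rule integral_nonneg_AE) auto

lemma k_mono:
  assumes "\<bar>y\<bar> \<le> \<bar>x\<bar>" "0 < x * y"
  shows "k x \<le> k y"
  unfolding k_def
proof (rule integral_mono[OF integrable_exp_kernel integrable_exp_kernel])
  fix s
  have "s * y \<le> s * x \<and> 0 < s * y" if "0 < s * x"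
  proof (cases "0 < x")
    case True
    then show ?thesis using that assms by (auto simp: zero_less_mult_iff)
  next
    case False
    then show ?thesis using that assms by (auto simp: zero_less_mult_iff mult_le_cancel_left)
  qed
  then show "exp_kernel s x \<le> exp_kernel s y"
    by (auto simp: exp_kernel_def)
qed

lemma antimono_k: "antimono_on {0<..} k"
  by (rule monotone_onI) (auto intro: k_mono)

lemma mono_k: "mono_on {..<0} k"
  by (rule monotone_onI) (auto intro: k_mono simp: mult_neg_neg)

lemma k_le: "k y \<le> measure \<tau> UNIV"
proof -
  have "k y \<le> (LINT s|\<tau>. 1)"
    unfolding k_def by (rule integral_mono[OF integrable_exp_kernel]) auto
  then show ?thesis by simp
qed

text \<open>Common to both one-sided limits at 0: \<open>B\<close> will be the half-line of those
  \<open>s\<close> that have the same sign as the points of \<open>A\<close>.\<close>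

lemma tendsto_exp_kernel_integral:
  assumes "\<And>X s. (\<And>i. X i \<in> A) \<Longrightarrow> X \<longlonglongrightarrow> 0 \<Longrightarrow> (\<lambda>i. exp_kernel s (X i)) \<longlonglongrightarrow> indicator B s"
    and [measurable]: "B \<in> sets borel"
  shows "(k \<longlongrightarrow> measure \<tau> B) (at 0 within A)"
  unfolding tendsto_at_iff_sequentially
proof (intro allI impI)
  fix X :: "nat \<Rightarrow> real"
  assume X: "\<forall>i. X i \<in> A - {0}" "X \<longlonglongrightarrow> 0"
  have "(\<lambda>i. LINT s|\<tau>. exp_kernel s (X i)) \<longlonglongrightarrow> (LINT s|\<tau>. indicator B s)"
  proof (rule integral_dominated_convergence[where w = "\<lambda>_. 1"])
    show "AE s in \<tau>. (\<lambda>i. exp_kernel s (X i)) \<longlonglongrightarrow> indicator B s"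
      using assms(1) X by auto
  qed auto
  then show "(k \<circ> X) \<longlonglongrightarrow> measure \<tau> B"
    by (simp add: k_def[abs_def] o_def)
qed

lemma tendsto_exp_minus: "X \<longlonglongrightarrow> 0 \<Longrightarrow> (\<lambda>i. exp (- (s * X i))) \<longlonglongrightarrow> (1 :: real)"
  using tendsto_exp[OF tendsto_minus[OF tendsto_mult[OF tendsto_const[of s]]], of X 0] by simp

lemma k_right: "(k \<longlongrightarrow> measure \<tau> {0<..}) (at_right 0)"
proof (rule tendsto_exp_kernel_integral)
  fix X :: "nat \<Rightarrow> real" and s :: real
  assume X: "\<And>i. X i \<in> {0<..}" "X \<longlonglongrightarrow> 0"
  have "exp_kernel s (X i) = (if 0 < s then exp (- (s * X i)) else 0)" for i
    using X(1)[of i] by (auto simp: exp_kernel_def zero_less_mult_iff)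
  then show "(\<lambda>i. exp_kernel s (X i)) \<longlonglongrightarrow> indicator {0<..} s"
    using tendsto_exp_minus[OF X(2), of s] by (cases "0 < s") auto
qed simp

lemma k_left: "(k \<longlongrightarrow> measure \<tau> {..<0}) (at_left 0)"
proof (rule tendsto_exp_kernel_integral)
  fix X :: "nat \<Rightarrow> real" and s :: real
  assume X: "\<And>i. X i \<in> {..<0}" "X \<longlonglongrightarrow> 0"
  have "exp_kernel s (X i) = (if s < 0 then exp (- (s * X i)) else 0)" for i
    using X(1)[of i] by (auto simp: exp_kernel_def zero_less_mult_iff)
  then show "(\<lambda>i. exp_kernel s (X i)) \<longlonglongrightarrow> indicator {..<0} s"
    using tendsto_exp_minus[OF X(2), of s] by (cases "s < 0") auto
qed simp

sublocale tl: pair_sigma_finite \<tau> lborel ..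

lemma ennreal_k: "ennreal (k y) = (\<integral>\<^sup>+s. ennreal (exp_kernel s y) \<partial>\<tau>)"
  unfolding k_def by (rule nn_integral_eq_integral[symmetric, OF integrable_exp_kernel]) auto

lemma nn_integral_k_weighted:
  assumes [measurable]: "g \<in> borel_measurable borel" and g: "\<And>y. 0 \<le> g y"
  shows "(\<integral>\<^sup>+y. ennreal (g y * k y) \<partial>lborel) = (\<integral>\<^sup>+s. \<integral>\<^sup>+y. ennreal (g y * exp_kernel s y) \<partial>lborel \<partial>\<tau>)"
proof -
  have "(\<integral>\<^sup>+y. ennreal (g y * k y) \<partial>lborel) = (\<integral>\<^sup>+y. \<integral>\<^sup>+s. ennreal (g y * exp_kernel s y) \<partial>\<tau> \<partial>lborel)"
    by (intro nn_integral_cong) (simp add: ennreal_mult g ennreal_k nn_integral_cmult)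
  also have "\<dots> = (\<integral>\<^sup>+s. \<integral>\<^sup>+y. ennreal (g y * exp_kernel s y) \<partial>lborel \<partial>\<tau>)"
    by (rule tl.Fubini') measurable
  finally show ?thesis .
qed

text \<open>Tonelli reduces the claim to the integrability of
  \<open>ln (1 + 1 / \<bar>s\<bar>)\<close>. It says that small jumps are summable, so functions
  vanishing linearly at 0 can be integrated without compensation.\<close>

lemma nn_integral_k_finite:
  "(\<integral>\<^sup>+y. ennreal ((1 - exp (- \<bar>y\<bar>)) / \<bar>y\<bar> * k y) \<partial>lborel) < \<infinity>"
proof -
  have "(\<integral>\<^sup>+y. ennreal ((1 - exp (- \<bar>y\<bar>)) / \<bar>y\<bar> * k y) \<partial>lborel) =
      (\<integral>\<^sup>+s. \<integral>\<^sup>+y. ennreal ((1 - exp (- \<bar>y\<bar>)) / \<bar>y\<bar> * exp_kernel s y) \<partial>lborel \<partial>\<tau>)"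
    by (rule nn_integral_k_weighted) auto
  also have "\<dots> = (\<integral>\<^sup>+s. ennreal (ln (1 + 1 / \<bar>s\<bar>)) \<partial>\<tau>)"
    using nonzero by (intro nn_integral_cong_AE, eventually_elim) (use nn_integral_exp_kernel in simp)
  also have "\<dots> < \<infinity>"
    using integrable_ln by (subst nn_integral_eq_integral) auto
  finally show ?thesis .
qed

lemma integrable_k: "integrable lborel (\<lambda>y. (1 - exp (- \<bar>y\<bar>)) / \<bar>y\<bar> * k y)"
  by (rule integrableI_nonneg) (use nn_integral_k_finite in auto)

lemma integrable_k_dominated:
  fixes h :: "real \<Rightarrow> 'b :: {banach, second_countable_topology}"
  assumes [measurable]: "h \<in> borel_measurable borel"
    and h: "\<And>y. norm (h y) \<le> C * (1 - exp (- \<bar>y\<bar>))"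
  shows "integrable lborel (\<lambda>y. (k y / \<bar>y\<bar>) *\<^sub>R h y)"
proof (rule Bochner_Integration.integrable_bound[OF integrable_mult_right[OF integrable_k, of C]])
  show "AE y in lborel. norm ((k y / \<bar>y\<bar>) *\<^sub>R h y) \<le> norm (C * ((1 - exp (- \<bar>y\<bar>)) / \<bar>y\<bar> * k y))"
  proof (rule AE_I2)
    fix y :: real
    have "norm ((k y / \<bar>y\<bar>) *\<^sub>R h y) \<le> (k y / \<bar>y\<bar>) * (C * (1 - exp (- \<bar>y\<bar>)))"
      using mult_left_mono[OF h[of y], of "k y / \<bar>y\<bar>"] by simp
    also have "\<dots> = C * ((1 - exp (- \<bar>y\<bar>)) / \<bar>y\<bar> * k y)" by simp
    finally show "norm ((k y / \<bar>y\<bar>) *\<^sub>R h y) \<le> norm (C * ((1 - exp (- \<bar>y\<bar>)) / \<bar>y\<bar> * k y))"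
      by (simp only: real_norm_def)
  qed
qed measurable

text \<open>Fubini puts the integral over \<open>y\<close> inside, where
  \<open>frullani_char\<close> evaluates it. Joint integrability follows from the weight
  \<open>1 - exp (- \<bar>y\<bar>)\<close> and \<open>nn_integral_exp_kernel\<close>.\<close>

lemma integral_k_char:
  "(CLINT y|lborel. (k y / \<bar>y\<bar>) *\<^sub>R (iexp (z * y) - 1)) = - exponent z"
proof -
  let ?f = "\<lambda>s y. (iexp (z * y) - 1) * complex_of_real (exp_kernel s y / \<bar>y\<bar>)"
  let ?g = "\<lambda>s y. (4 + 2 * \<bar>z\<bar>) * ((1 - exp (- \<bar>y\<bar>)) * (exp_kernel s y / \<bar>y\<bar>))"
  have int: "integrable (\<tau> \<Otimes>\<^sub>M lborel) (case_prod ?f)"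
  proof (rule Bochner_Integration.integrable_bound)
    show "integrable (\<tau> \<Otimes>\<^sub>M lborel) (case_prod ?g)"
    proof (rule integrableI_nonneg)
      have "(\<integral>\<^sup>+p. ennreal (case_prod ?g p) \<partial>(\<tau> \<Otimes>\<^sub>M lborel)) = (\<integral>\<^sup>+s. \<integral>\<^sup>+y. ennreal (?g s y) \<partial>lborel \<partial>\<tau>)"
        by (subst lborel.nn_integral_fst[symmetric]) auto
      also have "\<dots> = (\<integral>\<^sup>+s. ennreal (4 + 2 * \<bar>z\<bar>) * ennreal (ln (1 + 1 / \<bar>s\<bar>)) \<partial>\<tau>)"
      proof (rule nn_integral_cong_AE)
        show "AE s in \<tau>. (\<integral>\<^sup>+y. ennreal (?g s y) \<partial>lborel) = ennreal (4 + 2 * \<bar>z\<bar>) * ennreal (ln (1 + 1 / \<bar>s\<bar>))"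
          using nonzero
        proof eventually_elim
          case (elim s)
          have "(\<integral>\<^sup>+y. ennreal (?g s y) \<partial>lborel) = (\<integral>\<^sup>+y. ennreal (4 + 2 * \<bar>z\<bar>) * ennreal ((1 - exp (- \<bar>y\<bar>)) * (exp_kernel s y / \<bar>y\<bar>)) \<partial>lborel)"
            by (intro nn_integral_cong ennreal_mult) auto
          also have "\<dots> = ennreal (4 + 2 * \<bar>z\<bar>) * ennreal (ln (1 + 1 / \<bar>s\<bar>))"
            using nn_integral_exp_kernel[OF elim] by (subst nn_integral_cmult) auto
          finally show ?case .
        qed
      qed
      also have "\<dots> = ennreal (4 + 2 * \<bar>z\<bar>) * (\<integral>\<^sup>+s. ennreal (ln (1 + 1 / \<bar>s\<bar>)) \<partial>\<tau>)"
        by (rule nn_integral_cmult) auto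
      also have "\<dots> < \<infinity>"
        using integrable_ln by (subst nn_integral_eq_integral) (auto simp: ennreal_mult_less_top)
      finally show "(\<integral>\<^sup>+p. ennreal (case_prod ?g p) \<partial>(\<tau> \<Otimes>\<^sub>M lborel)) < \<infinity>" .
    qed auto
    show "AE p in \<tau> \<Otimes>\<^sub>M lborel. norm (case_prod ?f p) \<le> norm (case_prod ?g p)"
    proof (rule AE_I2, clarify)
      fix s y
      have "norm (?f s y) \<le> (4 + 2 * \<bar>z\<bar>) * (1 - exp (- \<bar>y\<bar>)) * (exp_kernel s y / \<bar>y\<bar>)"
        unfolding norm_mult norm_of_real using mult_right_mono[OF norm_iexp_minus_one_le, of "exp_kernel s y / \<bar>y\<bar>" z y] by simp
      then show "norm (?f s y) \<le> norm (?g s y)"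
        by (simp only: mult.assoc real_norm_def)
    qed
  qed measurable
  have "(CLINT y|lborel. (k y / \<bar>y\<bar>) *\<^sub>R (iexp (z * y) - 1)) = (CLINT y|lborel. CLINT s|\<tau>. ?f s y)"
  proof (rule Bochner_Integration.integral_cong[OF refl])
    fix y
    have "(CLINT s|\<tau>. ?f s y) = (iexp (z * y) - 1) * (CLINT s|\<tau>. complex_of_real (exp_kernel s y / \<bar>y\<bar>))"
      by (rule integral_mult_right_zero)
    also have "(CLINT s|\<tau>. complex_of_real (exp_kernel s y / \<bar>y\<bar>)) = of_real (k y / \<bar>y\<bar>)"
      by (simp only: integral_complex_of_real k_def integral_divide_zero)
    finally show "(k y / \<bar>y\<bar>) *\<^sub>R (iexp (z * y) - 1) = (CLINT s|\<tau>. ?f s y)"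
      by (simp only: scaleR_conv_of_real mult.commute)
  qed
  also have "\<dots> = (CLINT s|\<tau>. CLINT y|lborel. ?f s y)"
    by (rule tl.Fubini_integral[OF int])
  also have "\<dots> = (CLINT s|\<tau>. - Ln (1 - \<i> * of_real (z / s)))"
  proof (rule integral_cong_AE)
    show "AE s in \<tau>. (CLINT y|lborel. ?f s y) = - Ln (1 - \<i> * of_real (z / s))"
      using nonzero by eventually_elim (rule frullani_char)
    show "(\<lambda>s. CLINT y|lborel. ?f s y) \<in> borel_measurable \<tau>"
      by (rule lborel.borel_measurable_lebesgue_integral) measurable
    show "(\<lambda>s. - Ln (1 - \<i> * of_real (z / s))) \<in> borel_measurable \<tau>"
      by measurable
  qed
  finally show ?thesis
    by (simp only: exponent_def Bochner_Integration.integral_minus)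
qed

section \<open>Levy-Khintchine form and Blumenthal-Getoor index\<close>

definition levy_measure :: "real measure" where
  "levy_measure = density lborel (\<lambda>y. ennreal (k y / \<bar>y\<bar>))"

lemma has_levy_measure_levy_measure:
  assumes ch: "\<And>z. char (distr M borel (Y 1)) z = exp (- exponent z)"
  shows "has_levy_measure M Y levy_measure"
  unfolding has_levy_measure_def
proof (intro conjI)
  show "sets levy_measure = sets borel" by (simp add: levy_measure_def)
  show "emeasure levy_measure {0} = 0"
    unfolding levy_measure_def by (subst emeasure_density) (auto simp: nn_integral_0_iff_AE intro!: AE_I2 split: split_indicator)
  have "(\<integral>\<^sup>+x. ennreal (min 1 (x\<^sup>2)) \<partial>levy_measure) = (\<integral>\<^sup>+y. ennreal (k y / \<bar>y\<bar> * min 1 (y\<^sup>2)) \<partial>lborel)"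
    unfolding levy_measure_def by (subst nn_integral_density) (auto simp: ennreal_mult simp del: times_divide_eq_left)
  also have "\<dots> < \<infinity>"
  proof -
    have "norm (min 1 (y\<^sup>2)) \<le> 2 * (1 - exp (- \<bar>y\<bar>))" for y :: real
    proof -
      have "min 1 (y\<^sup>2) \<le> min 1 \<bar>y\<bar>"
      proof (cases "1 \<le> \<bar>y\<bar>")
        case False
        then have "\<bar>y\<bar> * \<bar>y\<bar> \<le> 1 * \<bar>y\<bar>" by (intro mult_right_mono) auto
        then show ?thesis by (simp add: power2_eq_square min_def)
      qed auto
      then show ?thesis using one_minus_exp_lower[of "\<bar>y\<bar>"] by simp
    qed
    then have "integrable lborel (\<lambda>y. (k y / \<bar>y\<bar>) *\<^sub>R min 1 (y\<^sup>2))"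
      by (intro integrable_k_dominated[where C = 2]) auto
    then show ?thesis
      by (subst nn_integral_eq_integral) auto
  qed
  finally show "(\<integral>\<^sup>+x. ennreal (min 1 (x\<^sup>2)) \<partial>levy_measure) < \<infinity>" .
  \<comment> \<open>The drift that cancels the compensator; the Gaussian variance is 0.\<close>
  define b where "b = (LINT y|lborel. (k y / \<bar>y\<bar>) *\<^sub>R (y * indicator {-1..1} y))"
  have int_b: "integrable lborel (\<lambda>y. (k y / \<bar>y\<bar>) *\<^sub>R (y * indicator {-1..1} y))"
  proof (rule integrable_k_dominated[where C = 2])
    show "norm (y * indicator {-1..1} y) \<le> 2 * (1 - exp (- \<bar>y\<bar>))" for y :: real
      using one_minus_exp_lower[of "\<bar>y\<bar>"] by (auto simp: indicator_def min_def split: if_splits)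
  qed auto
  show "\<exists>b s. 0 \<le> s \<and> (\<forall>z. char (distr M borel (Y 1)) z =
        exp (\<i> * of_real (z * b) - of_real (s * z\<^sup>2 / 2) +
             (CLINT x|levy_measure. iexp (z * x) - 1 - \<i> * of_real (z * x * indicator {-1..1} x))))"
  proof (rule exI[of _ b], rule exI[of _ 0], intro conjI allI)
    fix z :: real
    have int_e: "integrable lborel (\<lambda>y. (k y / \<bar>y\<bar>) *\<^sub>R (iexp (z * y) - 1))"
      by (rule integrable_k_dominated[OF _ norm_iexp_minus_one_le]) measurable
    have int_c: "integrable lborel (\<lambda>y. \<i> * of_real z * of_real ((k y / \<bar>y\<bar>) *\<^sub>R (y * indicator {-1..1} y)))"
      by (intro integrable_mult_right integrable_of_real int_b)
    have "(CLINT x|levy_measure. iexp (z * x) - 1 - \<i> * of_real (z * x * indicator {-1..1} x)) =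
        (CLINT y|lborel. (k y / \<bar>y\<bar>) *\<^sub>R (iexp (z * y) - 1 - \<i> * of_real (z * y * indicator {-1..1} y)))"
      unfolding levy_measure_def by (rule integral_density) auto
    also have "\<dots> = (CLINT y|lborel. (k y / \<bar>y\<bar>) *\<^sub>R (iexp (z * y) - 1) -
        \<i> * of_real z * of_real ((k y / \<bar>y\<bar>) *\<^sub>R (y * indicator {-1..1} y)))"
      by (intro Bochner_Integration.integral_cong refl) (simp add: scaleR_conv_of_real algebra_simps)
    also have "\<dots> = - exponent z - \<i> * of_real z * of_real b"
      by (subst Bochner_Integration.integral_diff[OF int_e int_c])
        (simp only: integral_k_char integral_mult_right_zero integral_complex_of_real b_def)
    finally show "char (distr M borel (Y 1)) z =
        exp (\<i> * of_real (z * b) - of_real (0 * z\<^sup>2 / 2) +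
             (CLINT x|levy_measure. iexp (z * x) - 1 - \<i> * of_real (z * x * indicator {-1..1} x)))"
      by (simp add: ch)
  qed simp
qed

text \<open>\<open>k\<close> is bounded by the total mass of \<open>\<tau>\<close>, so near 0 the
  integrand is at most a multiple of \<open>\<bar>x\<bar> powr (p - 1)\<close>. This is integrable
  for every \<open>p > 0\<close>, and the infimum of all these \<open>p\<close> is 0.\<close>

lemma blumenthal_getoor_levy_measure: "blumenthal_getoor_index levy_measure = 0"
proof -
  have "(\<integral>\<^sup>+x\<in>{-1..1}. ennreal (\<bar>x\<bar> powr p) \<partial>levy_measure) < \<infinity>" if p: "0 < p" for p
  proof -
    define C where "C = measure \<tau> UNIV"
    have C: "0 \<le> C" by (simp add: C_def)
    have "(\<integral>\<^sup>+x\<in>{-1..1}. ennreal (\<bar>x\<bar> powr p) \<partial>levy_measure) =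
        (\<integral>\<^sup>+x. ennreal (k x / \<bar>x\<bar>) * (ennreal (\<bar>x\<bar> powr p) * indicator {-1..1} x) \<partial>lborel)"
      unfolding levy_measure_def by (rule nn_integral_density) auto
    also have "\<dots> \<le> (\<integral>\<^sup>+x. ennreal C * (ennreal (x powr (p - 1)) * indicator {0..1} x +
        ennreal ((- x) powr (p - 1)) * indicator {0..1} (- x)) \<partial>lborel)"
    proof (rule nn_integral_mono)
      fix x :: real
      have "k x / \<bar>x\<bar> * \<bar>x\<bar> powr p \<le> C * \<bar>x\<bar> powr (p - 1)"
        using k_le[of x] by (cases "x = 0") (auto simp: powr_diff C_def divide_right_mono mult_right_mono)
      then have "ennreal (k x / \<bar>x\<bar>) * ennreal (\<bar>x\<bar> powr p) \<le> ennreal C * ennreal (\<bar>x\<bar> powr (p - 1))"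
        using C by (simp add: ennreal_mult[symmetric])
      moreover have "ennreal (k x / \<bar>x\<bar>) = 0" if "x = 0" using that by simp
      ultimately show "ennreal (k x / \<bar>x\<bar>) * (ennreal (\<bar>x\<bar> powr p) * indicator {-1..1} x) \<le>
          ennreal C * (ennreal (x powr (p - 1)) * indicator {0..1} x + ennreal ((- x) powr (p - 1)) * indicator {0..1} (- x))"
        by (cases x "0::real" rule: linorder_cases) (auto simp: indicator_def)
    qed
    also have "\<dots> = ennreal C * ((\<integral>\<^sup>+x. ennreal (x powr (p - 1)) * indicator {0..1} x \<partial>lborel) +
        (\<integral>\<^sup>+x. ennreal ((- x) powr (p - 1)) * indicator {0..1} (- x) \<partial>lborel))"
      by (subst nn_integral_cmult, measurable, subst nn_integral_add) measurable
    also have "(\<integral>\<^sup>+x. ennreal ((- x) powr (p - 1)) * indicator {0..1} (- x) \<partial>lborel) =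
        (\<integral>\<^sup>+x. ennreal (x powr (p - 1)) * indicator {0..1} x \<partial>lborel)"
      using nn_integral_real_affine[of "\<lambda>x. ennreal (x powr (p - 1)) * indicator {0..1} x" "-1" 0] by simp
    finally have "(\<integral>\<^sup>+x\<in>{-1..1}. ennreal (\<bar>x\<bar> powr p) \<partial>levy_measure) \<le>
        ennreal C * ((\<integral>\<^sup>+x. ennreal (x powr (p - 1)) * indicator {0..1} x \<partial>lborel) +
        (\<integral>\<^sup>+x. ennreal (x powr (p - 1)) * indicator {0..1} x \<partial>lborel))" .
    moreover have "(\<integral>\<^sup>+x. ennreal (x powr (p - 1)) * indicator {0..1} x \<partial>lborel) < \<infinity>"
    proof -
      have "(\<lambda>x. x powr (p - 1)) absolutely_integrable_on {0..1 :: real}"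
        using p by (intro nonnegative_absolutely_integrable_1 integrable_on_powr_from_0) auto
      then have "integrable lborel (\<lambda>x. indicator {0..1} x *\<^sub>R x powr (p - 1) :: real)"
        by (simp add: set_integrable_def integrable_completion)
      then have "(\<integral>\<^sup>+x. ennreal (indicator {0..1} x *\<^sub>R x powr (p - 1)) \<partial>lborel) < \<infinity>"
        by (subst nn_integral_eq_integral) auto
      moreover have "ennreal (indicator {0..1} x *\<^sub>R x powr (p - 1)) = ennreal (x powr (p - 1)) * indicator {0..1} x" for x :: real
        by (simp add: indicator_def)
      ultimately show ?thesis by simp
    qed
    ultimately show ?thesis
      by (elim le_less_trans) (auto simp: ennreal_mult_less_top)
  qed
  then have "{p. 0 < p \<and> (\<integral>\<^sup>+x\<in>{-1..1}. ennreal (\<bar>x\<bar> powr p) \<partial>levy_measure) < \<infinity>} = {0<..}"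
    by auto
  then show ?thesis
    by (simp add: blumenthal_getoor_index_def)
qed

end

text \<open>Frullani's integral with \<open>w = (b - 1) * s\<close>. The value does not depend on
  \<open>s\<close>, which is why the jump intensity in the self-decomposition has finite mass
  whenever \<open>\<tau>\<close> has.\<close>

lemma nn_integral_exp_kernel_diff:
  assumes s: "s \<noteq> 0" and b: "1 < b"
  shows "(\<integral>\<^sup>+y. ennreal ((exp_kernel s y - exp_kernel s (b * y)) / \<bar>y\<bar>) \<partial>lborel) = ennreal (ln b)"
proof -
  have pos: "(\<integral>\<^sup>+y. ennreal ((exp_kernel s y - exp_kernel s (b * y)) / \<bar>y\<bar>) \<partial>lborel) = ennreal (ln b)"
    if s: "0 < s" for s
  proof -
    have "(\<integral>\<^sup>+y. ennreal ((exp_kernel s y - exp_kernel s (b * y)) / \<bar>y\<bar>) \<partial>lborel) =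
        (\<integral>\<^sup>+y. ennreal (if 0 < y then (1 - exp (- ((b - 1) * s * y))) * exp (- (s * y)) / y else 0) \<partial>lborel)"
    proof (rule nn_integral_cong)
      fix y :: real
      have "exp (- (s * y)) - exp (- (s * (b * y))) = (1 - exp (- ((b - 1) * s * y))) * exp (- (s * y))"
        by (simp add: left_diff_distrib exp_add[symmetric] algebra_simps)
      then show "ennreal ((exp_kernel s y - exp_kernel s (b * y)) / \<bar>y\<bar>) =
          ennreal (if 0 < y then (1 - exp (- ((b - 1) * s * y))) * exp (- (s * y)) / y else 0)"
        using s b by (auto simp: exp_kernel_def zero_less_mult_iff)
    qed
    also have "\<dots> = ennreal (ln (1 + (b - 1) * s / s))"
      by (rule nn_integral_frullani) (use s b in auto)
    finally show ?thesis using s by simp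
  qed
  show ?thesis
  proof (cases "0 < s")
    case True
    then show ?thesis by (rule pos)
  next
    case False
    have "(\<integral>\<^sup>+y. ennreal ((exp_kernel s y - exp_kernel s (b * y)) / \<bar>y\<bar>) \<partial>lborel) =
        (\<integral>\<^sup>+y. ennreal ((exp_kernel (- s) y - exp_kernel (- s) (b * y)) / \<bar>y\<bar>) \<partial>lborel)"
      using nn_integral_real_affine[of "\<lambda>y. ennreal ((exp_kernel s y - exp_kernel s (b * y)) / \<bar>y\<bar>)" "-1" 0]
        exp_kernel_minus[of "- s"]
      by simp
    then show ?thesis using pos[of "- s"] False s by simp
  qed
qed

section \<open>Self-decomposability and approximation by gamma convolutions\<close>

context thorin_measure
begin

lemma self_decomposable_law:
  assumes \<mu>: "real_distribution \<mu>" and ch: "\<And>z. char \<mu> z = exp (- exponent z)"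
  shows "self_decomposable \<mu>"
  unfolding self_decomposable_def
proof (intro conjI \<mu> allI impI)
  fix b :: real assume b: "1 < b"
  \<comment> \<open>The difference of the Levy densities belonging to \<open>z\<close> and to
    \<open>z / b\<close>; it is nonnegative because \<open>k\<close> decreases away from 0 on each
    side.\<close>
  define h where "h y = (k y - k (b * y)) / \<bar>y\<bar>" for y
  have h0: "0 \<le> h y" for y
  proof (cases "y = 0")
    case False
    have "0 < b * y * y" using False b by (auto simp: mult.assoc zero_less_mult_iff linorder_neq_iff)
    moreover have "1 * \<bar>y\<bar> \<le> b * \<bar>y\<bar>" using b by (intro mult_right_mono) auto
    ultimately have "k (b * y) \<le> k y" using b by (intro k_mono) (auto simp: abs_mult)
    then show ?thesis by (simp add: h_def)
  qed (simp add: h_def)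
  have hm[measurable]: "h \<in> borel_measurable borel"
    unfolding h_def[abs_def] by measurable
  define \<Lambda> where "\<Lambda> = density lborel (\<lambda>y. ennreal (h y))"
  have "finite_measure \<Lambda>"
  proof
    have kap: "exp_kernel s (b * y) \<le> exp_kernel s y" for s y
    proof -
      have "s * y \<le> b * (s * y)" if "0 < s * y"
        using mult_right_mono[of 1 b "s * y"] that b by simp
      then show ?thesis using b by (auto simp: exp_kernel_def mult.left_commute[of s b y] zero_less_mult_iff[of b])
    qed
    have "emeasure \<Lambda> (space \<Lambda>) = (\<integral>\<^sup>+y. ennreal (h y) \<partial>lborel)"
      unfolding \<Lambda>_def by (simp add: emeasure_density)
    also have "\<dots> = (\<integral>\<^sup>+y. \<integral>\<^sup>+s. ennreal ((exp_kernel s y - exp_kernel s (b * y)) / \<bar>y\<bar>) \<partial>\<tau> \<partial>lborel)"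
    proof (rule nn_integral_cong)
      fix y
      have i: "integrable \<tau> (\<lambda>s. (exp_kernel s y - exp_kernel s (b * y)) / \<bar>y\<bar>)"
        by (intro integrable_divide_zero Bochner_Integration.integrable_diff integrable_exp_kernel)
      have "h y = (LINT s|\<tau>. (exp_kernel s y - exp_kernel s (b * y)) / \<bar>y\<bar>)"
        unfolding h_def k_def integral_divide_zero
        by (subst Bochner_Integration.integral_diff[OF integrable_exp_kernel integrable_exp_kernel]) (rule refl)
      then show "ennreal (h y) = (\<integral>\<^sup>+s. ennreal ((exp_kernel s y - exp_kernel s (b * y)) / \<bar>y\<bar>) \<partial>\<tau>)"
        using nn_integral_eq_integral[OF i] kap by (simp add: divide_nonneg_nonneg)
    qed
    also have "\<dots> = (\<integral>\<^sup>+s. \<integral>\<^sup>+y. ennreal ((exp_kernel s y - exp_kernel s (b * y)) / \<bar>y\<bar>) \<partial>lborel \<partial>\<tau>)"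
      by (rule tl.Fubini') measurable
    also have "\<dots> = (\<integral>\<^sup>+s. ennreal (ln b) \<partial>\<tau>)"
      using nonzero by (intro nn_integral_cong_AE, eventually_elim) (rule nn_integral_exp_kernel_diff[OF _ b])
    also have "\<dots> \<noteq> \<infinity>"
      by (simp add: emeasure_eq_measure ennreal_mult_eq_top_iff)
    finally show "emeasure \<Lambda> (space \<Lambda>) \<noteq> \<infinity>" .
  qed
  then obtain \<rho> where \<rho>: "real_distribution \<rho>" "\<And>z. char \<rho> z = exp (CLINT x|\<Lambda>. iexp (z * x) - 1)"
    using compound_poisson_exists[of \<Lambda>] by (auto simp: \<Lambda>_def)
  have "char \<mu> z = char \<mu> (z / b) * char \<rho> z" for z
  proof -
    have int: "integrable lborel (\<lambda>y. (k y / \<bar>y\<bar>) *\<^sub>R (iexp (z * y) - 1))" for z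
      by (rule integrable_k_dominated[OF _ norm_iexp_minus_one_le]) measurable
    let ?g = "\<lambda>y. (k y / \<bar>y\<bar>) *\<^sub>R (iexp (z / b * y) - 1)"
    \<comment> \<open>The substitution \<open>y \<rightarrow> b * y\<close> trades the frequency
      \<open>z / b\<close> for a dilation of \<open>k\<close>; the measure
      \<open>dy / \<bar>y\<bar>\<close> is invariant under it.\<close>
    have resc: "b *\<^sub>R ?g (b * y) = (k (b * y) / \<bar>y\<bar>) *\<^sub>R (iexp (z * y) - 1)" for y
      using b by (simp add: abs_mult)
    have int2: "integrable lborel (\<lambda>y. (k (b * y) / \<bar>y\<bar>) *\<^sub>R (iexp (z * y) - 1))"
    proof -
      have "integrable lborel (\<lambda>y. ?g (0 + b * y))"
        by (rule lborel_integrable_real_affine[OF int]) (use b in simp)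
      then have "integrable lborel (\<lambda>y. ?g (b * y))"
        by (simp only: add_0_left)
      then show ?thesis
        unfolding resc[symmetric] by (rule integrable_scaleR_right)
    qed
    have eq2: "(CLINT y|lborel. (k (b * y) / \<bar>y\<bar>) *\<^sub>R (iexp (z * y) - 1)) = - exponent (z / b)"
    proof -
      have "- exponent (z / b) = \<bar>b\<bar> *\<^sub>R (CLINT y|lborel. ?g (0 + b * y))"
        unfolding integral_k_char[symmetric] by (rule lborel_integral_real_affine) (use b in simp)
      also have "\<dots> = (CLINT y|lborel. b *\<^sub>R ?g (b * y))"
        using b by (simp only: integral_scaleR_right add_0_left abs_of_pos)
      finally show ?thesis by (simp only: resc)
    qed
    have "(CLINT x|\<Lambda>. iexp (z * x) - 1) = (CLINT y|lborel. h y *\<^sub>R (iexp (z * y) - 1))"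
      unfolding \<Lambda>_def by (rule integral_density) (auto simp: h0)
    also have "\<dots> = (CLINT y|lborel. (k y / \<bar>y\<bar>) *\<^sub>R (iexp (z * y) - 1) - (k (b * y) / \<bar>y\<bar>) *\<^sub>R (iexp (z * y) - 1))"
      by (intro Bochner_Integration.integral_cong refl) (simp only: h_def diff_divide_distrib scaleR_left_diff_distrib)
    also have "\<dots> = - exponent z + exponent (z / b)"
      by (subst Bochner_Integration.integral_diff[OF int int2]) (simp only: integral_k_char eq2 diff_minus_eq_add)
    finally show ?thesis
      by (simp add: ch \<rho>(2) exp_add[symmetric])
  qed
  with \<rho>(1) show "\<exists>\<rho>. real_distribution \<rho> \<and> (\<forall>z. char \<mu> z = char \<mu> (z / b) * char \<rho> z)"
    by blast
qed

lemma BG0_thorin: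
  assumes Y: "levy_process M Y" and ch: "\<And>z. char (distr M borel (Y 1)) z = exp (- exponent z)"
    and mass: "0 < measure \<tau> UNIV"
  shows "BG0 M Y (measure \<tau> UNIV)"
proof -
  interpret M: prob_space M using Y by (simp add: levy_process_def)
  have "real_distribution (distr M borel (Y 1))"
    using Y by (intro M.real_distribution_distr) (simp add: levy_process_def)
  then have sd: "self_decomposable (distr M borel (Y 1))"
    by (rule self_decomposable_law) (rule ch)
  \<comment> \<open>No mass sits at 0, so the two limits of \<open>k\<close> at 0 add up to the
    total mass.\<close>
  have "measure \<tau> ({0<..} \<union> {..<0}) = measure \<tau> {0<..} + measure \<tau> {..<0}"
    by (rule finite_measure_Union) auto
  moreover have "measure \<tau> ({0<..} \<union> {..<0}) = measure \<tau> UNIV"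
    by (rule finite_measure_eq_AE) (use nonzero in auto)
  ultimately have sum: "measure \<tau> UNIV = measure \<tau> {0<..} + measure \<tau> {..<0}" by simp
  show ?thesis
    unfolding BG0_def
    by (intro conjI Y sd exI[of _ levy_measure] exI[of _ k] exI[of _ "measure \<tau> {0<..}"] exI[of _ "measure \<tau> {..<0}"]
        has_levy_measure_levy_measure ch blumenthal_getoor_levy_measure k_measurable antimono_k mono_k k_right k_left sum mass allI k_nonneg levy_measure_def)
qed

text \<open>The exponents of the rounded measures converge by dominated convergence, and Levy's
  continuity theorem turns this into weak convergence. Positive mass guarantees at least one gamma
  factor.\<close>

lemma gamma_convolution_approximation:
  assumes \<mu>: "real_distribution \<mu>" and ch: "\<And>z. char \<mu> z = exp (- exponent z)"
    and mass: "0 < measure \<tau> UNIV"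
  shows "\<exists>\<mu>s. (\<forall>n. gamma_convolution (\<mu>s n)) \<and> weak_conv_m \<mu>s \<mu>"
proof -
  \<comment> \<open>Rounding away from zero keeps the logarithmic bound that dominates the integrands.\<close>
  define r where "r n s = sgn s * grid n \<bar>s\<bar>" for n s
  have r_abs: "\<bar>s\<bar> \<le> \<bar>r n s\<bar>" "r n s \<noteq> 0" if "s \<noteq> 0" for n s
    using grid_bounds(1)[of "\<bar>s\<bar>" n] that by (auto simp: r_def abs_mult abs_sgn_eq sgn_eq_0_iff)
  have r_lim: "(\<lambda>n. r n s) \<longlonglongrightarrow> s" for s
  proof -
    have "(\<lambda>n. grid n \<bar>s\<bar>) \<longlonglongrightarrow> \<bar>s\<bar>"
      using filterlim_grid[of "\<bar>s\<bar>"] by (simp add: filterlim_at)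
    from tendsto_mult[OF tendsto_const this, of "sgn s"] show ?thesis
      by (simp add: r_def sgn_mult_abs)
  qed
  have r_m[measurable]: "r n \<in> borel_measurable borel" for n
    unfolding r_def[abs_def] grid_def[abs_def] by measurable
  define e where "e n z = (CLINT s|\<tau>. Ln (1 - \<i> * of_real (z / r n s)))" for n z
  have e_lim: "(\<lambda>n. e n z) \<longlonglongrightarrow> exponent z" for z
    unfolding e_def exponent_def
  proof (rule integral_dominated_convergence[OF _ _ integrable_bound_Ln[of z]])
    show "AE s in \<tau>. (\<lambda>n. Ln (1 - \<i> * of_real (z / r n s))) \<longlonglongrightarrow> Ln (1 - \<i> * of_real (z / s))"
      using nonzero
    proof eventually_elim
      case (elim s)
      show ?case
        by (intro tendsto_intros r_lim elim) (auto simp: complex_nonpos_Reals_iff)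
    qed
    show "AE s in \<tau>. norm (Ln (1 - \<i> * of_real (z / r n s))) \<le> ln (1 + \<bar>z\<bar>) + ln (1 + 1 / \<bar>s\<bar>) + pi" for n
      using nonzero
    proof eventually_elim
      case (elim s)
      have "1 / \<bar>r n s\<bar> \<le> 1 / \<bar>s\<bar>"
        using r_abs[OF elim] elim by (intro divide_left_mono) auto
      then have "ln (1 + 1 / \<bar>r n s\<bar>) \<le> ln (1 + 1 / \<bar>s\<bar>)"
        by (intro ln_mono) (auto intro: add_pos_nonneg)
      then show ?case
        using norm_Ln_one_minus_i_le[of z "r n s"] by linarith
    qed
  qed measurable
  have "\<exists>\<mu>'. gamma_convolution \<mu>' \<and> real_distribution \<mu>' \<and> (\<forall>z. char \<mu>' z = exp (- e n z))" for n
  proof -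
    \<comment> \<open>The largest index that \<open>\<bar>s\<bar> \<le> R\<close> can produce;
      \<open>K\<close> collects all rounded values of both signs, the shift \<open>j + 1\<close>
      being that of \<open>grid\<close>.\<close>
    define m where "m = nat \<lfloor>real (Suc n) * R\<rfloor>"
    define K where "K = (\<lambda>(\<sigma>, j). \<sigma> * ((real j + 1) / real (Suc n))) ` ({-1, 1} \<times> {..m})"
    have finK: "finite K" unfolding K_def by (intro finite_imageI finite_cartesian_product) auto
    have rK: "AE s in \<tau>. r n s \<in> K"
      using nonzero bounded
    proof eventually_elim
      case (elim s)
      have "nat \<lfloor>real (Suc n) * \<bar>s\<bar>\<rfloor> \<le> m"
        unfolding m_def using elim by (intro nat_mono floor_mono mult_left_mono) auto
      then have "(sgn s, nat \<lfloor>real (Suc n) * \<bar>s\<bar>\<rfloor>) \<in> {-1, 1} \<times> {..m}"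
        using elim by (auto simp: sgn_if)
      then show ?case
        unfolding K_def by (rule rev_image_eqI) (simp add: r_def grid_def)
    qed
    define a where "a y = measure \<tau> {s. r n s = y}" for y
    have [measurable]: "{s. r n s = y} \<in> sets borel" for y
    proof -
      have "{s. r n s = y} = r n -` {y} \<inter> space borel" by auto
      also have "\<dots> \<in> sets borel" by measurable
      finally show ?thesis .
    qed
    \<comment> \<open>Grid points that receive no mass are dropped, since a gamma law needs a
      positive shape parameter.\<close>
    define K' where "K' = {y \<in> K. 0 < a y}"
    have a0: "a y = 0" if "y \<in> K - K'" for y
      using that measure_nonneg[of \<tau> "{s. r n s = y}"] by (auto simp: K'_def a_def)
    have fin_sum: "(LINT s|\<tau>. F (r n s)) = (\<Sum>y\<in>K'. a y *\<^sub>R F y)"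
      if [measurable]: "F \<in> borel_measurable borel" for F :: "real \<Rightarrow> complex"
    proof -
      have "(LINT s|\<tau>. F (r n s)) = (LINT s|\<tau>. (\<Sum>y\<in>K. indicator {s. r n s = y} s *\<^sub>R F y))"
      proof (rule integral_cong_AE)
        show "AE s in \<tau>. F (r n s) = (\<Sum>y\<in>K. indicator {s. r n s = y} s *\<^sub>R F y)"
          using rK
        proof eventually_elim
          case (elim s)
          have "(\<Sum>y\<in>K. indicator {s. r n s = y} s *\<^sub>R F y) = (\<Sum>y\<in>K. if y = r n s then F y else 0)"
            by (intro sum.cong) (auto simp: indicator_def)
          then show ?case using elim finK by simp
        qed
      qed measurable
      also have "\<dots> = (\<Sum>y\<in>K. LINT s|\<tau>. indicator {s. r n s = y} s *\<^sub>R F y)"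
        by (rule Bochner_Integration.integral_sum) (auto intro!: integrable_scaleR_left integrable_real_indicator simp: emeasure_eq_measure)
      also have "\<dots> = (\<Sum>y\<in>K. a y *\<^sub>R F y)"
      proof (intro sum.cong refl)
        fix y
        have "integrable \<tau> (indicator {s. r n s = y} :: real \<Rightarrow> real)"
          by (intro integrable_real_indicator) (auto simp: emeasure_eq_measure)
        then show "(LINT s|\<tau>. indicator {s. r n s = y} s *\<^sub>R F y) = a y *\<^sub>R F y"
          by (subst integral_scaleR_left) (auto simp: a_def)
      qed
      also have "\<dots> = (\<Sum>y\<in>K'. a y *\<^sub>R F y)"
        by (rule sum.mono_neutral_right) (use finK a0 in \<open>auto simp: K'_def\<close>)
      finally show ?thesis .
    qed
    have "K' \<noteq> {}"
    proof
      assume "K' = {}"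
      then have "(LINT s|\<tau>. 1 :: complex) = 0" using fin_sum[of "\<lambda>_. 1"] by simp
      then show False using mass by simp
    qed
    moreover have "finite K'" using finK by (simp add: K'_def)
    moreover have "y \<noteq> 0 \<and> 0 < a y" if "y \<in> K'" for y
      using that by (auto simp: K'_def K_def)
    ultimately obtain \<mu>' where \<mu>': "gamma_convolution \<mu>'" "real_distribution \<mu>'"
      "\<And>z. char \<mu>' z = exp (- (\<Sum>y\<in>K'. of_real (a y) * Ln (1 - \<i> * of_real (z / y))))"
      using gamma_convolution_finite_sum[of K' a] by blast
    have "e n z = (\<Sum>y\<in>K'. of_real (a y) * Ln (1 - \<i> * of_real (z / y)))" for z
      unfolding e_def by (subst fin_sum) (measurable, simp add: scaleR_conv_of_real)
    then show ?thesis using \<mu>' by auto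
  qed
  then obtain \<mu>s where \<mu>s: "\<And>n. gamma_convolution (\<mu>s n)" "\<And>n. real_distribution (\<mu>s n)"
    "\<And>n z. char (\<mu>s n) z = exp (- e n z)"
    by metis
  have "weak_conv_m \<mu>s \<mu>"
    by (rule levy_continuity[OF \<mu>s(2) \<mu>]) (auto simp: \<mu>s(3) ch intro!: tendsto_intros e_lim)
  with \<mu>s(1) show ?thesis by blast
qed

end

section \<open>Sums of measures\<close>

lemma space_add_measure [simp]: "space (add_measure M N) = UNIV"
  using sets_eq_imp_space_eq[OF sets_add_measure] by simp

text \<open>Only the values of \<open>add_measure\<close> on sets are known from its construction,
  so the integral is built up by monotone induction.\<close>

lemma nn_integral_add_measure:
  assumes M: "sets M = sets borel" and N: "sets N = sets borel"
    and g: "g \<in> borel_measurable borel"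
  shows "(\<integral>\<^sup>+x. g x \<partial>add_measure M N) = (\<integral>\<^sup>+x. g x \<partial>M) + (\<integral>\<^sup>+x. g x \<partial>N)"
  using g
proof (induction g rule: borel_measurable_induct)
  have sp: "space M = UNIV" "space N = UNIV" "space (add_measure M N) = UNIV"
    using M N sets_eq_imp_space_eq[of _ borel] by auto
  have m: "u \<in> borel_measurable M" "u \<in> borel_measurable N" "u \<in> borel_measurable (add_measure M N)"
    if "u \<in> borel_measurable borel" for u :: "real \<Rightarrow> ennreal"
    using that by (simp_all add: measurable_cong_sets[OF M refl] measurable_cong_sets[OF N refl]
        measurable_cong_sets[OF sets_add_measure refl])
  {
    case (cong f g)
    then show ?case by simp
  next
    case (set A)
    then show ?case using M N by (simp add: emeasure_add_measure)
  next
    case (mult u c)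
    have u: "u \<in> borel_measurable borel" by fact
    show ?case
      by (simp only: nn_integral_cmult[OF m(1)[OF u]] nn_integral_cmult[OF m(2)[OF u]]
          nn_integral_cmult[OF m(3)[OF u]] mult.IH distrib_left)
  next
    case (add u v)
    have u: "u \<in> borel_measurable borel" "v \<in> borel_measurable borel" by fact+
    show ?case
      by (simp only: nn_integral_add[OF m(1)[OF u(1)] m(1)[OF u(2)]] nn_integral_add[OF m(2)[OF u(1)] m(2)[OF u(2)]]
          nn_integral_add[OF m(3)[OF u(1)] m(3)[OF u(2)]] add.IH ac_simps)
  next
    case (seq U)
    have "(\<integral>\<^sup>+x. (SUP i. U i) x \<partial>L) = (SUP i. \<integral>\<^sup>+x. U i x \<partial>L)" if "\<And>i. U i \<in> borel_measurable L" for L :: "real measure"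
      using that seq(3) by (simp add: nn_integral_monotone_convergence_SUP SUP_apply[abs_def])
    note conv = this
    have inc: "incseq (\<lambda>i. \<integral>\<^sup>+x. U i x \<partial>L)" for L :: "real measure"
      using seq(3) by (auto simp: incseq_def le_fun_def intro!: nn_integral_mono)
    show ?case
      unfolding conv[OF m(1)[OF seq(1)]] conv[OF m(2)[OF seq(1)]] conv[OF m(3)[OF seq(1)]] seq.IH
      by (rule ennreal_SUP_add[OF inc inc])
  }
qed

lemma AE_add_measure:
  assumes M: "sets M = sets borel" and N: "sets N = sets borel"
    and ae: "AE x in M. P x" "AE x in N. P x" and P[measurable]: "Measurable.pred borel P"
  shows "AE x in add_measure M N. P x"
proof -
  have sp: "space M = UNIV" "space N = UNIV" "space (add_measure M N) = UNIV"
    using M N sets_eq_imp_space_eq[of _ borel] by auto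
  have A: "{x. \<not> P x} \<in> sets borel" by measurable
  have "emeasure M {x. \<not> P x} = 0" "emeasure N {x. \<not> P x} = 0"
    using ae A M N by (auto simp: AE_iff_measurable[OF _ refl] sp)
  then have "emeasure (add_measure M N) {x. \<not> P x} = 0"
    using emeasure_add_measure[OF M N A] by simp
  then show ?thesis
    using A by (subst AE_iff_measurable[OF _ refl]) (auto simp: sp)
qed

lemma integrable_add_measure_iff:
  fixes f :: "real \<Rightarrow> 'b :: {banach, second_countable_topology}"
  assumes M: "sets M = sets borel" and N: "sets N = sets borel"
  shows "integrable (add_measure M N) f \<longleftrightarrow> integrable M f \<and> integrable N f"
proof (cases "f \<in> borel_measurable borel")
  case True
  then have m: "f \<in> borel_measurable M" "f \<in> borel_measurable N" "f \<in> borel_measurable (add_measure M N)"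
    by (simp_all add: measurable_cong_sets[OF M refl] measurable_cong_sets[OF N refl]
        measurable_cong_sets[OF sets_add_measure refl])
  have "(\<integral>\<^sup>+x. ennreal (norm (f x)) \<partial>add_measure M N) = (\<integral>\<^sup>+x. ennreal (norm (f x)) \<partial>M) + (\<integral>\<^sup>+x. ennreal (norm (f x)) \<partial>N)"
    by (rule nn_integral_add_measure[OF M N]) (use True in measurable)
  then show ?thesis using m by (simp add: integrable_iff_bounded)
next
  case False
  then have "\<not> integrable M f" "\<not> integrable (add_measure M N) f"
    by (auto dest!: borel_measurable_integrable simp: measurable_cong_sets[OF M refl] measurable_cong_sets[OF sets_add_measure refl])
  then show ?thesis by simp
qed

text \<open>In the limit step, dominated convergence runs separately under \<open>M\<close> and
  \<open>N\<close> with bound \<open>2 * norm (f x)\<close>; integrability under both follows from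
  that under the sum.\<close>

lemma integral_add_measure:
  fixes f :: "real \<Rightarrow> 'b :: {banach, second_countable_topology}"
  assumes M: "sets M = sets borel" and N: "sets N = sets borel"
    and f: "integrable M f" "integrable N f"
  shows "(LINT x|add_measure M N. f x) = (LINT x|M. f x) + (LINT x|N. f x)"
proof -
  note iff = integrable_add_measure_iff[OF M N]
  have "integrable (add_measure M N) f" using f by (simp add: iff)
  then show ?thesis
  proof (induction rule: integrable_induct)
    case (base A c)
    then have A: "A \<in> sets borel" by simp
    have e: "emeasure (add_measure M N) A = emeasure M A + emeasure N A"
      by (rule emeasure_add_measure[OF M N A])
    then have fin: "emeasure M A < \<infinity>" "emeasure N A < \<infinity>" using base(2) by auto
    have "measure (add_measure M N) A = measure M A + measure N A"
      using e fin by (simp add: measure_def enn2real_plus)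
    moreover have "(LINT x|L. indicator A x *\<^sub>R c) = measure L A *\<^sub>R c"
      if "sets L = sets borel" "emeasure L A < \<infinity>" for L :: "real measure"
    proof -
      have "integrable L (indicator A :: real \<Rightarrow> real)"
        using that A by (intro integrable_real_indicator) auto
      moreover have "A \<inter> space L = A"
        using sets_eq_imp_space_eq[OF that(1)] by auto
      ultimately show ?thesis by simp
    qed
    ultimately show ?case
      using M N fin base by (simp add: scaleR_left_distrib)
  next
    case (add f g)
    then show ?case by (simp add: iff)
  next
    case (lim f s)
    have m: "f \<in> borel_measurable borel" "s i \<in> borel_measurable borel" for i
      using lim(1,4)[THEN borel_measurable_integrable] by (auto simp: measurable_cong_sets[OF sets_add_measure refl])
    have sp: "space M = UNIV" "space N = UNIV" "space (add_measure M N) = UNIV"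
      using M N sets_eq_imp_space_eq[of _ borel] by auto
    have c: "(\<lambda>i. LINT x|L. s i x) \<longlonglongrightarrow> (LINT x|L. f x)" if L: "sets L = sets borel" "integrable L f" for L
    proof (rule integral_dominated_convergence[where w = "\<lambda>x. 2 * norm (f x)"])
      show "integrable L (\<lambda>x. 2 * norm (f x))"
        by (intro integrable_mult_right integrable_norm L)
    qed (use m lim(2,3) in \<open>auto simp: sp measurable_cong_sets[OF L(1) refl]\<close>)
    have "(\<lambda>i. (LINT x|M. s i x) + (LINT x|N. s i x)) \<longlonglongrightarrow> (LINT x|M. f x) + (LINT x|N. f x)"
      using lim(4) M N by (intro tendsto_add c) (auto simp: iff)
    then have "(\<lambda>i. LINT x|add_measure M N. s i x) \<longlonglongrightarrow> (LINT x|M. f x) + (LINT x|N. f x)"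
      by (simp add: lim.IH)
    with c[OF sets_add_measure lim(4)] show ?case by (rule LIMSEQ_unique)
  qed
qed

lemma scale_return_eq_density:
  "scale_measure (ennreal d) (return borel b) = density (return borel b) (\<lambda>_. ennreal d)"
  by (rule measure_eqI) (auto simp: emeasure_density nn_integral_cmult)

lemma
  fixes f :: "real \<Rightarrow> 'b :: {banach, second_countable_topology}"
  assumes d: "0 \<le> d" and f[measurable]: "f \<in> borel_measurable borel"
  shows integral_scale_return: "(LINT x|scale_measure (ennreal d) (return borel b). f x) = d *\<^sub>R f b"
    and integrable_scale_return: "integrable (scale_measure (ennreal d) (return borel b)) f"
proof -
  show "(LINT x|scale_measure (ennreal d) (return borel b). f x) = d *\<^sub>R f b"
    unfolding scale_return_eq_density using d by (subst integral_density) (auto simp: integral_return)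
  show "integrable (scale_measure (ennreal d) (return borel b)) f"
  proof -
    have m: "f \<in> borel_measurable (scale_measure (ennreal d) (return borel b))"
      by (subst measurable_cong_sets[of _ borel borel borel]) auto
    then show ?thesis
      by (auto simp: integrable_iff_bounded nn_integral_scale_measure nn_integral_return ennreal_mult_less_top)
  qed
qed

lemma AE_scale_return:
  assumes [measurable]: "Measurable.pred borel P" and "P b"
  shows "AE x in scale_measure (ennreal d) (return borel b). P x"
  unfolding scale_return_eq_density using assms by (subst AE_density) (auto simp: AE_return)

section \<open>The roots of the quadratic factor\<close>

text \<open>All points \<open>1 - \<i> * t\<close> lie on the vertical line through 1. The signs and
  sizes of the arguments serve to compare branches; the strictly positive real part puts the Laplace
  argument in the open half-plane.\<close>

lemma Ln_one_minus_i_parts: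
  fixes t :: real
  shows "\<bar>Im (Ln (1 - \<i> * of_real t))\<bar> < pi / 2"
    and "0 \<le> t \<Longrightarrow> Im (Ln (1 - \<i> * of_real t)) \<le> 0"
    and "t \<le> 0 \<Longrightarrow> 0 \<le> Im (Ln (1 - \<i> * of_real t))"
    and "t \<noteq> 0 \<Longrightarrow> 0 < Re (Ln (1 - \<i> * of_real t))"
    and "exp (Ln (1 - \<i> * of_real t)) = 1 - \<i> * of_real t"
proof -
  let ?w = "1 - \<i> * complex_of_real t"
  have w0: "?w \<noteq> 0" by (simp add: complex_eq_iff)
  show "exp (Ln ?w) = ?w" using w0 by simp
  show "\<bar>Im (Ln ?w)\<bar> < pi / 2"
    by (rule Re_Ln_pos_lt_imp) simp
  show "t \<le> 0 \<Longrightarrow> 0 \<le> Im (Ln ?w)"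
    using Im_Ln_pos_le[OF w0] by simp
  show "0 \<le> t \<Longrightarrow> Im (Ln ?w) \<le> 0"
    using Im_Ln_pos_lt[OF w0] Im_Ln_le_pi[OF w0] Im_Ln_eq_0[OF w0] \<open>\<bar>Im (Ln ?w)\<bar> < pi / 2\<close> pi_gt_zero
    by (auto simp: not_less)
  assume t: "t \<noteq> 0"
  have "1 < (norm ?w)\<^sup>2" using t by (simp add: cmod_power2)
  then have "1 < norm ?w"
    by (smt (verit) norm_ge_zero power_le_one)
  then show "0 < Re (Ln ?w)" using w0 by simp
qed

locale gnbc_roots =
  fixes \<pi> :: "real measure" and \<beta>p \<beta>m \<theta> :: real
  assumes \<beta>p: "0 < \<beta>p" and \<beta>m: "0 < \<beta>m"
    and gnbc: "gnbc_measure \<pi>" and mass: "emeasure \<pi> {0..1} = ennreal \<theta>" and \<theta>: "0 < \<theta>"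
begin

definition f :: "real \<Rightarrow> real" where
  "f q = 1 / 2 * sqrt ((\<beta>p + \<beta>m)\<^sup>2 - 4 * \<beta>p * \<beta>m * q)"

definition \<beta>0 :: real where "\<beta>0 = (\<beta>m - \<beta>p) / 2"
text \<open>\<open>rp q\<close> and \<open>- rm q\<close> are the zeros of \<open>(1 - x/\<beta>p) (1 + x/\<beta>m) - q\<close>.\<close>

definition rp :: "real \<Rightarrow> real" where "rp q = f q - \<beta>0"
definition rm :: "real \<Rightarrow> real" where "rm q = f q + \<beta>0"

text \<open>Rewriting the radicand around \<open>\<beta>0\<^sup>2\<close> shows that it is
  nonnegative for \<open>q \<le> 1\<close> and gives the product of the roots as a difference of
  squares.\<close>

lemma f_square:
  assumes "q \<le> 1"
  shows "(f q)\<^sup>2 = \<beta>0\<^sup>2 + \<beta>p * \<beta>m * (1 - q)"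
proof -
  have D: "(\<beta>p + \<beta>m)\<^sup>2 - 4 * \<beta>p * \<beta>m * q = 4 * (\<beta>0\<^sup>2 + \<beta>p * \<beta>m * (1 - q))"
    by (simp add: \<beta>0_def power2_eq_square field_simps)
  have "0 \<le> \<beta>p * \<beta>m * (1 - q)" using assms \<beta>p \<beta>m by simp
  then have "0 \<le> (\<beta>p + \<beta>m)\<^sup>2 - 4 * \<beta>p * \<beta>m * q" unfolding D by simp
  then show ?thesis
    by (simp add: f_def power_mult_distrib power_divide D)
qed

lemma f_nonneg: "q \<le> 1 \<Longrightarrow> 0 \<le> f q"
proof -
  assume "q \<le> 1"
  have D: "(\<beta>p + \<beta>m)\<^sup>2 - 4 * \<beta>p * \<beta>m * q = 4 * (\<beta>0\<^sup>2 + \<beta>p * \<beta>m * (1 - q))"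
    by (simp add: \<beta>0_def power2_eq_square field_simps)
  have "0 \<le> \<beta>p * \<beta>m * (1 - q)" using \<open>q \<le> 1\<close> \<beta>p \<beta>m by simp
  then show ?thesis unfolding f_def D by simp
qed

lemma f_range: "f \<in> {0..1} \<rightarrow> {\<bar>\<beta>0\<bar>..(\<beta>p + \<beta>m) / 2}"
proof
  fix q :: real assume q: "q \<in> {0..1}"
  have "\<bar>\<beta>0\<bar>\<^sup>2 \<le> (f q)\<^sup>2"
    using f_square[of q] q \<beta>p \<beta>m by simp
  then have "\<bar>\<beta>0\<bar> \<le> f q"
    by (rule power2_le_imp_le) (use q f_nonneg[of q] in simp)
  moreover have "f q \<le> 1 / 2 * sqrt ((\<beta>p + \<beta>m)\<^sup>2)"
    unfolding f_def using q \<beta>p \<beta>m by (intro mult_left_mono real_sqrt_le_mono) auto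
  ultimately show "f q \<in> {\<bar>\<beta>0\<bar>..(\<beta>p + \<beta>m) / 2}"
    using \<beta>p \<beta>m by simp
qed

text \<open>The upper bounds come from the range of \<open>f\<close>. Inserting the upper bound of
  one root into the product formula gives the lower bound of the other. Linearity of these lower
  bounds in \<open>1 - q\<close> is what transfers logarithmic integrability from
  \<open>\<pi>\<close> to the roots.\<close>

lemma roots:
  assumes q: "0 \<le> q" "q < 1"
  shows "rp q * rm q = \<beta>p * \<beta>m * (1 - q)" and "rm q - rp q = \<beta>m - \<beta>p"
    and "\<beta>p * (1 - q) \<le> rp q" "rp q \<le> \<beta>p" "0 < rp q"
    and "\<beta>m * (1 - q) \<le> rm q" "rm q \<le> \<beta>m" "0 < rm q"
proof -
  show prod: "rp q * rm q = \<beta>p * \<beta>m * (1 - q)"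
    using f_square[of q] q by (simp add: rp_def rm_def power2_eq_square algebra_simps)
  show "rm q - rp q = \<beta>m - \<beta>p"
    by (simp add: rp_def rm_def \<beta>0_def)
  have fq: "\<bar>\<beta>0\<bar> \<le> f q" "f q \<le> (\<beta>p + \<beta>m) / 2"
    using funcset_mem[OF f_range, of q] q by auto
  have nn: "0 \<le> rp q" "0 \<le> rm q"
    using fq(1) unfolding rp_def rm_def by linarith+
  have le: "rp q \<le> \<beta>p" "rm q \<le> \<beta>m"
    using fq(2) unfolding rp_def rm_def \<beta>0_def by (simp_all add: field_simps)
  have pos: "0 < rp q * rm q" unfolding prod using q \<beta>p \<beta>m by simp
  then show p: "0 < rp q" "0 < rm q" using nn by (auto simp: zero_less_mult_iff)
  show "rp q \<le> \<beta>p" "rm q \<le> \<beta>m" by fact+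
  have "\<beta>m * (\<beta>p * (1 - q)) \<le> \<beta>m * rp q"
    using prod mult_right_mono[OF le(2) nn(1)] by (simp add: mult_ac)
  then show "\<beta>p * (1 - q) \<le> rp q" using \<beta>m by simp
  have "\<beta>p * (\<beta>m * (1 - q)) \<le> \<beta>p * rm q"
    using prod mult_right_mono[OF le(1) nn(2)] by (simp add: mult_ac)
  then show "\<beta>m * (1 - q) \<le> rm q" using \<beta>p by simp
qed

section \<open>Finiteness of \<open>\<pi>\<close> and logarithmic integrability of the roots\<close>

lemma sets_pi[measurable_cong, simp]: "sets \<pi> = sets borel"
  using gnbc by (simp add: gnbc_measure_def)

lemma space_pi [simp]: "space \<pi> = UNIV"
  using sets_eq_imp_space_eq[OF sets_pi] by simp

lemma AE_pi: "AE q in \<pi>. 0 \<le> q \<and> q < 1"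
proof -
  have "AE q in \<pi>. q \<in> {0..1}"
    using gnbc by (subst AE_iff_measurable[of "- {0..1}"]) (auto simp: gnbc_measure_def)
  moreover have "AE q in \<pi>. q \<noteq> 1"
    using gnbc by (subst AE_iff_measurable[of "{1}"]) (auto simp: gnbc_measure_def)
  ultimately show ?thesis by eventually_elim auto
qed

lemma mass_pi: "emeasure \<pi> UNIV = ennreal \<theta>"
proof -
  have "emeasure \<pi> UNIV = emeasure \<pi> {0..1}"
    by (rule emeasure_eq_AE) (use AE_pi in auto)
  then show ?thesis by (simp add: mass)
qed

sublocale finite_measure \<pi>
  by standard (simp add: mass_pi)

lemma measure_pi [simp]: "measure \<pi> UNIV = \<theta>"
  using \<theta> by (simp add: measure_def mass_pi)

text \<open>Near 1 this is part of \<open>gnbc_measure\<close>; below \<open>1 / 2\<close> the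
  integrand is at most \<open>ln 2\<close> and the mass is finite.\<close>

lemma integrable_ln_1_minus: "integrable \<pi> (\<lambda>q. \<bar>ln (1 - q)\<bar>)"
proof (rule integrableI_nonneg)
  have "(\<integral>\<^sup>+q. ennreal \<bar>ln (1 - q)\<bar> \<partial>\<pi>) \<le>
      (\<integral>\<^sup>+q. ennreal \<bar>ln (1 - q)\<bar> * indicator {1/2..1} q + ennreal (ln 2) \<partial>\<pi>)"
  proof (rule nn_integral_mono_AE, use AE_pi in eventually_elim)
    fix q :: real assume q: "0 \<le> q \<and> q < 1"
    show "ennreal \<bar>ln (1 - q)\<bar> \<le> ennreal \<bar>ln (1 - q)\<bar> * indicator {1/2..1} q + ennreal (ln 2)"
    proof (cases "1 / 2 \<le> q")
      case True
      then show ?thesis using q by simp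
    next
      case False
      then have "ln (1 / 2) \<le> ln (1 - q)" by (intro ln_mono) auto
      moreover have "ln (1 - q) \<le> 0" using q by simp
      ultimately have "\<bar>ln (1 - q)\<bar> \<le> ln 2" by (simp add: ln_div)
      then show ?thesis using False by (simp add: ennreal_leI)
    qed
  qed
  also have "\<dots> = (\<integral>\<^sup>+q\<in>{1/2..1}. ennreal \<bar>ln (1 - q)\<bar> \<partial>\<pi>) + ennreal (ln 2) * ennreal \<theta>"
    by (subst nn_integral_add) (auto simp: mass_pi)
  also have "\<dots> < \<infinity>"
    using gnbc by (auto simp: gnbc_measure_def ennreal_mult_less_top)
  finally show "(\<integral>\<^sup>+q. ennreal \<bar>ln (1 - q)\<bar> \<partial>\<pi>) < \<infinity>" .
qed auto

lemma f_measurable [measurable]: "f \<in> borel_measurable borel"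
  unfolding f_def[abs_def] by measurable

lemma rp_measurable [measurable]: "rp \<in> borel_measurable borel"
  unfolding rp_def[abs_def] by measurable

lemma rm_measurable [measurable]: "rm \<in> borel_measurable borel"
  unfolding rm_def[abs_def] by measurable

text \<open>Take logarithms in \<open>1 + 1 / r \<le> (1 + 1 / b) * (2 / (1 - q))\<close>.\<close>

lemma ln_root_bound:
  fixes r b q :: real
  assumes "0 < b" "0 \<le> q" "q < 1" "b * (1 - q) \<le> r"
  shows "ln (1 + 1 / r) \<le> ln (1 + 1 / b) + ln 2 + \<bar>ln (1 - q)\<bar>"
proof -
  have pos: "0 < b * (1 - q)" "0 < 1 - q" "0 < 1 + 1 / b" using assms by (auto intro: add_pos_pos)
  have r: "0 < r" using pos assms by linarith
  have "1 / r \<le> 1 / (b * (1 - q))"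
    using pos r assms by (intro divide_left_mono) auto
  also have "\<dots> = 1 / b * (1 / (1 - q))" by simp
  finally have "1 + 1 / r \<le> (1 + 1 / b) * (2 / (1 - q))"
  proof -
    assume a: "1 / r \<le> 1 / b * (1 / (1 - q))"
    have "1 \<le> 1 / (1 - q)" using assms by simp
    moreover have "0 \<le> 1 / b * (1 / (1 - q))" using assms by simp
    moreover have "(1 + 1 / b) * (2 / (1 - q)) = 2 * (1 / (1 - q)) + 2 * (1 / b * (1 / (1 - q)))"
      by (simp add: algebra_simps add_divide_distrib)
    ultimately show ?thesis using a by linarith
  qed
  then have "ln (1 + 1 / r) \<le> ln ((1 + 1 / b) * (2 / (1 - q)))"
    using r by (intro ln_mono) (auto intro: add_pos_pos)
  also have "\<dots> = ln (1 + 1 / b) + ln (2 / (1 - q))"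
    using pos by (intro ln_mult_pos) auto
  also have "ln (2 / (1 - q)) = ln 2 - ln (1 - q)"
    using pos by (simp add: ln_div)
  finally show ?thesis by linarith
qed

lemma integrable_ln_root:
  assumes [measurable]: "r \<in> borel_measurable borel" and "0 < b"
    and r: "\<And>q. 0 \<le> q \<Longrightarrow> q < 1 \<Longrightarrow> b * (1 - q) \<le> \<bar>r q\<bar>"
  shows "integrable \<pi> (\<lambda>q. ln (1 + 1 / \<bar>r q\<bar>))"
proof (rule Bochner_Integration.integrable_bound)
  show "integrable \<pi> (\<lambda>q. ln (1 + 1 / b) + ln 2 + \<bar>ln (1 - q)\<bar>)"
    by (intro Bochner_Integration.integrable_add integrable_ln_1_minus) auto
  show "AE q in \<pi>. norm (ln (1 + 1 / \<bar>r q\<bar>)) \<le> norm (ln (1 + 1 / b) + ln 2 + \<bar>ln (1 - q)\<bar>)"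
    using AE_pi
  proof eventually_elim
    case (elim q)
    have "0 \<le> ln (1 + 1 / \<bar>r q\<bar>)" by simp
    moreover have "ln (1 + 1 / \<bar>r q\<bar>) \<le> ln (1 + 1 / b) + ln 2 + \<bar>ln (1 - q)\<bar>"
      using elim r[of q] \<open>0 < b\<close> by (intro ln_root_bound) auto
    ultimately show ?case by simp
  qed
qed measurable

lemma log_factorization:
  fixes q z :: real
  assumes q: "0 \<le> q" "q < 1"
  defines "L \<equiv> Ln (1 - \<i> * of_real (z / \<beta>p)) + Ln (1 - \<i> * of_real (z / - \<beta>m))"
  shows "of_real (ln (1 - q)) - Ln (1 - of_real q * exp (- L)) =
    L - Ln (1 - \<i> * of_real (z / rp q)) - Ln (1 - \<i> * of_real (z / - rm q))"
  \<comment> \<open>The imaginary parts of both sides differ by less than \<open>2 \<pi>\<close>, so comparing exponentials suffices.\<close>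
proof (rule exp_complex_eqI)
  note r = roots[OF q]
  define A where "A r = 1 - \<i> * complex_of_real (z / r)" for r
  note P = Ln_one_minus_i_parts
  have A0: "A r \<noteq> 0" for r by (simp add: A_def complex_eq_iff)
  have L: "L = Ln (A \<beta>p) + Ln (A (- \<beta>m))" by (simp add: L_def A_def)
  have eL: "exp (- L) = 1 / (A \<beta>p * A (- \<beta>m))"
    using A0 by (simp add: L exp_minus exp_add exp_diff field_simps)
  have ReA: "1 \<le> norm (A r)" for r
    using complex_Re_le_cmod[of "A r"] by (simp add: A_def)
  have nL: "norm (exp (- L)) \<le> 1"
    unfolding eL norm_divide norm_mult using ReA[of \<beta>p] ReA[of "- \<beta>m"] mult_mono[of 1 "norm (A \<beta>p)" 1 "norm (A (- \<beta>m))"]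
    by (simp add: divide_le_eq)
  let ?v = "1 - of_real q * exp (- L)"
  have "norm (of_real q * exp (- L)) \<le> q * 1"
    unfolding norm_mult using nL q by (intro mult_mono) auto
  then have Rev: "0 < Re ?v"
    using complex_Re_le_cmod[of "of_real q * exp (- L)"] q by simp
  then have v0: "?v \<noteq> 0" by (metis less_irrefl zero_complex.sel(1))
  have Imv: "\<bar>Im (Ln ?v)\<bar> < pi / 2" by (rule Re_Ln_pos_lt_imp[OF Rev])
  \<comment> \<open>A root and the matching pole have the same sign, so both arguments lie on the
    same side of 0 and differ by less than \<open>pi / 2\<close>. Two such differences and the
    argument of \<open>?v\<close> stay below \<open>2 * pi\<close>.\<close>
  have same: "\<bar>Im (Ln (A a)) - Im (Ln (A b))\<bar> < pi / 2" if "0 < a * b" for a b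
  proof -
    have "0 \<le> z / a \<and> 0 \<le> z / b \<or> z / a \<le> 0 \<and> z / b \<le> 0"
      using that by (auto simp: zero_less_mult_iff zero_le_divide_iff divide_le_0_iff)
    then show ?thesis
      using P(1)[of "z / a"] P(1)[of "z / b"] P(2)[of "z / a"] P(2)[of "z / b"] P(3)[of "z / a"] P(3)[of "z / b"]
      unfolding A_def by linarith
  qed
  have "\<bar>Im (Ln (A \<beta>p)) - Im (Ln (A (rp q)))\<bar> < pi / 2" "\<bar>Im (Ln (A (- \<beta>m))) - Im (Ln (A (- rm q)))\<bar> < pi / 2"
    using same[of \<beta>p "rp q"] same[of "- \<beta>m" "- rm q"] \<beta>p \<beta>m r(5,8) by simp_all
  then show "\<bar>Im (of_real (ln (1 - q)) - Ln ?v) - Im (L - Ln (1 - \<i> * of_real (z / rp q)) - Ln (1 - \<i> * of_real (z / - rm q)))\<bar> < 2 * pi"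
    using Imv pi_gt_zero unfolding L A_def[symmetric] minus_complex.sel plus_complex.sel Im_complex_of_real by linarith
  have "exp (of_real (ln (1 - q)) - Ln ?v) = of_real (1 - q) / ?v"
    using v0 q by (simp add: exp_diff exp_of_real)
  also have "\<dots> = A \<beta>p * A (- \<beta>m) / (A (rp q) * A (- rm q))"
  proof -
    \<comment> \<open>The product depends on its two parameters only through their difference and
      their product. Multiplying by \<open>1 - q\<close> changes both coefficients into those for
      \<open>\<beta>p\<close> and \<open>\<beta>m\<close>.\<close>
    have expand: "A a * A (- b) = 1 - \<i> * of_real z * of_real ((b - a) / (a * b)) + of_real (z\<^sup>2 / (a * b))"
      if "a \<noteq> 0" "b \<noteq> 0" for a b
      using that by (simp add: A_def power2_eq_square field_simps)
    have "of_real (1 - q) * (A (rp q) * A (- rm q)) = A \<beta>p * A (- \<beta>m) - of_real q"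
    proof -
      have e1: "(rm q - rp q) / (rp q * rm q) * (1 - q) = (\<beta>m - \<beta>p) / (\<beta>p * \<beta>m)"
        unfolding r(1) r(2) using q by simp
      have e2: "z\<^sup>2 / (rp q * rm q) * (1 - q) = z\<^sup>2 / (\<beta>p * \<beta>m)"
        unfolding r(1) using q by simp
      have "of_real (1 - q) * (A (rp q) * A (- rm q)) = of_real (1 - q) -
          \<i> * of_real z * of_real ((rm q - rp q) / (rp q * rm q) * (1 - q)) + of_real (z\<^sup>2 / (rp q * rm q) * (1 - q))"
        using r by (subst expand) (auto simp: algebra_simps)
      also have "\<dots> = A \<beta>p * A (- \<beta>m) - of_real q"
        unfolding e1 e2 using \<beta>p \<beta>m by (subst expand) auto
      finally show ?thesis .
    qed
    moreover have "?v = (A \<beta>p * A (- \<beta>m) - of_real q) / (A \<beta>p * A (- \<beta>m))"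
      unfolding eL using A0 by (simp add: diff_divide_distrib)
    ultimately have v: "?v = of_real (1 - q) * (A (rp q) * A (- rm q)) / (A \<beta>p * A (- \<beta>m))" by simp
    have q1: "complex_of_real (1 - q) \<noteq> 0" using q by simp
    have "a / (a * b / d) = d / b" if "a \<noteq> 0" for a b d :: complex
      using that by simp
    from this[OF q1] show ?thesis unfolding v .
  qed
  also have "\<dots> = exp (L - Ln (A (rp q)) - Ln (A (- rm q)))"
    using A0 by (simp add: L exp_diff exp_add)
  finally show "exp (of_real (ln (1 - q)) - Ln ?v) =
      exp (L - Ln (1 - \<i> * of_real (z / rp q)) - Ln (1 - \<i> * of_real (z / - rm q)))"
    by (simp add: A_def)
qed

end

section \<open>The Thorin measure of the subordinated process\<close>

context gnbc_roots
begin

text \<open>Putting \<open>z = exp (- y)\<close> in the generating function gives the formula for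
  real \<open>y > 0\<close>; holomorphy of the integral over \<open>\<pi>\<close> carries it to the
  half-plane.\<close>

lemma lgnbc_laplace:
  assumes law: "lgnbc_law c \<alpha>0 0 \<pi> \<mu>" and s: "0 < Re s"
  shows "(CLINT x|\<mu>. exp (- s * of_real x)) = exp (- s * of_real c) *
    exp (CLINT q|\<pi>. of_real (ln (1 - q)) - Ln (1 - of_real q * exp (- s * of_real \<alpha>0)))"
proof -
  have \<alpha>0: "0 < \<alpha>0" and \<mu>: "real_distribution \<mu>" and nn: "AE x in \<mu>. 0 \<le> x"
    and pgf: "\<And>z. 0 < z \<Longrightarrow> z \<le> 1 \<Longrightarrow> (LINT x|\<mu>. z powr x) = z powr c * gnbc_pgf 0 \<pi> (z powr \<alpha>0)"
    using law by (auto simp: lgnbc_law_def)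
  interpret \<mu>: real_distribution \<mu> by fact
  define F where "F s q = of_real (ln (1 - q)) - Ln (1 - of_real q * exp (- s * of_real \<alpha>0))" for s :: complex and q :: real
  have F_meas: "F s \<in> borel_measurable \<pi>" for s
    unfolding F_def[abs_def] by measurable
  \<comment> \<open>The argument of \<open>Ln\<close> avoids the cut, and its modulus lies between
    \<open>1 - q\<close> and 2 uniformly in \<open>s\<close>, which yields a dominating function
    free of \<open>s\<close>.\<close>
  have F: "0 < Re (1 - of_real q * exp (- s * of_real \<alpha>0))"
      "norm (F s q) \<le> 2 * \<bar>ln (1 - q)\<bar> + (ln 2 + pi)"
    if q: "0 \<le> q" "q < 1" and s: "0 < Re s" for s q
  proof -
    let ?v = "1 - of_real q * exp (- s * of_real \<alpha>0)"
    have "norm (exp (- s * of_real \<alpha>0)) \<le> 1" using s \<alpha>0 by simp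
    then have n: "norm (of_real q * exp (- s * of_real \<alpha>0)) \<le> q * 1"
      unfolding norm_mult using q by (intro mult_mono) auto
    then show Rev: "0 < Re ?v"
      using complex_Re_le_cmod[of "of_real q * exp (- s * of_real \<alpha>0)"] q by simp
    then have v0: "?v \<noteq> 0" by (metis less_irrefl zero_complex.sel(1))
    have up: "norm ?v \<le> 2"
      using norm_triangle_ineq4[of 1 "of_real q * exp (- s * of_real \<alpha>0)"] n q by simp
    have lo: "1 - q \<le> norm ?v"
      using norm_triangle_ineq2[of 1 "of_real q * exp (- s * of_real \<alpha>0)"] n q by simp
    have "ln (norm ?v) \<le> ln 2" using up v0 by (intro ln_mono) auto
    moreover have "ln (1 - q) \<le> ln (norm ?v)" using lo q by (intro ln_mono) auto
    moreover have "0 \<le> ln (2 :: real)" by simp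
    ultimately have "\<bar>ln (norm ?v)\<bar> \<le> \<bar>ln (1 - q)\<bar> + ln 2" by linarith
    moreover have "\<bar>Im (Ln ?v)\<bar> \<le> pi"
      using mpi_less_Im_Ln[OF v0] Im_Ln_le_pi[OF v0] by simp
    ultimately have "norm (Ln ?v) \<le> \<bar>ln (1 - q)\<bar> + ln 2 + pi"
      using cmod_le[of "Ln ?v"] v0 by simp
    then show "norm (F s q) \<le> 2 * \<bar>ln (1 - q)\<bar> + (ln 2 + pi)"
      unfolding F_def using norm_triangle_ineq4[of "of_real (ln (1 - q))" "Ln ?v"] by simp
  qed
  have F_hol: "(\<lambda>s. CLINT q|\<pi>. F s q) holomorphic_on {s. 0 < Re s}"
  proof (rule holomorphic_on_lebesgue_integral[where g = "\<lambda>q. 2 * \<bar>ln (1 - q)\<bar> + (ln 2 + pi)"])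
    show "open {s. 0 < Re s}" by (rule open_halfspace_Re_gt)
    show "integrable \<pi> (\<lambda>q. 2 * \<bar>ln (1 - q)\<bar> + (ln 2 + pi))"
      by (intro Bochner_Integration.integrable_add integrable_mult_right integrable_ln_1_minus) auto
    show "F s \<in> borel_measurable \<pi>" for s
      by (rule F_meas)
    show "AE q in \<pi>. (\<lambda>s. F s q) holomorphic_on {s. 0 < Re s} \<and>
        (\<forall>s\<in>{s. 0 < Re s}. norm (F s q) \<le> 2 * \<bar>ln (1 - q)\<bar> + (ln 2 + pi))"
      using AE_pi
    proof (eventually_elim, intro conjI ballI)
      fix q :: real assume q: "0 \<le> q \<and> q < 1"
      show "(\<lambda>s. F s q) holomorphic_on {s. 0 < Re s}"
        unfolding F_def using F(1) q
        by (intro holomorphic_intros) (auto simp: complex_nonpos_Reals_iff not_le[symmetric] leD)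
      show "norm (F s q) \<le> 2 * \<bar>ln (1 - q)\<bar> + (ln 2 + pi)" if "s \<in> {s. 0 < Re s}" for s
        using F(2) q that by auto
    qed
  qed
  show ?thesis
    unfolding F_def[symmetric]
  proof (rule laplace_transform_continuation[OF _ _ nn _ _ s])
    show "finite_measure \<mu>" by unfold_locales
    show "(\<lambda>s. exp (- s * of_real c) * exp (CLINT q|\<pi>. F s q)) holomorphic_on {s. 0 < Re s}"
      by (intro holomorphic_intros F_hol)
    show "of_real (LINT x|\<mu>. exp (- y * x)) = exp (- of_real y * of_real c) * exp (CLINT q|\<pi>. F (of_real y) q)"
      if y: "0 < y" for y
    proof -
      define w where "w = exp (- y) powr \<alpha>0"
      have w: "0 < w" "w < 1" using y \<alpha>0 by (auto simp: w_def powr_def)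
      have "(CLINT q|\<pi>. F (of_real y) q) = (CLINT q|\<pi>. of_real (ln ((1 - q) / (1 - q * w))))"
      proof (rule integral_cong_AE)
        show "AE q in \<pi>. F (of_real y) q = of_real (ln ((1 - q) / (1 - q * w)))"
          using AE_pi
        proof eventually_elim
          case (elim q)
          have "q * w \<le> 1 * w" using elim w by (intro mult_right_mono) auto
          then have pos: "0 < 1 - q * w" using w by linarith
          have "exp (- complex_of_real y * of_real \<alpha>0) = of_real w"
            by (simp add: w_def powr_def exp_of_real[symmetric] mult.commute)
          then have "Ln (1 - of_real q * exp (- of_real y * of_real \<alpha>0)) = of_real (ln (1 - q * w))"
            using Ln_of_real[OF pos] by simp
          then show ?case
            using elim pos by (simp add: F_def ln_div)
        qed
        show "F (of_real y) \<in> borel_measurable \<pi>" by (rule F_meas)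
      qed measurable
      also have "\<dots> = of_real (LINT q|\<pi>. ln ((1 - q) / (1 - q * w)))"
        by (rule integral_complex_of_real)
      finally have "exp (CLINT q|\<pi>. F (of_real y) q) = of_real (gnbc_pgf 0 \<pi> w)"
        by (simp add: gnbc_pgf_def exp_of_real)
      moreover have "(LINT x|\<mu>. exp (- y * x)) = exp (- y * c) * gnbc_pgf 0 \<pi> w"
        using pgf[of "exp (- y)"] y by (simp add: w_def powr_def mult.commute)
      ultimately show ?thesis
        by (simp add: exp_of_real[symmetric])
    qed
  qed auto
qed

end

lemma emeasure_uminus_image:
  assumes [measurable]: "B \<in> sets borel"
  shows "uminus ` B = {x :: real. - x \<in> B}" "uminus ` B \<in> sets borel"
proof -
  show eq: "uminus ` B = {x :: real. - x \<in> B}"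
    by (auto simp: image_iff) (metis minus_minus)
  show "uminus ` B \<in> sets borel" unfolding eq by measurable
qed

text \<open>\<open>\<delta>\<close> stands for the surplus \<open>c * \<alpha> - \<theta>\<close>
  that weights the atoms at \<open>\<beta>p\<close> and \<open>- \<beta>m\<close>.\<close>

locale gnbc_thorin = gnbc_roots +
  fixes \<delta> :: real
  assumes \<delta>: "0 \<le> \<delta>"
begin

definition \<tau>p :: "real measure" where
  "\<tau>p = add_measure (distr \<pi> borel rp) (scale_measure (ennreal \<delta>) (return borel \<beta>p))"

definition \<tau>m :: "real measure" where
  "\<tau>m = add_measure (distr \<pi> borel rm) (scale_measure (ennreal \<delta>) (return borel \<beta>m))"

text \<open>The reflection of \<open>\<tau>m\<close> to the negative half-line, which turns the
  two-sided measure into an ordinary sum.\<close>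

definition \<tau>m_neg :: "real measure" where
  "\<tau>m_neg = add_measure (distr \<pi> borel (\<lambda>q. - rm q)) (scale_measure (ennreal \<delta>) (return borel (- \<beta>m)))"

definition \<tau> :: "real measure" where
  "\<tau> = two_sided \<tau>p \<tau>m"

lemma sets_taus [simp, measurable_cong]:
  "sets \<tau>p = sets borel" "sets \<tau>m = sets borel" "sets \<tau>m_neg = sets borel" "sets \<tau> = sets borel"
  by (simp_all add: \<tau>p_def \<tau>m_def \<tau>m_neg_def \<tau>_def)

lemma AE_tau_parts:
  assumes [measurable]: "Measurable.pred borel P" "r \<in> borel_measurable borel"
    and "\<And>q. 0 \<le> q \<Longrightarrow> q < 1 \<Longrightarrow> P (r q)" "P b"
  shows "AE x in add_measure (distr \<pi> borel r) (scale_measure (ennreal \<delta>) (return borel b)). P x"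
proof (rule AE_add_measure)
  show "AE x in distr \<pi> borel r. P x"
    by (subst AE_distr_iff) (use AE_pi assms(3) in auto)
  show "AE x in scale_measure (ennreal \<delta>) (return borel b). P x"
    by (rule AE_scale_return) (use assms in auto)
qed auto

lemma AE_tau_p: "AE x in \<tau>p. 0 < x \<and> x \<le> \<beta>p"
  unfolding \<tau>p_def by (rule AE_tau_parts) (use roots \<beta>p in auto)

lemma AE_tau_m: "AE x in \<tau>m. 0 < x \<and> x \<le> \<beta>m"
  unfolding \<tau>m_def by (rule AE_tau_parts) (use roots \<beta>m in auto)

lemma AE_tau_m_neg: "AE x in \<tau>m_neg. - \<beta>m \<le> x \<and> x < 0"
  unfolding \<tau>m_neg_def by (rule AE_tau_parts) (use roots \<beta>m in auto)

text \<open>The restriction to \<open>{0<..}\<close> in \<open>two_sided\<close> changes nothing, as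
  both parts are carried by the positive half-line.\<close>

lemma tau_eq: "\<tau> = add_measure \<tau>p \<tau>m_neg"
proof (rule measure_eqI)
  fix B assume "B \<in> sets \<tau>"
  then have B[measurable]: "B \<in> sets borel" by simp
  have uB[measurable]: "uminus ` B \<in> sets borel" by (rule emeasure_uminus_image[OF B])
  have "emeasure \<tau> B = emeasure \<tau>p (B \<inter> {0<..}) + emeasure \<tau>m (uminus ` B \<inter> {0<..})"
    unfolding \<tau>_def by (rule emeasure_two_sided) auto
  also have "emeasure \<tau>p (B \<inter> {0<..}) = emeasure \<tau>p B"
    by (rule emeasure_eq_AE) (use AE_tau_p in auto)
  also have "emeasure \<tau>m (uminus ` B \<inter> {0<..}) = emeasure \<tau>m (uminus ` B)"
    by (rule emeasure_eq_AE) (use AE_tau_m in auto)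
  also have "emeasure \<tau>m (uminus ` B) = emeasure \<tau>m_neg B"
    unfolding \<tau>m_def \<tau>m_neg_def
    by (simp add: emeasure_add_measure emeasure_distr vimage_def emeasure_uminus_image(1)[OF B] indicator_def)
  finally show "emeasure \<tau> B = emeasure (add_measure \<tau>p \<tau>m_neg) B"
    by (simp add: emeasure_add_measure)
qed simp

lemma emeasure_tau: "emeasure \<tau> UNIV = ennreal (2 * (\<theta> + \<delta>))"
proof -
  have "emeasure \<tau> UNIV = (ennreal \<theta> + ennreal \<delta>) + (ennreal \<theta> + ennreal \<delta>)"
    unfolding tau_eq \<tau>p_def \<tau>m_neg_def
    by (simp add: emeasure_add_measure emeasure_distr mass_pi)
  also have "\<dots> = ennreal (2 * (\<theta> + \<delta>))"
    using \<theta> \<delta> by (simp add: ennreal_plus[symmetric] del: ennreal_plus)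
  finally show ?thesis .
qed

lemma AE_tau: "AE x in \<tau>. x \<noteq> 0 \<and> - \<beta>m \<le> x \<and> x \<le> \<beta>p"
  unfolding tau_eq
proof (rule AE_add_measure)
  show "AE x in \<tau>p. x \<noteq> 0 \<and> - \<beta>m \<le> x \<and> x \<le> \<beta>p"
    using AE_tau_p by eventually_elim (use \<beta>m in auto)
  show "AE x in \<tau>m_neg. x \<noteq> 0 \<and> - \<beta>m \<le> x \<and> x \<le> \<beta>p"
    using AE_tau_m_neg by eventually_elim (use \<beta>p in auto)
qed auto

lemma
  fixes h :: "real \<Rightarrow> 'b :: {banach, second_countable_topology}"
  assumes [measurable]: "h \<in> borel_measurable borel"
    and int: "integrable \<pi> (\<lambda>q. h (rp q))" "integrable \<pi> (\<lambda>q. h (- rm q))"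
  shows integrable_tau: "integrable \<tau> h"
    and integral_tau: "(LINT x|\<tau>. h x) = (LINT q|\<pi>. h (rp q)) + \<delta> *\<^sub>R h \<beta>p + ((LINT q|\<pi>. h (- rm q)) + \<delta> *\<^sub>R h (- \<beta>m))"
proof -
  have i1: "integrable (distr \<pi> borel rp) h" "integrable (distr \<pi> borel (\<lambda>q. - rm q)) h"
    using int by (simp_all add: integrable_distr_eq)
  have i2: "integrable (scale_measure (ennreal \<delta>) (return borel b)) h" for b
    by (rule integrable_scale_return) (use \<delta> in auto)
  have i: "integrable \<tau>p h" "integrable \<tau>m_neg h"
    unfolding \<tau>p_def \<tau>m_neg_def using i1 i2 by (simp_all add: integrable_add_measure_iff)
  then show "integrable \<tau> h"
    unfolding tau_eq by (simp add: integrable_add_measure_iff)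
  have "(LINT x|\<tau>. h x) = (LINT x|\<tau>p. h x) + (LINT x|\<tau>m_neg. h x)"
    unfolding tau_eq by (rule integral_add_measure) (use i in auto)
  also have "(LINT x|\<tau>p. h x) = (LINT q|\<pi>. h (rp q)) + \<delta> *\<^sub>R h \<beta>p"
    unfolding \<tau>p_def by (subst integral_add_measure) (use i1 i2 \<delta> in \<open>auto simp: integral_distr integral_scale_return\<close>)
  also have "(LINT x|\<tau>m_neg. h x) = (LINT q|\<pi>. h (- rm q)) + \<delta> *\<^sub>R h (- \<beta>m)"
    unfolding \<tau>m_neg_def by (subst integral_add_measure) (use i1 i2 \<delta> in \<open>auto simp: integral_distr integral_scale_return\<close>)
  finally show "(LINT x|\<tau>. h x) = (LINT q|\<pi>. h (rp q)) + \<delta> *\<^sub>R h \<beta>p + ((LINT q|\<pi>. h (- rm q)) + \<delta> *\<^sub>R h (- \<beta>m))" .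
qed

lemma integrable_ln_roots:
  "integrable \<pi> (\<lambda>q. ln (1 + 1 / \<bar>rp q\<bar>))" "integrable \<pi> (\<lambda>q. ln (1 + 1 / \<bar>- rm q\<bar>))"
proof -
  show "integrable \<pi> (\<lambda>q. ln (1 + 1 / \<bar>rp q\<bar>))"
    by (rule integrable_ln_root[OF rp_measurable \<beta>p]) (use roots in force)
  show "integrable \<pi> (\<lambda>q. ln (1 + 1 / \<bar>- rm q\<bar>))"
    by (rule integrable_ln_root[OF borel_measurable_uminus[OF rm_measurable] \<beta>m]) (use roots in force)
qed

sublocale Th: thorin_measure \<tau> "max \<beta>p \<beta>m"
proof (intro thorin_measure.intro thorin_measure_axioms.intro finite_measureI)
  have "space \<tau> = UNIV" using sets_eq_imp_space_eq[OF sets_taus(4)] by simp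
  then show "emeasure \<tau> (space \<tau>) \<noteq> \<infinity>" by (simp add: emeasure_tau)
  show "AE s in \<tau>. s \<noteq> 0" using AE_tau by eventually_elim simp
  show "AE s in \<tau>. \<bar>s\<bar> \<le> max \<beta>p \<beta>m" using AE_tau by eventually_elim (use \<beta>p \<beta>m in auto)
  show "integrable \<tau> (\<lambda>s. ln (1 + 1 / \<bar>s\<bar>))"
    by (rule integrable_tau[OF _ integrable_ln_roots]) measurable
qed simp

lemma integrable_Ln_root:
  assumes [measurable]: "r \<in> borel_measurable borel" and ln: "integrable \<pi> (\<lambda>q. ln (1 + 1 / \<bar>r q\<bar>))"
  shows "integrable \<pi> (\<lambda>q. Ln (1 - \<i> * of_real (z / r q)))"
proof (rule Bochner_Integration.integrable_bound)
  show "integrable \<pi> (\<lambda>q. ln (1 + \<bar>z\<bar>) + ln (1 + 1 / \<bar>r q\<bar>) + pi)"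
    by (intro Bochner_Integration.integrable_add ln) auto
qed (auto intro!: AE_I2 order_trans[OF norm_Ln_one_minus_i_le] simp del: of_real_divide)

definition L :: "real \<Rightarrow> complex" where
  "L z = Ln (1 - \<i> * of_real (z / \<beta>p)) + Ln (1 - \<i> * of_real (z / - \<beta>m))"

text \<open>\<open>log_factorization\<close> integrated over \<open>\<pi>\<close>: its constant term
  contributes \<open>\<theta> * L z\<close>, and the two atoms contribute
  \<open>\<delta> * L z\<close>.\<close>

lemma exponent_eq:
  "Th.exponent z = of_real (\<theta> + \<delta>) * L z -
    (CLINT q|\<pi>. of_real (ln (1 - q)) - Ln (1 - of_real q * exp (- L z)))"
proof -
  have int: "integrable \<pi> (\<lambda>q. Ln (1 - \<i> * of_real (z / rp q)))" "integrable \<pi> (\<lambda>q. Ln (1 - \<i> * of_real (z / - rm q)))"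
    using integrable_Ln_root[OF rp_measurable integrable_ln_roots(1)]
      integrable_Ln_root[OF borel_measurable_uminus[OF rm_measurable] integrable_ln_roots(2)]
    by auto
  have "(CLINT q|\<pi>. of_real (ln (1 - q)) - Ln (1 - of_real q * exp (- L z))) =
      (CLINT q|\<pi>. L z - Ln (1 - \<i> * of_real (z / rp q)) - Ln (1 - \<i> * of_real (z / - rm q)))"
  proof (rule integral_cong_AE)
    show "AE q in \<pi>. of_real (ln (1 - q)) - Ln (1 - of_real q * exp (- L z)) =
        L z - Ln (1 - \<i> * of_real (z / rp q)) - Ln (1 - \<i> * of_real (z / - rm q))"
      using AE_pi by eventually_elim (unfold L_def, rule log_factorization, auto)
  qed measurable
  also have "\<dots> = of_real \<theta> * L z - (CLINT q|\<pi>. Ln (1 - \<i> * of_real (z / rp q))) - (CLINT q|\<pi>. Ln (1 - \<i> * of_real (z / - rm q)))"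
    by (subst Bochner_Integration.integral_diff, (intro Bochner_Integration.integrable_diff int; simp), rule int,
       subst Bochner_Integration.integral_diff, simp, rule int) (simp add: scaleR_conv_of_real)
  moreover have "Th.exponent z = (CLINT q|\<pi>. Ln (1 - \<i> * of_real (z / rp q))) + \<delta> *\<^sub>R Ln (1 - \<i> * of_real (z / \<beta>p)) +
      ((CLINT q|\<pi>. Ln (1 - \<i> * of_real (z / - rm q))) + \<delta> *\<^sub>R Ln (1 - \<i> * of_real (z / - \<beta>m)))"
    unfolding Th.exponent_def by (rule integral_tau[OF _ int]) measurable
  ultimately show ?thesis
    by (simp only: L_def scaleR_conv_of_real of_real_add) (simp add: algebra_simps)
qed

end

text \<open>The sum of the two principal logarithms is continuous in \<open>z\<close> and vanishes
  at 0, so it is the logarithm that governs all times.\<close>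

lemma bilateral_gamma_char:
  assumes X: "bilateral_gamma_process M X \<alpha> \<beta>p \<alpha> \<beta>m" and u: "0 \<le> u"
  shows "char (distr M borel (X u)) z =
    exp (of_real u * (- of_real \<alpha> * (Ln (1 - \<i> * of_real (z / \<beta>p)) + Ln (1 - \<i> * of_real (z / - \<beta>m)))))"
proof (rule levy_process_char_exp[OF _ _ _ _ u])
  show "levy_process M X" using X by (simp add: bilateral_gamma_process_def)
  have "0 < \<beta>p" "0 < \<beta>m" using X by (simp_all add: bilateral_gamma_process_def)
  then show "continuous_on UNIV (\<lambda>z. - of_real \<alpha> * (Ln (1 - \<i> * of_real (z / \<beta>p)) + Ln (1 - \<i> * of_real (z / - \<beta>m))))"
    by (intro continuous_intros) (auto simp: complex_nonpos_Reals_iff)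
  show "char (distr M borel (X 1)) z =
      exp (- of_real \<alpha> * (Ln (1 - \<i> * of_real (z / \<beta>p)) + Ln (1 - \<i> * of_real (z / - \<beta>m))))" for z
  proof -
    have "1 - \<i> * of_real (z / \<beta>p) \<noteq> 0" "1 + \<i> * of_real (z / \<beta>m) \<noteq> 0"
      by (simp_all add: complex_eq_iff)
    then show ?thesis
      using X by (simp add: bilateral_gamma_process_def powr_def exp_add[symmetric] algebra_simps)
  qed
qed simp

context thorin_measure
begin

lemma integrable_inverse_large:
  "integrable \<tau> (\<lambda>x. indicator {x. 1 \<le> \<bar>x\<bar>} x * (1 / x) :: real)"
proof (rule integrable_const_bound[where B = 1])
  show "AE x in \<tau>. norm (indicator {x. 1 \<le> \<bar>x\<bar>} x * (1 / x) :: real) \<le> 1"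
    by (intro AE_I2) (auto simp: indicator_def divide_le_eq)
qed measurable

text \<open>The truncation term is integrable by itself, so it splits off; the drift
  \<open>b\<close> is its integral and cancels it.\<close>

lemma exponent_truncated:
  assumes b: "b = (LINT x:{x. 1 \<le> \<bar>x\<bar>}|\<tau>. 1 / x)"
  shows "\<i> * of_real (z * b) - (CLINT x|\<tau>. Ln (1 - \<i> * of_real (z / x)) +
    \<i> * of_real (z / x * indicator {x. 1 \<le> \<bar>x\<bar>} x)) = - exponent z"
proof -
  have eq: "\<i> * of_real (z / x * indicator {x. 1 \<le> \<bar>x\<bar>} x) =
      \<i> * of_real z * complex_of_real (indicator {x. 1 \<le> \<bar>x\<bar>} x * (1 / x))" for x
    by simp
  have "(CLINT x|\<tau>. Ln (1 - \<i> * of_real (z / x)) + \<i> * of_real (z / x * indicator {x. 1 \<le> \<bar>x\<bar>} x)) =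
      exponent z + (CLINT x|\<tau>. \<i> * of_real z * complex_of_real (indicator {x. 1 \<le> \<bar>x\<bar>} x * (1 / x)))"
    unfolding eq exponent_def
    by (intro Bochner_Integration.integral_add integrable_Ln integrable_mult_right integrable_of_real integrable_inverse_large)
  also have "(CLINT x|\<tau>. \<i> * of_real z * complex_of_real (indicator {x. 1 \<le> \<bar>x\<bar>} x * (1 / x))) =
      \<i> * of_real z * of_real b"
    unfolding b set_lebesgue_integral_def real_scaleR_def
    by (simp only: integral_mult_right_zero integral_complex_of_real)
  finally show ?thesis by simp
qed

lemma thorin_integrability:
  "(\<integral>\<^sup>+x\<in>{x. \<bar>x\<bar> \<le> 1}. ennreal (1 + \<bar>ln \<bar>x\<bar>\<bar>) \<partial>\<tau>) +
    (\<integral>\<^sup>+x\<in>{x. 1 < \<bar>x\<bar>}. ennreal (1 / x\<^sup>2) \<partial>\<tau>) < \<infinity>"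
proof -
  have "(\<integral>\<^sup>+x\<in>{x. \<bar>x\<bar> \<le> 1}. ennreal (1 + \<bar>ln \<bar>x\<bar>\<bar>) \<partial>\<tau>) \<le> (\<integral>\<^sup>+x. ennreal (1 + ln (1 + 1 / \<bar>x\<bar>)) \<partial>\<tau>)"
  proof (rule nn_integral_mono_AE, use nonzero in eventually_elim)
    fix x :: real assume x: "x \<noteq> 0"
    show "ennreal (1 + \<bar>ln \<bar>x\<bar>\<bar>) * indicator {x. \<bar>x\<bar> \<le> 1} x \<le> ennreal (1 + ln (1 + 1 / \<bar>x\<bar>))"
    proof (cases "\<bar>x\<bar> \<le> 1")
      case True
      have "ln (1 / \<bar>x\<bar>) \<le> ln (1 + 1 / \<bar>x\<bar>)" using x by (intro ln_mono) auto
      moreover have "ln \<bar>x\<bar> \<le> 0" using x True by simp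
      ultimately have "\<bar>ln \<bar>x\<bar>\<bar> \<le> ln (1 + 1 / \<bar>x\<bar>)" using x by (simp add: ln_div)
      then show ?thesis using True by (simp add: ennreal_leI)
    qed simp
  qed
  also have "\<dots> < \<infinity>"
  proof -
    have "integrable \<tau> (\<lambda>x. 1 + ln (1 + 1 / \<bar>x\<bar>))"
      by (intro Bochner_Integration.integrable_add integrable_ln) simp
    then show ?thesis by (subst nn_integral_eq_integral) (auto intro!: AE_I2 add_nonneg_nonneg)
  qed
  finally have 1: "(\<integral>\<^sup>+x\<in>{x. \<bar>x\<bar> \<le> 1}. ennreal (1 + \<bar>ln \<bar>x\<bar>\<bar>) \<partial>\<tau>) < \<infinity>" .
  have "(\<integral>\<^sup>+x\<in>{x. 1 < \<bar>x\<bar>}. ennreal (1 / x\<^sup>2) \<partial>\<tau>) \<le> (\<integral>\<^sup>+x. 1 \<partial>\<tau>)"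
  proof (rule nn_integral_mono)
    fix x :: real
    have "1 / x\<^sup>2 \<le> 1" if "1 < \<bar>x\<bar>"
      using that one_le_power[of "\<bar>x\<bar>" 2] by (simp add: divide_le_eq)
    then show "ennreal (1 / x\<^sup>2) * indicator {x. 1 < \<bar>x\<bar>} x \<le> 1"
      using ennreal_leI[of "1 / x\<^sup>2" 1] by (auto simp: indicator_def)
  qed
  also have "\<dots> < \<infinity>" by (simp add: emeasure_eq_measure)
  finally show ?thesis using 1 by simp
qed

end

lemma (in gnbc_thorin) measure_support_tau: "measure_support \<tau> \<subseteq> {- \<beta>m..\<beta>p}"
proof
  fix x assume x: "x \<in> measure_support \<tau>"
  have "emeasure \<tau> (- {- \<beta>m..\<beta>p}) = emeasure \<tau> {}"
    by (rule emeasure_eq_AE) (use AE_tau in auto)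
  moreover have "open (- {- \<beta>m..\<beta>p})" by auto
  ultimately show "x \<in> {- \<beta>m..\<beta>p}"
    using x unfolding measure_support_def by (metis (mono_tags, lifting) ComplI emeasure_empty less_irrefl mem_Collect_eq)
qed

text \<open>Conditioning makes the characteristic function a Laplace transform of
  \<open>T 1\<close>, which \<open>lgnbc_laplace\<close> evaluates and \<open>exponent_eq\<close>
  rewrites through \<open>\<tau>\<close>.\<close>

lemma (in gnbc_thorin) char_subordinated:
  assumes sub: "subordination M X T Y" and X: "bilateral_gamma_process M X \<alpha> \<beta>p \<alpha> \<beta>m"
    and law: "lgnbc_law c (1 / \<alpha>) 0 \<pi> (distr M borel (T 1))" and \<delta>_eq: "\<theta> + \<delta> = c * \<alpha>"
  shows "char (distr M borel (Y 1)) z = exp (- Th.exponent z)"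
proof -
  interpret S: subordination M X T Y by fact
  have \<alpha>: "0 < \<alpha>" using X by (simp add: bilateral_gamma_process_def)
  have T1[measurable]: "T 1 \<in> borel_measurable M"
    by (rule levy_processD(2)[OF S.T]) simp
  have "char (distr M borel (Y 1)) z = (CLINT \<omega>|M. exp (of_real (T 1 \<omega>) * (- of_real \<alpha> * L z)))"
    by (rule S.char_Y) (use bilateral_gamma_char[OF X] in \<open>auto simp: L_def\<close>)
  also have "\<dots> = (CLINT x|distr M borel (T 1). exp (- (of_real \<alpha> * L z) * of_real x))"
    by (subst integral_distr) (auto simp: mult_ac)
  also have "\<dots> = exp (- Th.exponent z)"
  \<comment> \<open>At \<open>z = 0\<close> the argument \<open>\<alpha> * L z\<close> is 0, outside
    the open half-plane, but both sides are 1.\<close>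
  proof (cases "z = 0")
    case True
    interpret D: prob_space "distr M borel (T 1)" by (rule S.prob_space_distr) measurable
    show ?thesis using D.prob_space by (simp add: True L_def Th.exponent_def)
  next
    case False
    have "0 < Re (L z)"
      using Ln_one_minus_i_parts(4)[of "z / \<beta>p"] Ln_one_minus_i_parts(4)[of "z / - \<beta>m"] False \<beta>p \<beta>m
      by (simp add: L_def del: Re_Ln of_real_divide)
    then have "0 < Re (of_real \<alpha> * L z)" using \<alpha> by simp
    from lgnbc_laplace[OF law this]
    have "(CLINT x|distr M borel (T 1). exp (- (of_real \<alpha> * L z) * of_real x)) =
        exp (- (of_real \<alpha> * L z) * of_real c) *
        exp (CLINT q|\<pi>. of_real (ln (1 - q)) - Ln (1 - of_real q * exp (- (of_real \<alpha> * L z) * of_real (1 / \<alpha>))))" .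
    \<comment> \<open>The lattice span \<open>1 / \<alpha>\<close> of \<open>T 1\<close> cancels the
      shape \<open>\<alpha>\<close>, leaving the reciprocal of the quadratic factor as
      \<open>exp (- L z)\<close>.\<close>
    also have "- (of_real \<alpha> * L z) * of_real (1 / \<alpha>) = - L z" using \<alpha> by simp
    also have "- (of_real \<alpha> * L z) * of_real c = - (of_real (\<theta> + \<delta>) * L z)"
      by (simp add: \<delta>_eq)
    finally show ?thesis by (simp add: exponent_eq exp_add[symmetric] exp_diff)
  qed
  finally show ?thesis .
qed

theorem theorem7:
  fixes M :: "'a measure"
    and X T Y :: "real \<Rightarrow> 'a \<Rightarrow> real"
    and \<alpha> \<beta>p \<beta>m c \<theta> \<beta>0 c' :: real
    and \<pi> \<tau>p \<tau>m \<tau> :: "real measure"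
    and f :: "real \<Rightarrow> real"
  assumes "0 < \<alpha>" and "0 < \<beta>p" and "0 < \<beta>m"
    and X: "bilateral_gamma_process M X \<alpha> \<beta>p \<alpha> \<beta>m"
    and T: "lgnbc_subordinator M T c (1 / \<alpha>) 0 \<pi>"
    and indep: "indep_processes M X T"
    and \<theta>: "emeasure \<pi> {0..1} = ennreal \<theta>" "0 < \<theta>" "\<theta> \<le> c * \<alpha>"
    and Y: "\<And>t. 0 \<le> t \<Longrightarrow> Y t \<in> borel_measurable M"
      "AE \<omega> in M. \<forall>t\<ge>0. Y t \<omega> = X (T t \<omega>) \<omega>"
    and \<beta>0: "\<beta>0 = (\<beta>m - \<beta>p) / 2"
    and f: "f = (\<lambda>x. 1 / 2 * sqrt ((\<beta>p + \<beta>m)\<^sup>2 - 4 * \<beta>p * \<beta>m * x))"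
    and \<tau>p: "\<tau>p = add_measure (left_translate (distr \<pi> borel f) \<beta>0)
                 (scale_measure (ennreal (c * \<alpha> - \<theta>)) (return borel \<beta>p))"
    and \<tau>m: "\<tau>m = add_measure (left_translate (distr \<pi> borel f) (- \<beta>0))
                 (scale_measure (ennreal (c * \<alpha> - \<theta>)) (return borel \<beta>m))"
    and \<tau>: "\<tau> = two_sided \<tau>p \<tau>m"
    and c': "c' = (LINT x:{x. 1 \<le> \<bar>x\<bar>}|\<tau>. 1 / x)"
  shows "f \<in> {0..1} \<rightarrow> {\<bar>\<beta>0\<bar>..(\<beta>p + \<beta>m) / 2} \<and>
    thorin_process M Y \<and>
    has_thorin_triplet_0 M Y c' \<tau>p \<tau>m \<and>
    measure_support \<tau> \<subseteq> {- \<beta>m..\<beta>p} \<and>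
    BG0 M Y (2 * c * \<alpha>)"
proof -
  have T_law: "lgnbc_law c (1 / \<alpha>) 0 \<pi> (distr M borel (T 1))" and T_levy: "levy_process M T"
    using T by (simp_all add: lgnbc_subordinator_def)
  have X_levy: "levy_process M X" using X by (simp add: bilateral_gamma_process_def)
  have T1: "T 1 \<in> borel_measurable M" using T_levy by (simp add: levy_process_def)
  have sub: "subordination M X T Y"
  proof
    show "AE \<omega> in M. 0 \<le> T 1 \<omega>"
      using T_law T1 by (subst (asm) lgnbc_law_def) (simp add: AE_distr_iff)
  qed (use X_levy T_levy indep Y in auto)
  then interpret S: subordination M X T Y .
  interpret G: gnbc_thorin \<pi> \<beta>p \<beta>m \<theta> "c * \<alpha> - \<theta>"
    by unfold_locales (use assms(1-3) \<theta> T_law in \<open>auto simp: lgnbc_law_def\<close>)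
  have f': "f = G.f" by (simp add: f G.f_def[abs_def])
  have \<beta>0': "\<beta>0 = G.\<beta>0" by (simp add: \<beta>0 G.\<beta>0_def)
  \<comment> \<open>Pushing forward by \<open>f\<close> and then translating by
    \<open>\<beta>0\<close> is pushing forward by the root \<open>rp\<close>; translation by
    \<open>- \<beta>0\<close> gives \<open>rm\<close>.\<close>
  have \<tau>p': "\<tau>p = G.\<tau>p"
    unfolding \<tau>p G.\<tau>p_def left_translate_def f' \<beta>0'
    by (subst distr_distr) (auto simp: o_def G.rp_def[abs_def])
  have \<tau>m': "\<tau>m = G.\<tau>m"
    unfolding \<tau>m G.\<tau>m_def left_translate_def f' \<beta>0'
    by (subst distr_distr) (auto simp: o_def G.rm_def[abs_def])
  have \<tau>': "\<tau> = G.\<tau>" by (simp add: \<tau> G.\<tau>_def \<tau>p' \<tau>m')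
  have ch: "char (distr M borel (Y 1)) z = exp (- G.Th.exponent z)" for z
    by (rule G.char_subordinated[OF sub X T_law]) simp
  \<comment> \<open>Each side carries
    \<open>\<theta> + (c * \<alpha> - \<theta>) = c * \<alpha>\<close>.\<close>
  have mass: "measure G.\<tau> UNIV = 2 * c * \<alpha>"
    using G.emeasure_tau \<theta> by (simp add: measure_def mult.assoc)
  have pos: "0 < measure G.\<tau> UNIV" using mass \<theta> by (simp add: mult.assoc)
  have Y_dist: "real_distribution (distr M borel (Y 1))"
    using Y(1)[of 1] by (intro S.real_distribution_distr) simp
  have "thorin_process M Y"
    unfolding thorin_process_def
    using S.levy_process_Y G.Th.gamma_convolution_approximation[OF Y_dist ch pos] by simp
  moreover have "has_thorin_triplet_0 M Y c' \<tau>p \<tau>m"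
    unfolding has_thorin_triplet_0_def Let_def \<tau>[symmetric] \<tau>'
  proof (intro conjI allI)
    have "emeasure G.\<tau>p {..0} = emeasure G.\<tau>p {}" "emeasure G.\<tau>m {..0} = emeasure G.\<tau>m {}"
      by (rule emeasure_eq_AE; use G.AE_tau_p G.AE_tau_m in auto)+
    then show "emeasure \<tau>p {..0} = 0" "emeasure \<tau>m {..0} = 0"
      by (simp_all add: \<tau>p' \<tau>m')
    show "char (distr M borel (Y 1)) z = exp (\<i> * of_real (z * c') -
        (CLINT x|G.\<tau>. Ln (1 - \<i> * of_real (z / x)) + \<i> * of_real (z / x * indicator {x. 1 \<le> \<bar>x\<bar>} x)))" for z
      unfolding ch G.Th.exponent_truncated[OF c'[unfolded \<tau>']] ..
  qed (use G.Th.thorin_integrability in \<open>auto simp: \<tau>p' \<tau>m'\<close>)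
  moreover have "BG0 M Y (2 * c * \<alpha>)"
    using G.Th.BG0_thorin[OF S.levy_process_Y ch pos] by (simp add: mass)
  ultimately show ?thesis
    using G.f_range G.measure_support_tau by (simp add: f' \<beta>0' \<tau>')
qed

end
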